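(* Let $\alpha\in(\frac12,1)$, $\gamma=1/(2\alpha)$, and let $B\colon[0,T]\times\mathbb{R}^N\to\mathbb{R}^N$ be a measurable and bounded vector field. Then for every $\phi\in\mathcal{B}_b(\mathbb{R}^N)$ and $0<t\le T$ there exists a unique solution $u_s^\phi(t,x)$, $s\in[0,t]$, $x\in\mathbb{R}^N$, of $$u^\phi_s(t,x)=R_{s,t}\phi(x)+\int_s^tR_{s,r}\big(\langle B(r,\cdot),\nabla^\top u^\phi_r(t,\cdot)\rangle\big)(x)\,dr,\qquad s\in[0,t],\ x\in\mathbb{R}^N,$$ such that the function $(s,x)\mapsto u^\phi_{t-s}(t,x)$ belongs to $\Lambda_1^\gamma(0,t]$.
   Context: Fix $N\in\mathbb{N}$, $T>0$ and a complete probability space $(\Omega,\mathcal{F},\mathbb{P})$. $W=(\beta^1,\dots,\beta^N)^\top$ is a standard $N$-dimensional Brownian motion and $L=(L_t)_{t\ge0}$ is a strictly $\alpha$-stable subordinator (increasing Lévy process) independent of $W$, with $\mathbb{E}[e^{iuL_1}]=\exp\{-\bar\gamma^\alpha|u|^\alpha(1-i\tan\frac{\pi\alpha}{2}\,\mathrm{sign}\,u)\}$, $u\in\mathbb{R}$, for some $\bar\gamma>0$. $W_L=(W_{L_t})_{t\ge0}$. $A=-\mathrm{diag}[\lambda_1,\dots,\lambda_N]$ with $0<\lambda_1\le\dots\le\lambda_N$, $Q=\mathrm{diag}[\sigma_1^2,\dots,\sigma_N^2]$ with $\sigma_n^2>0$. A continuous function $f\colon[0,T]\to\mathbb{R}^N$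 is fixed. $\mathcal{B}_b(\mathbb{R}^N)$ denotes the real-valued bounded Borel functions; $C_b^1(\mathbb{R}^N)$ the bounded $C^1$ functions with bounded first derivatives. $Z^{s,x}=(Z^{s,x}_t)_{t\in[s,T]}$ is the unique solution of $dZ_t^{s,x}=(AZ_t^{s,x}+f(t))dt+\sqrt{Q}\,dW_{L_t}$, $Z_s^{s,x}=x$, and $R_{s,t}\phi(x)=\mathbb{E}[\phi(Z_t^{s,x})]$ for $0\le s\le t\le T$, $\phi\in\mathcal{B}_b(\mathbb{R}^N)$. $\nabla^\top$ is the (column) gradient in $x$. $\Lambda_1^\gamma(0,t]$ is the set of measurable $V\colon(0,t]\times\mathbb{R}^N\to\mathbb{R}$ such that $V(\cdot,x)$ is continuous on $(0,t]$ for every $x$, $V(s,\cdot)\in C_b^1(\mathbb{R}^N)$ for every $s\in(0,t]$, and $\sup_{s\in(0,t]}s^\gamma\big(\|V(s,\cdot)\|_\infty+\sup_{i}\|\partial_{x_i}V(s,\cdot)\|_\infty\big)<\infty$. *)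

theory Defs
  imports "HOL-Probability.Probability"
begin

subsection \<open>Brownian motion and stable subordinators\<close>

text \<open>A process is a map from time to random variables; only times in \<open>{0..}\<close> are relevant.\<close>

definition independent_increments ::
    "'w measure \<Rightarrow> (real \<Rightarrow> 'w \<Rightarrow> real) \<Rightarrow> bool" where
  "independent_increments M X \<longleftrightarrow>
     (\<forall>(n::nat) (\<tau>::nat \<Rightarrow> real). 0 \<le> \<tau> 0 \<and> mono \<tau> \<longrightarrow>
        prob_space.indep_vars M (\<lambda>_. borel) (\<lambda>i \<omega>. X (\<tau> (Suc i)) \<omega> - X (\<tau> i) \<omega>) {..<n})"

definition real_brownian_motion :: "'w measure \<Rightarrow> (real \<Rightarrow> 'w \<Rightarrow> real) \<Rightarrow> bool" where
  "real_brownian_motion M \<beta> \<longleftrightarrow>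
     (\<forall>t\<ge>0. \<beta> t \<in> borel_measurable M) \<and>
     (AE \<omega> in M. \<beta> 0 \<omega> = 0) \<and>
     independent_increments M \<beta> \<and>
     (\<forall>s t. 0 \<le> s \<and> s < t \<longrightarrow>
        distributed M lborel (\<lambda>\<omega>. \<beta> t \<omega> - \<beta> s \<omega>) (normal_density 0 (sqrt (t - s)))) \<and>
     (AE \<omega> in M. continuous_on {0..} (\<lambda>t. \<beta> t \<omega>))"

text \<open>The components are independent as processes, i.e. as random elements of the product
  space of real functions on \<open>{0..}\<close>.\<close>

definition brownian_motion :: "'w measure \<Rightarrow> (real \<Rightarrow> 'w \<Rightarrow> real ^ 'n) \<Rightarrow> bool" where
  "brownian_motion M W \<longleftrightarrow>
     (\<forall>i. real_brownian_motion M (\<lambda>t \<omega>. W t \<omega> $ i)) \<and>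
     prob_space.indep_vars M (\<lambda>_. Pi\<^sub>M {0..} (\<lambda>_. borel))
       (\<lambda>i \<omega>. \<lambda>t\<in>{0..}. W t \<omega> $ i) UNIV"

definition cadlag :: "(real \<Rightarrow> real) \<Rightarrow> bool" where
  "cadlag g \<longleftrightarrow> (\<forall>t\<ge>0. (g \<longlongrightarrow> g t) (at_right t)) \<and> (\<forall>t>0. \<exists>l. (g \<longlongrightarrow> l) (at_left t))"

definition levy_process :: "'w measure \<Rightarrow> (real \<Rightarrow> 'w \<Rightarrow> real) \<Rightarrow> bool" where
  "levy_process M X \<longleftrightarrow>
     (\<forall>t\<ge>0. X t \<in> borel_measurable M) \<and>
     (AE \<omega> in M. X 0 \<omega> = 0) \<and>
     independent_increments M X \<and>
     (\<forall>s t. 0 \<le> s \<and> s \<le> t \<longrightarrow>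
        distr M borel (\<lambda>\<omega>. X t \<omega> - X s \<omega>) = distr M borel (X (t - s))) \<and>
     (AE \<omega> in M. cadlag (\<lambda>t. X t \<omega>))"

definition subordinator :: "'w measure \<Rightarrow> (real \<Rightarrow> 'w \<Rightarrow> real) \<Rightarrow> bool" where
  "subordinator M L \<longleftrightarrow> levy_process M L \<and> (AE \<omega> in M. mono_on {0..} (\<lambda>t. L t \<omega>))"

text \<open>Strict stability as self-similarity of index \<open>1/\<alpha>\<close>; for Levy processes equality of the
  one-dimensional laws amounts to equality in law of the processes.\<close>

definition strictly_stable :: "'w measure \<Rightarrow> real \<Rightarrow> (real \<Rightarrow> 'w \<Rightarrow> real) \<Rightarrow> bool" where
  "strictly_stable M \<alpha> X \<longleftrightarrow>
     (\<forall>a>0. \<forall>t\<ge>0. distr M borel (X (a * t)) = distr M borel (\<lambda>\<omega>. a powr (1 / \<alpha>) * X t \<omega>))"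

definition stable_subordinator ::
    "'w measure \<Rightarrow> real \<Rightarrow> real \<Rightarrow> (real \<Rightarrow> 'w \<Rightarrow> real) \<Rightarrow> bool" where
  "stable_subordinator M \<alpha> \<gamma>b L \<longleftrightarrow>
     subordinator M L \<and> strictly_stable M \<alpha> L \<and>
     (\<forall>u. char (distr M borel (L 1)) u =
        exp (- (of_real (\<gamma>b powr \<alpha> * \<bar>u\<bar> powr \<alpha>) *
                (1 - \<i> * of_real (tan (pi * \<alpha> / 2) * sgn u)))))"

definition process_events ::
    "'w measure \<Rightarrow> (real \<Rightarrow> 'w \<Rightarrow> 'b::topological_space) \<Rightarrow> 'w set set" where
  "process_events M X =
     sigma_sets (space M) {X t -` A \<inter> space M | t A. 0 \<le> t \<and> A \<in> sets borel}"

definition independent_processes ::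
    "'w measure \<Rightarrow> (real \<Rightarrow> 'w \<Rightarrow> 'b::topological_space) \<Rightarrow>
     (real \<Rightarrow> 'w \<Rightarrow> 'c::topological_space) \<Rightarrow> bool" where
  "independent_processes M X Y \<longleftrightarrow>
     prob_space.indep_set M (process_events M X) (process_events M Y)"

definition subordinated ::
    "(real \<Rightarrow> 'w \<Rightarrow> 'b) \<Rightarrow> (real \<Rightarrow> 'w \<Rightarrow> real) \<Rightarrow> real \<Rightarrow> 'w \<Rightarrow> 'b" where
  "subordinated W L t \<omega> = W (L t \<omega>) \<omega>"

subsection \<open>The linear equation and its transition operators\<close>

definition diag_mat :: "('n \<Rightarrow> real) \<Rightarrow> real ^ 'n ^ 'n" where
  "diag_mat d = (\<chi> i j. if i = j then d i else 0)"

text \<open>\<open>X\<close> solves \<open>dX\<^sub>t = (A X\<^sub>t + f(t)) dt + S dY\<^sub>t\<close> on \<open>{s..T}\<close> with \<open>X\<^sub>s = x\<close>. The matrix \<open>S\<close>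
  is constant, so the stochastic integral of \<open>S\<close> over \<open>{s..t}\<close> is \<open>S (Y\<^sub>t - Y\<^sub>s)\<close>.\<close>

definition solves_linear_sde ::
    "'w measure \<Rightarrow> real ^ 'n ^ 'n \<Rightarrow> (real \<Rightarrow> real ^ 'n) \<Rightarrow> real ^ 'n ^ 'n \<Rightarrow>
     (real \<Rightarrow> 'w \<Rightarrow> real ^ 'n) \<Rightarrow> real \<Rightarrow> real \<Rightarrow> real ^ 'n \<Rightarrow> (real \<Rightarrow> 'w \<Rightarrow> real ^ 'n) \<Rightarrow> bool" where
  "solves_linear_sde M A f S Y T s x X \<longleftrightarrow>
     (\<forall>t\<in>{s..T}. X t \<in> borel_measurable M) \<and>
     (AE \<omega> in M.
        set_integrable lborel {s..T} (\<lambda>r. A *v X r \<omega> + f r) \<and>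
        (\<forall>t\<in>{s..T}. X t \<omega> =
           x + (LINT r:{s..t}|lborel. A *v X r \<omega> + f r) + S *v (Y t \<omega> - Y s \<omega>)))"

definition transition_op ::
    "'w measure \<Rightarrow> (real \<Rightarrow> 'x \<Rightarrow> real \<Rightarrow> 'w \<Rightarrow> 'x) \<Rightarrow> real \<Rightarrow> real \<Rightarrow> ('x \<Rightarrow> real) \<Rightarrow> 'x \<Rightarrow> real" where
  "transition_op M Z s t \<phi> x = (LINT \<omega>|M. \<phi> (Z s x t \<omega>))"

subsection \<open>Function spaces and the integral equation\<close>

definition bounded_borel :: "('x::topological_space \<Rightarrow> real) set" where
  "bounded_borel = {\<phi>. \<phi> \<in> borel_measurable borel \<and> bounded (range \<phi>)}"

definition partial_deriv :: "'n \<Rightarrow> (real ^ 'n \<Rightarrow> real) \<Rightarrow> real ^ 'n \<Rightarrow> real" where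
  "partial_deriv i g x = deriv (\<lambda>h. g (x + h *\<^sub>R axis i 1)) 0"

definition gradient :: "(real ^ 'n \<Rightarrow> real) \<Rightarrow> real ^ 'n \<Rightarrow> real ^ 'n" where
  "gradient g x = (\<chi> i. partial_deriv i g x)"

definition Cb1 :: "(real ^ 'n \<Rightarrow> real) set" where
  "Cb1 = {g. (\<forall>x. g differentiable (at x)) \<and> bounded (range g) \<and>
             (\<forall>i. continuous_on UNIV (partial_deriv i g) \<and> bounded (range (partial_deriv i g)))}"

definition sup_norm :: "('x \<Rightarrow> real) \<Rightarrow> real" where
  "sup_norm g = (SUP x. \<bar>g x\<bar>)"

definition Lambda1 :: "real \<Rightarrow> real \<Rightarrow> (real \<Rightarrow> real ^ 'n \<Rightarrow> real) set" where
  "Lambda1 \<gamma> t = {V.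
     (\<lambda>(s, x). V s x) \<in> borel_measurable (restrict_space borel ({0<..t} \<times> UNIV)) \<and>
     (\<forall>x. continuous_on {0<..t} (\<lambda>s. V s x)) \<and>
     (\<forall>s\<in>{0<..t}. V s \<in> Cb1) \<and>
     bdd_above ((\<lambda>s. s powr \<gamma> *
        (sup_norm (V s) + (SUP i. sup_norm (partial_deriv i (V s))))) ` {0<..t})}"

text \<open>At \<open>r = t\<close> the gradient of \<open>u r\<close> need not exist; this single time does not affect the
  integral.\<close>

definition solves_kolmogorov ::
    "(real \<Rightarrow> real \<Rightarrow> (real ^ 'n \<Rightarrow> real) \<Rightarrow> real ^ 'n \<Rightarrow> real) \<Rightarrow>
     (real \<Rightarrow> real ^ 'n \<Rightarrow> real ^ 'n) \<Rightarrow> (real ^ 'n \<Rightarrow> real) \<Rightarrow> real \<Rightarrow>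
     (real \<Rightarrow> real ^ 'n \<Rightarrow> real) \<Rightarrow> bool" where
  "solves_kolmogorov R B \<phi> t u \<longleftrightarrow>
     (\<forall>s\<in>{0..t}. \<forall>x.
        set_integrable lborel {s..t} (\<lambda>r. R s r (\<lambda>y. B r y \<bullet> gradient (u r) y) x) \<and>
        u s x = R s t \<phi> x + (LINT r:{s..t}|lborel. R s r (\<lambda>y. B r y \<bullet> gradient (u r) y) x))"

end

theory Submission
  imports Defs
begin

text \<open>Write the equation in terms of the scalar field \<open>\<psi>(r, y) = \<langle>B(r, y), \<nabla>u\<^sub>r(y)\<rangle>\<close>: it becomes
  the fixed point equation \<open>\<psi>\<^sub>s = \<langle>B(s), \<nabla>R\<^sub>s\<^sub>,\<^sub>t\<phi> + \<nabla> \<integral> R\<^sub>s\<^sub>,\<^sub>r \<psi>\<^sub>r dr\<rangle>\<close>, and no limits of differentiable functions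
  have to be taken. Given the smoothing estimate \<open>\<bar>\<nabla>R\<^sub>s\<^sub>,\<^sub>r\<psi>\<bar> \<le> C (r - s) powr (-\<gamma>) sup \<bar>\<psi>\<bar>\<close> with
  \<open>\<gamma> < 1\<close>, the right-hand side is a contraction for the weight \<open>(t - s) powr (-\<gamma>) exp (\<rho> (t - s))\<close> once
  \<open>\<rho>\<close> is large.

  For the smoothing estimate, the solution of the linear equation is a deterministic affine function
  of \<open>x\<close> plus the noise \<open>\<integral> exp (-\<lambda>(r - q)) dW\<^sub>L\<^sub>(\<^sub>q\<^sub>)\<close>. Conditionally on \<open>L\<close> this noise is Gaussian with independent
  components of variance \<open>\<sigma>\<^sup>2 \<integral> exp (-2\<lambda>(r - q)) dL\<^sub>q\<close>, which is at least a constant times \<open>L\<^sub>r - L\<^sub>s\<close>.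
  Differentiating the Gaussian density costs the inverse standard deviation, and self-similarity gives
  \<open>E (L\<^sub>r - L\<^sub>s) powr (-1/2) = (r - s) powr (-1/(2\<alpha>)) E L\<^sub>1 powr (-1/2)\<close>, where the last moment is finite because the
  Laplace transform of \<open>L\<^sub>1\<close> decays geometrically along the scales \<open>n powr (1/\<alpha>)\<close>.\<close>

subsection \<open>Differentiation under the integral sign\<close>

text \<open>The work lies in making "conditionally on L" precise. The path map of W is measurable
  only for the product sigma-algebra, and for that one evaluation at a random time is not jointly
  measurable. So L is first approximated by variables with countably many values, for which
  conditioning is a computation in a product measure. The discretised identity passes to the limit
  for continuous test functions, and equality of the two laws that it then identifies extends it to
  Borel ones.

  All integrals against L and W_L are pathwise: integration by parts moves the increments onto the
  smooth exponential weight, and a monotone path has only countably many discontinuities, which the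
  remaining Lebesgue integral does not see.

  The time integral of the kernel has to be measurable and continuous in s. Both come from joint
  continuity of R_{s,r} \<phi> (x) in (s, r, x). For merely Borel \<phi> this needs convergence of
  the Gaussian laws in total variation, and it needs L to be almost surely continuous at each given
  time, from both sides.\<close>

lemma has_derivative_imp_difference_quotient:
  fixes f :: "'a::euclidean_space \<Rightarrow> real"
  assumes "(f has_derivative (\<lambda>k. g \<bullet> k)) (at x)"
  shows "(\<lambda>n. real (Suc n) * (f (x + (1 / real (Suc n)) *\<^sub>R v) - f x)) \<longlonglongrightarrow> g \<bullet> v"
proof -
  have d: "((\<lambda>h. f (x + h *\<^sub>R v)) has_derivative (\<lambda>h. g \<bullet> (h *\<^sub>R v))) (at 0)"
    by (rule has_derivative_compose[where g=f and f="\<lambda>h. x + h *\<^sub>R v"])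
       (auto intro!: derivative_eq_intros assms)
  moreover have "(\<lambda>h::real. g \<bullet> (h *\<^sub>R v)) = (*) (g \<bullet> v)" by (auto simp: mult.commute)
  ultimately have "((\<lambda>h. f (x + h *\<^sub>R v)) has_field_derivative (g \<bullet> v)) (at 0)"
    by (simp add: has_field_derivative_def)
  then have "((\<lambda>h. (f (x + h *\<^sub>R v) - f x) / h) \<longlongrightarrow> g \<bullet> v) (at 0)"
    by (simp add: has_field_derivative_iff)
  moreover have "filterlim (\<lambda>n. 1 / real (Suc n)) (at 0) sequentially"
    unfolding filterlim_at
    by (intro conjI LIMSEQ_inverse_real_of_nat[unfolded inverse_eq_divide]) (auto simp del: of_nat_Suc)
  ultimately have "(\<lambda>n. (f (x + (1 / real (Suc n)) *\<^sub>R v) - f x) / (1 / real (Suc n))) \<longlonglongrightarrow> g \<bullet> v"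
    by (rule filterlim_compose)
  then show ?thesis by (simp add: mult.commute del: of_nat_Suc)
qed

lemma difference_quotient_bound:
  fixes f :: "'a::euclidean_space \<Rightarrow> real"
  assumes "convex U" "x \<in> U" "y \<in> U"
    and "\<And>z. z \<in> U \<Longrightarrow> (f has_derivative (\<lambda>k. g z \<bullet> k)) (at z)"
    and "\<And>z. z \<in> U \<Longrightarrow> norm (g z) \<le> b"
  shows "\<bar>f y - f x\<bar> \<le> b * norm (y - x)"
proof -
  have "norm (f y - f x) \<le> b * norm (y - x)"
  proof (rule differentiable_bound[OF assms(1) _ _ assms(3,2), of f "\<lambda>z k. g z \<bullet> k"])
    show "(f has_derivative (\<bullet>) (g z)) (at z within U)" if "z \<in> U" for z
      using assms(4)[OF that] by (rule has_derivative_at_withinI)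
    show "onorm ((\<bullet>) (g z)) \<le> b" if "z \<in> U" for z
    proof (rule onorm_le)
      fix k
      have "norm (g z \<bullet> k) \<le> norm (g z) * norm k" by (rule Cauchy_Schwarz_ineq2[unfolded real_norm_def[symmetric]])
      also have "\<dots> \<le> b * norm k" using assms(5)[OF that] by (intro mult_right_mono) auto
      finally show "norm (g z \<bullet> k) \<le> b * norm k" .
    qed
  qed
  then show ?thesis by simp
qed

text \<open>The gradient is a pointwise limit of difference quotients that are measurable in
  \<open>z\<close>, so its measurability need never be assumed when differentiating in a
  parameter.\<close>

lemma borel_measurable_gradient:
  fixes h :: "'a::euclidean_space \<Rightarrow> 'b \<Rightarrow> real"
  assumes "open U" "x \<in> U"
    and meas: "\<And>x. x \<in> U \<Longrightarrow> h x \<in> borel_measurable N"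
    and der: "\<And>z. z \<in> space N \<Longrightarrow> ((\<lambda>x. h x z) has_derivative (\<lambda>k. g z \<bullet> k)) (at x)"
  shows "g \<in> borel_measurable N"
proof (subst borel_measurable_euclidean_space, intro ballI)
  fix i :: 'a assume i: "i \<in> Basis"
  obtain e where e: "e > 0" "ball x e \<subseteq> U" using assms(1,2) openE by blast
  \<comment> \<open>\<open>h\<close> is known to be measurable only at points of \<open>U\<close>;
    skipping the first \<open>n0\<close> steps keeps the displaced point inside the ball contained
    in \<open>U\<close>.\<close>
  define n0 where "n0 = nat \<lceil>1/e\<rceil>"
  have inU: "x + (1 / real (Suc (n + n0))) *\<^sub>R i \<in> U" for n
  proof -
    have "1/e \<le> real n0" unfolding n0_def by (rule real_nat_ceiling_ge)
    then have "1/e < real (Suc (n + n0))" by linarith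
    then have "1 / real (Suc (n + n0)) < e"
      using e(1) by (simp add: divide_simps mult.commute del: of_nat_Suc split: if_splits)
    then have "dist x (x + (1 / real (Suc (n + n0))) *\<^sub>R i) < e"
      using i by (simp add: dist_norm del: of_nat_Suc)
    then show ?thesis using e(2) by auto
  qed
  show "(\<lambda>z. g z \<bullet> i) \<in> borel_measurable N"
  proof (rule borel_measurable_LIMSEQ_real)
    fix z assume "z \<in> space N"
    from has_derivative_imp_difference_quotient[OF der[OF this], of i, THEN LIMSEQ_ignore_initial_segment, of n0]
    show "(\<lambda>n. real (Suc (n + n0)) * (h (x + (1 / real (Suc (n + n0))) *\<^sub>R i) z - h x z)) \<longlonglongrightarrow> g z \<bullet> i" .
  next
    fix n
    show "(\<lambda>z. real (Suc (n + n0)) * (h (x + (1 / real (Suc (n + n0))) *\<^sub>R i) z - h x z)) \<in> borel_measurable N"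
      using meas[OF inU[of n]] meas[OF assms(2)] by measurable
  qed
qed

text \<open>The mean value inequality on the convex set \<open>U\<close> bounds the increments of
  the integrand by \<open>b\<close>, so dominated convergence applies. A neighbourhood
  \<open>U\<close> instead of the whole space matters for Gaussian densities, whose gradients have a
  common majorant only while the mean stays in a ball.\<close>

lemma
  fixes h :: "'a::euclidean_space \<Rightarrow> 'b \<Rightarrow> real" and g :: "'a \<Rightarrow> 'b \<Rightarrow> 'a"
  assumes U: "open U" "convex U" "x0 \<in> U"
    and int: "\<And>x. x \<in> U \<Longrightarrow> integrable N (h x)"
    and der: "\<And>x z. x \<in> U \<Longrightarrow> z \<in> space N \<Longrightarrow> ((\<lambda>x. h x z) has_derivative (\<lambda>k. g x z \<bullet> k)) (at x)"
    and bnd: "\<And>x z. x \<in> U \<Longrightarrow> z \<in> space N \<Longrightarrow> norm (g x z) \<le> b z"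
    and b: "integrable N b"
  shows integrable_gradient: "integrable N (g x0)"
    and has_derivative_integral:
      "((\<lambda>x. \<integral>z. h x z \<partial>N) has_derivative (\<lambda>k. (\<integral>z. g x0 z \<partial>N) \<bullet> k)) (at x0)"
    and isCont_integral_gradient:
      "(\<And>z. z \<in> space N \<Longrightarrow> isCont (\<lambda>x. g x z) x0) \<Longrightarrow> isCont (\<lambda>x. \<integral>z. g x z \<partial>N) x0"
proof -
  have meas: "g x \<in> borel_measurable N" if "x \<in> U" for x
    by (rule borel_measurable_gradient[OF U(1) that]) (use int der that in \<open>auto\<close>)
  have gi: "integrable N (g x)" if "x \<in> U" for x
    by (rule Bochner_Integration.integrable_bound[OF b meas[OF that]])
       (use bnd[OF that] in \<open>auto intro: order_trans[OF _ abs_ge_self]\<close>)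
  show "integrable N (g x0)" using gi U by blast
  have b0: "0 \<le> b z" if "z \<in> space N" for z using bnd[OF U(3) that] norm_ge_zero order_trans by blast
  have evU: "eventually (\<lambda>n. X n \<in> U) sequentially" if "X \<longlonglongrightarrow> x0" for X :: "nat \<Rightarrow> 'a"
    using topological_tendstoD[OF that U(1,3)] .
  show "((\<lambda>x. \<integral>z. h x z \<partial>N) has_derivative (\<lambda>k. (\<integral>z. g x0 z \<partial>N) \<bullet> k)) (at x0)"
  proof -
    \<comment> \<open>The remainder quotient in the definition of the derivative at
      \<open>x0\<close>. The increment of \<open>h\<close> and the linear term are each at most
      \<open>b z\<close> after division, whence the majorant \<open>2 * b z\<close>.\<close>
    define q where "q = (\<lambda>x z. (h x z - h x0 z - g x0 z \<bullet> (x - x0)) / norm (x - x0))"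
    have "((\<lambda>x. \<integral>z. q x z \<partial>N) \<longlongrightarrow> 0) (at x0)"
    proof (subst tendsto_at_iff_sequentially, intro allI impI)
      fix X assume X: "\<forall>i. X i \<in> UNIV - {x0}" "X \<longlonglongrightarrow> x0"
      from evU[OF X(2)] obtain n0 where n0: "\<And>n. n \<ge> n0 \<Longrightarrow> X n \<in> U"
        by (auto simp: eventually_sequentially)
      let ?X = "\<lambda>n. X (n + n0)"
      have XU: "?X n \<in> U" for n using n0 by simp
      have "(\<lambda>n. \<integral>z. q (?X n) z \<partial>N) \<longlonglongrightarrow> (\<integral>z. 0 \<partial>N)"
      proof (rule integral_dominated_convergence[where w="\<lambda>z. 2 * b z"])
        show "(\<lambda>z. q (?X n) z) \<in> borel_measurable N" for n
          unfolding q_def using int[OF XU[of n]] int[OF U(3)] meas[OF U(3)] by measurable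
        show "integrable N (\<lambda>z. 2 * b z)" using b by simp
        show "AE z in N. (\<lambda>n. q (?X n) z) \<longlonglongrightarrow> 0"
        proof (rule AE_I2)
          fix z assume z: "z \<in> space N"
          have "((\<lambda>x. q x z) \<longlongrightarrow> 0) (at x0)"
          proof -
            have "((\<lambda>y. (h y z - h x0 z - g x0 z \<bullet> (y - x0)) /\<^sub>R norm (y - x0)) \<longlongrightarrow> 0) (at x0)"
              using der[OF U(3) z] unfolding has_derivative_at_within by simp
            then show ?thesis by (simp add: q_def divide_inverse mult.commute)
          qed
          moreover have "filterlim ?X (at x0) sequentially"
            unfolding filterlim_at using X LIMSEQ_ignore_initial_segment[OF X(2)] by auto
          ultimately show "(\<lambda>n. q (?X n) z) \<longlonglongrightarrow> 0"
            by (rule filterlim_compose)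
        qed
        show "AE z in N. norm (q (?X n) z) \<le> 2 * b z" for n
        proof (rule AE_I2)
          fix z assume z: "z \<in> space N"
          have "\<bar>h (?X n) z - h x0 z\<bar> \<le> b z * norm (?X n - x0)"
            by (rule difference_quotient_bound[OF U(2) U(3) XU, of "\<lambda>x. h x z" "\<lambda>x. g x z"])
              (use der bnd z in auto)
          moreover have "\<bar>g x0 z \<bullet> (?X n - x0)\<bar> \<le> b z * norm (?X n - x0)"
            by (rule order_trans[OF Cauchy_Schwarz_ineq2]) (use bnd[OF U(3) z] in \<open>auto intro: mult_right_mono\<close>)
          ultimately have "\<bar>h (?X n) z - h x0 z - g x0 z \<bullet> (?X n - x0)\<bar> \<le> 2 * b z * norm (?X n - x0)"
            by linarith
          then show "norm (q (?X n) z) \<le> 2 * b z" using X(1)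
            by (simp add: q_def divide_simps)
        qed
      qed simp
      then have "(\<lambda>n. \<integral>z. q (?X n) z \<partial>N) \<longlonglongrightarrow> 0" by simp
      then show "((\<lambda>x. \<integral>z. q x z \<partial>N) \<circ> X) \<longlonglongrightarrow> 0"
        unfolding o_def by (rule LIMSEQ_offset)
    qed
    moreover have "eventually (\<lambda>x. (\<integral>z. q x z \<partial>N) =
        ((\<integral>z. h x z \<partial>N) - (\<integral>z. h x0 z \<partial>N) - (\<integral>z. g x0 z \<partial>N) \<bullet> (x - x0)) /\<^sub>R norm (x - x0)) (at x0)"
    proof -
      have "eventually (\<lambda>x. x \<in> U) (at x0)" using U by (metis eventually_at_topological)
      then show ?thesis
      proof eventually_elim
        case (elim x)
        have "(\<integral>z. q x z \<partial>N) = (\<integral>z. h x z - h x0 z - g x0 z \<bullet> (x - x0) \<partial>N) / norm (x - x0)"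
          unfolding q_def by simp
        also have "(\<integral>z. h x z - h x0 z - g x0 z \<bullet> (x - x0) \<partial>N) =
           (\<integral>z. h x z \<partial>N) - (\<integral>z. h x0 z \<partial>N) - (\<integral>z. g x0 z \<partial>N) \<bullet> (x - x0)"
          using int[OF elim] int[OF U(3)] gi[OF U(3)] by simp
        finally show ?case by (simp add: divide_inverse mult.commute)
      qed
    qed
    ultimately have "((\<lambda>x. ((\<integral>z. h x z \<partial>N) - (\<integral>z. h x0 z \<partial>N) - (\<integral>z. g x0 z \<partial>N) \<bullet> (x - x0)) /\<^sub>R norm (x - x0)) \<longlongrightarrow> 0) (at x0)"
      by (rule Lim_transform_eventually)
    then show ?thesis
      unfolding has_derivative_at_within using bounded_linear_inner_right by blast
  qed
  show "isCont (\<lambda>x. \<integral>z. g x z \<partial>N) x0" if c: "\<And>z. z \<in> space N \<Longrightarrow> isCont (\<lambda>x. g x z) x0"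
  proof (subst continuous_at_sequentially, intro allI impI)
    fix X :: "nat \<Rightarrow> 'a" assume X: "X \<longlonglongrightarrow> x0"
    from evU[OF X] obtain n0 where n0: "\<And>n. n \<ge> n0 \<Longrightarrow> X n \<in> U"
      by (auto simp: eventually_sequentially)
    let ?X = "\<lambda>n. X (n + n0)"
    have XU: "?X n \<in> U" for n using n0 by simp
    have "(\<lambda>n. \<integral>z. g (?X n) z \<partial>N) \<longlonglongrightarrow> (\<integral>z. g x0 z \<partial>N)"
    proof (rule integral_dominated_convergence[where w=b])
      show "g x0 \<in> borel_measurable N" "\<And>n. g (?X n) \<in> borel_measurable N" "integrable N b"
        using meas U(3) XU b by auto
      show "AE z in N. (\<lambda>n. g (?X n) z) \<longlonglongrightarrow> g x0 z"
        using isCont_tendsto_compose[OF c LIMSEQ_ignore_initial_segment[OF X, of n0]] by auto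
      show "AE z in N. norm (g (?X n) z) \<le> b z" for n using bnd XU by auto
    qed
    then show "((\<lambda>x. \<integral>z. g x z \<partial>N) \<circ> X) \<longlonglongrightarrow> (\<integral>z. g x0 z \<partial>N)"
      unfolding o_def by (rule LIMSEQ_offset)
  qed
qed

subsection \<open>Weighted contractions\<close>

lemma integrable_powr_near_0:
  fixes \<gamma> :: real
  assumes "\<gamma> < 1"
  shows "integrable lborel (\<lambda>p. indicator {0<..T} p * p powr (-\<gamma>))"
proof (cases "T \<ge> 0")
  case True
  have "(\<lambda>p. p powr (-\<gamma>)) absolutely_integrable_on {0..T}"
    by (rule nonnegative_absolutely_integrable_1, rule integrable_on_powr_from_0) (use assms True in auto)
  then have "integrable lborel (\<lambda>p. indicator {0..T} p *\<^sub>R p powr (-\<gamma>))"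
    unfolding set_integrable_def by (subst (asm) integrable_completion) auto
  moreover have "(\<lambda>p. indicator {0..T} p *\<^sub>R p powr (-\<gamma>)) = (\<lambda>p. indicator {0<..T} p * p powr (-\<gamma>))"
    by (auto simp: indicator_def fun_eq_iff)
  ultimately show ?thesis by simp
qed simp

text \<open>The power is the singularity at s = t that a bounded Borel final value forces on the
  gradient. The exponential factor makes the integral operator small without shortening the time
  interval. The indicator makes anything dominated by the weight vanish outside {0..<t}.\<close>

definition weight :: "real \<Rightarrow> real \<Rightarrow> real \<Rightarrow> real \<Rightarrow> real" where
  "weight \<gamma> \<rho> t s = indicator {0..<t} s * ((t - s) powr (-\<gamma>) * exp (\<rho> * (t - s)))"

lemma weight_nonneg: "weight \<gamma> \<rho> t s \<ge> 0"
  by (simp add: weight_def)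

lemma weight_measurable [measurable]: "weight \<gamma> \<rho> t \<in> borel_measurable borel"
  unfolding weight_def[abs_def] by measurable

lemma integrable_weight:
  assumes "\<gamma> < 1" "\<rho> \<ge> 0"
  shows "integrable lborel (weight \<gamma> \<rho> t)"
proof -
  have "integrable lborel (\<lambda>s. indicator {0<..t} (t + (-1) * s) * (t + (-1) * s) powr (-\<gamma>))"
    by (rule lborel_integrable_real_affine[OF integrable_powr_near_0[OF assms(1)]]) simp
  then have "integrable lborel (\<lambda>s. exp (\<rho> * t) * (indicator {0<..t} (t - s) * (t - s) powr (-\<gamma>)))"
    by simp
  then show ?thesis
  proof (rule Bochner_Integration.integrable_bound)
    show "AE s in lborel. norm (weight \<gamma> \<rho> t s)
        \<le> norm (exp (\<rho> * t) * (indicator {0<..t} (t - s) * (t - s) powr (-\<gamma>)))"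
    proof (rule AE_I2)
      fix s
      have "exp (\<rho> * (t - s)) \<le> exp (\<rho> * t)" if "s \<ge> 0"
        using that assms(2) by (simp add: mult_left_mono)
      then show "norm (weight \<gamma> \<rho> t s)
        \<le> norm (exp (\<rho> * t) * (indicator {0<..t} (t - s) * (t - s) powr (-\<gamma>)))"
        by (auto simp: weight_def indicator_def abs_mult mult.commute intro!: mult_right_mono)
    qed
  qed measurable
qed

text \<open>The larger of \<open>a\<close> and \<open>b\<close> is at least half their sum, so its
  singular power is harmless and only the one at the smaller argument survives. If that argument is
  \<open>b\<close>, the exponential may be moved from \<open>a\<close> to \<open>b\<close> as well,
  because it decreases. A product of two singularities thus splits into two single ones.\<close>

lemma powr_product_split:
  fixes a b \<gamma> \<rho> :: real
  assumes "a > 0" "b > 0" "\<gamma> > 0" "\<rho> \<ge> 0"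
  shows "a powr (-\<gamma>) * b powr (-\<gamma>) * exp (- \<rho> * a) \<le>
    2 powr \<gamma> * (a + b) powr (-\<gamma>) * (a powr (-\<gamma>) * exp (- \<rho> * a) + b powr (-\<gamma>) * exp (- \<rho> * b))"
proof -
  have half: "c powr (-\<gamma>) \<le> 2 powr \<gamma> * (a + b) powr (-\<gamma>)" if "2 * c \<ge> a + b" for c
  proof -
    have "c powr (-\<gamma>) \<le> ((a + b) / 2) powr (-\<gamma>)"
      using that assms by (intro powr_mono2') auto
    also have "\<dots> = 2 powr \<gamma> * (a + b) powr (-\<gamma>)"
      using assms by (simp add: powr_divide powr_minus divide_simps)
    finally show ?thesis .
  qed
  show ?thesis
  proof (cases "a \<le> b")
    case True
    have "a powr (-\<gamma>) * b powr (-\<gamma>) * exp (- \<rho> * a) = b powr (-\<gamma>) * (a powr (-\<gamma>) * exp (- \<rho> * a))" by simp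
    also have "\<dots> \<le> (2 powr \<gamma> * (a + b) powr (-\<gamma>)) * (a powr (-\<gamma>) * exp (- \<rho> * a))"
      using half[of b] True by (intro mult_right_mono) auto
    also have "\<dots> \<le> (2 powr \<gamma> * (a + b) powr (-\<gamma>)) * (a powr (-\<gamma>) * exp (- \<rho> * a) + b powr (-\<gamma>) * exp (- \<rho> * b))"
      by (intro mult_left_mono) auto
    finally show ?thesis .
  next
    case False
    have "a powr (-\<gamma>) * b powr (-\<gamma>) * exp (- \<rho> * a) \<le> a powr (-\<gamma>) * (b powr (-\<gamma>) * exp (- \<rho> * b))"
      using False assms by (simp add: mult_left_mono)
    also have "\<dots> \<le> (2 powr \<gamma> * (a + b) powr (-\<gamma>)) * (b powr (-\<gamma>) * exp (- \<rho> * b))"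
      using half[of a] False by (intro mult_right_mono) auto
    also have "\<dots> \<le> (2 powr \<gamma> * (a + b) powr (-\<gamma>)) * (a powr (-\<gamma>) * exp (- \<rho> * a) + b powr (-\<gamma>) * exp (- \<rho> * b))"
      by (intro mult_left_mono) auto
    finally show ?thesis .
  qed
qed

text \<open>As the rate grows the exponential vanishes at every p > 0, and the bare power is an
  integrable majorant because \<gamma> < 1.\<close>

lemma ex_small_exponential_integral:
  fixes \<gamma> :: real
  assumes "\<gamma> < 1" "\<epsilon> > 0"
  shows "\<exists>\<rho>\<ge>0. (\<integral>p. indicator {0<..T} p * (p powr (-\<gamma>) * exp (- \<rho> * p)) \<partial>lborel) < \<epsilon>"
proof -
  have "(\<lambda>n. \<integral>p. indicator {0<..T} p * (p powr (-\<gamma>) * exp (- real n * p)) \<partial>lborel) \<longlonglongrightarrow> (\<integral>p. 0 \<partial>(lborel :: real measure))"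
  proof (rule integral_dominated_convergence[OF _ _ integrable_powr_near_0[OF assms(1), of T]])
    show "AE p in lborel. (\<lambda>n. indicator {0<..T} p * (p powr (-\<gamma>) * exp (- real n * p))) \<longlonglongrightarrow> (0::real)"
    proof (rule AE_I2)
      fix p :: real
      show "(\<lambda>n. indicator {0<..T} p * (p powr (-\<gamma>) * exp (- real n * p))) \<longlonglongrightarrow> (0::real)"
      proof (cases "p > 0")
        case True
        have "(\<lambda>n. exp (-p) ^ n) \<longlonglongrightarrow> 0" by (rule LIMSEQ_power_zero) (use True in auto)
        then have "(\<lambda>n. exp (- real n * p)) \<longlonglongrightarrow> 0" by (simp add: exp_of_nat_mult[symmetric])
        then have "(\<lambda>n. indicator {0<..T} p * (p powr (-\<gamma>) * exp (- real n * p))) \<longlonglongrightarrow> indicator {0<..T} p * (p powr (-\<gamma>) * 0)"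
          by (intro tendsto_intros)
        then show ?thesis by simp
      qed simp
    qed
    show "AE p in lborel. norm (indicator {0<..T} p * (p powr (-\<gamma>) * exp (- real n * p)))
       \<le> indicator {0<..T} p * p powr (-\<gamma>)" for n
      by (rule AE_I2) (auto simp: indicator_def mult_left_le)
  qed measurable
  then have "eventually (\<lambda>n. (\<integral>p. indicator {0<..T} p * (p powr (-\<gamma>) * exp (- real n * p)) \<partial>lborel) < \<epsilon>) sequentially"
    using assms(2) by (simp add: order_tendsto_iff)
  then obtain n where "(\<integral>p. indicator {0<..T} p * (p powr (-\<gamma>) * exp (- real n * p)) \<partial>lborel) < \<epsilon>"
    using eventually_happens by fastforce
  then show ?thesis by (intro exI[of _ "real n"]) auto
qed

text \<open>With a = r - s and b = t - r one has exp (\<rho> (t - r)) = exp (\<rho> (t - s)) exp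
  (-\<rho> (r - s)), and a + b = t - s restores the weight at \<open>s\<close>. What is left after
  splitting the product are two translates or reflections of one small integral over {0<..T}, so
  \<rho> serves all \<open>s\<close> and \<open>t\<close> at once.\<close>

lemma ex_contraction_weight:
  fixes \<gamma> :: real
  assumes "0 < \<gamma>" "\<gamma> < 1" "\<epsilon> > 0"
  shows "\<exists>\<rho>\<ge>0. \<forall>s t. 0 \<le> s \<longrightarrow> s < t \<longrightarrow> t \<le> T \<longrightarrow>
     integrable lborel (\<lambda>r. indicator {s<..<t} r * ((r - s) powr (-\<gamma>) * weight \<gamma> \<rho> t r)) \<and>
     (\<integral>r. indicator {s<..<t} r * ((r - s) powr (-\<gamma>) * weight \<gamma> \<rho> t r) \<partial>lborel) \<le> \<epsilon> * weight \<gamma> \<rho> t s"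
proof -
  \<comment> \<open>The factor 2 pays for the two summands of the split product,
    \<open>2 powr \<gamma>\<close> for the constant in it.\<close>
  have "\<epsilon> / (2 * 2 powr \<gamma>) > 0" using assms by simp
  from ex_small_exponential_integral[OF assms(2) this, of T] obtain \<rho> where \<rho>: "\<rho> \<ge> 0"
    and small: "(\<integral>p. indicator {0<..T} p * (p powr (-\<gamma>) * exp (- \<rho> * p)) \<partial>lborel) < \<epsilon> / (2 * 2 powr \<gamma>)"
    by blast
  define h where "h p = indicator {0<..T} p * (p powr (-\<gamma>) * exp (- \<rho> * p))" for p :: real
  have h0: "h p \<ge> 0" for p by (simp add: h_def)
  have hm [measurable]: "h \<in> borel_measurable borel" unfolding h_def[abs_def] by measurable
  have hi: "integrable lborel h"
    by (rule Bochner_Integration.integrable_bound[OF integrable_powr_near_0[OF assms(2), of T]])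
      (use \<rho> in \<open>auto simp: h_def indicator_def mult_left_le\<close>)
  show ?thesis
  proof (intro exI[of _ \<rho>] conjI allI impI \<rho>)
    fix s t :: real assume st: "0 \<le> s" "s < t" "t \<le> T"
    let ?k = "\<lambda>r. indicator {s<..<t} r * ((r - s) powr (-\<gamma>) * weight \<gamma> \<rho> t r)"
    let ?c = "2 powr \<gamma> * weight \<gamma> \<rho> t s"
    have i1: "integrable lborel (\<lambda>r. h (r - s))"
      using lborel_integrable_real_affine[OF hi, of 1 "-s"] by simp
    have i2: "integrable lborel (\<lambda>r. h (t - r))"
      using lborel_integrable_real_affine[OF hi, of "-1" t] by simp
    have e1: "(\<integral>r. h (r - s) \<partial>lborel) = (\<integral>r. h r \<partial>lborel)"
      using lborel_integral_real_affine[of 1 h "-s"] by simp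
    have e2: "(\<integral>r. h (t - r) \<partial>lborel) = (\<integral>r. h r \<partial>lborel)"
      using lborel_integral_real_affine[of "-1" h t] by simp
    have le: "?k r \<le> ?c * (h (r - s) + h (t - r))" for r
    proof (cases "r \<in> {s<..<t}")
      case True
      have "?k r = ((r - s) powr (-\<gamma>) * (t - r) powr (-\<gamma>) * exp (- \<rho> * (r - s))) * exp (\<rho> * (t - s))"
        using True st by (simp add: weight_def algebra_simps flip: exp_add)
      also have "\<dots> \<le> (2 powr \<gamma> * ((r - s) + (t - r)) powr (-\<gamma>) *
          ((r - s) powr (-\<gamma>) * exp (- \<rho> * (r - s)) + (t - r) powr (-\<gamma>) * exp (- \<rho> * (t - r)))) * exp (\<rho> * (t - s))"
        by (intro mult_right_mono powr_product_split) (use True \<rho> assms in auto)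
      also have "\<dots> = ?c * (h (r - s) + h (t - r))"
        using True st by (simp add: weight_def h_def)
      finally show ?thesis .
    qed (use h0 weight_nonneg in auto)
    have ib: "integrable lborel (\<lambda>r. ?c * (h (r - s) + h (t - r)))" using i1 i2 by simp
    show ik: "integrable lborel ?k"
    proof (rule Bochner_Integration.integrable_bound[OF ib])
      show "AE r in lborel. norm (?k r) \<le> norm (?c * (h (r - s) + h (t - r)))"
        using le h0 weight_nonneg by (intro AE_I2) (auto intro!: order_trans[OF le abs_ge_self])
    qed measurable
    have "(\<integral>r. ?k r \<partial>lborel) \<le> (\<integral>r. ?c * (h (r - s) + h (t - r)) \<partial>lborel)"
      by (rule integral_mono[OF ik ib le])
    also have "\<dots> = ?c * (2 * (\<integral>r. h r \<partial>lborel))"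
      using i1 i2 by (simp add: e1 e2)
    also have "\<dots> \<le> ?c * (2 * (\<epsilon> / (2 * 2 powr \<gamma>)))"
      using small weight_nonneg[of \<gamma> \<rho> t s] by (intro mult_left_mono) (auto simp: h_def)
    also have "\<dots> = \<epsilon> * weight \<gamma> \<rho> t s" by simp
    finally show "(\<integral>r. ?k r \<partial>lborel) \<le> \<epsilon> * weight \<gamma> \<rho> t s" .
  qed
qed

text \<open>A ball of explicit radius \<open>c\<close> in a weighted sup norm. Radii instead of a
  norm let the fixed point argument run on plain functions, and membership carries measurability
  along.\<close>

definition weighted_bounded :: "'z measure \<Rightarrow> ('z \<Rightarrow> real) \<Rightarrow> real \<Rightarrow> ('z \<Rightarrow> real) \<Rightarrow> bool" where
  "weighted_bounded N w c \<psi> \<longleftrightarrow> \<psi> \<in> borel_measurable N \<and> (\<forall>z\<in>space N. \<bar>\<psi> z\<bar> \<le> c * w z)"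

lemma weighted_bounded_diff:
  assumes "weighted_bounded N w c \<psi>" "weighted_bounded N w d \<eta>"
  shows "weighted_bounded N w (c + d) (\<lambda>z. \<psi> z - \<eta> z)"
  using assms by (fastforce simp: weighted_bounded_def algebra_simps)

text \<open>The difference of two solutions is itself fixed by \<open>K\<close>, so its radius can
  be halved forever. Compatibility with differences is all the linearity that is asked of
  \<open>K\<close>.\<close>

lemma weighted_contraction_unique:
  assumes K: "\<And>c \<psi>. weighted_bounded N w c \<psi> \<Longrightarrow> weighted_bounded N w (c / 2) (K \<psi>)"
    and diff: "\<And>c d \<psi> \<eta>. weighted_bounded N w c \<psi> \<Longrightarrow> weighted_bounded N w d \<eta> \<Longrightarrow>
       K (\<lambda>z. \<psi> z - \<eta> z) = (\<lambda>z. K \<psi> z - K \<eta> z)"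
    and \<psi>: "weighted_bounded N w c \<psi>" "\<psi> = (\<lambda>z. \<psi>0 z + K \<psi> z)"
    and \<eta>: "weighted_bounded N w d \<eta>" "\<eta> = (\<lambda>z. \<psi>0 z + K \<eta> z)"
    and z: "z \<in> space N"
  shows "\<psi> z = \<eta> z"
proof -
  define \<delta> where "\<delta> = (\<lambda>z. \<psi> z - \<eta> z)"
  have K_fix: "K \<delta> = \<delta>"
  proof
    fix z
    have "K \<delta> z = K \<psi> z - K \<eta> z" unfolding \<delta>_def using diff[OF \<psi>(1) \<eta>(1)] by simp
    also have "\<dots> = \<delta> z"
      using fun_cong[OF \<psi>(2), of z] fun_cong[OF \<eta>(2), of z] by (simp add: \<delta>_def)
    finally show "K \<delta> z = \<delta> z" .
  qed
  have wb: "weighted_bounded N w ((c + d) / 2 ^ n) \<delta>" for n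
  proof (induction n)
    case 0
    then show ?case using weighted_bounded_diff[OF \<psi>(1) \<eta>(1)] by (simp add: \<delta>_def)
  next
    case (Suc n)
    then show ?case using K[OF Suc] by (simp add: K_fix mult.commute)
  qed
  have "\<bar>\<delta> z\<bar> \<le> (c + d) * w z * (1/2) ^ n" for n
    using wb[of n] z by (simp add: weighted_bounded_def power_one_over divide_simps)
  moreover have "(\<lambda>n. (c + d) * w z * (1/2) ^ n) \<longlonglongrightarrow> (c + d) * w z * 0"
    by (intro tendsto_intros LIMSEQ_power_zero) auto
  ultimately have "\<bar>\<delta> z\<bar> \<le> 0" by (intro LIMSEQ_le_const[of _ 0 "\<bar>\<delta> z\<bar>"]) auto
  then show ?thesis by (simp add: \<delta>_def)
qed

text \<open>Picard iteration from zero. The iterates converge pointwise at a geometric rate, so the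
  limit is measurable, and the estimate of the tail lies again in the class on which
  \<open>K\<close> contracts.\<close>

lemma weighted_contraction_fixpoint:
  assumes K: "\<And>c \<psi>. weighted_bounded N w c \<psi> \<Longrightarrow> weighted_bounded N w (c / 2) (K \<psi>)"
    and diff: "\<And>c d \<psi> \<eta>. weighted_bounded N w c \<psi> \<Longrightarrow> weighted_bounded N w d \<eta> \<Longrightarrow>
       K (\<lambda>z. \<psi> z - \<eta> z) = (\<lambda>z. K \<psi> z - K \<eta> z)"
    and \<psi>0: "weighted_bounded N w c0 \<psi>0"
    and w: "\<And>z. w z \<ge> 0" and sp: "space N = UNIV"
  shows "\<exists>\<psi>. weighted_bounded N w (2 * c0) \<psi> \<and> \<psi> = (\<lambda>z. \<psi>0 z + K \<psi> z)"
proof -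
  define S where "S = rec_nat (\<lambda>z. 0) (\<lambda>_ S z. \<psi>0 z + K S z)"
  have S_0: "S 0 = (\<lambda>z. 0)" and S_Suc: "S (Suc n) = (\<lambda>z. \<psi>0 z + K (S n) z)" for n
    by (simp_all add: S_def)
  have wb0: "weighted_bounded N w 0 (\<lambda>z. 0)" by (simp add: weighted_bounded_def)
  have K0: "K (\<lambda>z. 0) = (\<lambda>z. 0)" using diff[OF wb0 wb0] by simp
  \<comment> \<open>A crude radius growing with \<open>n\<close> suffices: it only certifies that
    each iterate is admissible, so that \<open>K\<close> and \<open>diff\<close> apply to
    it.\<close>
  have Sm: "weighted_bounded N w (c0 * real n) (S n)" for n
  proof (induction n)
    case (Suc n)
    have "c0 * w z \<ge> 0" for z using \<psi>0 sp order_trans[OF abs_ge_zero] by (auto simp: weighted_bounded_def)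
    then have nn: "c0 * w z * real n \<ge> 0" for z by simp
    have "\<bar>\<psi>0 z + K (S n) z\<bar> \<le> c0 * real (Suc n) * w z" for z
    proof -
      have "\<bar>\<psi>0 z\<bar> \<le> c0 * w z" "\<bar>K (S n) z\<bar> \<le> c0 * real n / 2 * w z"
        using \<psi>0 K[OF Suc] sp by (auto simp: weighted_bounded_def)
      then show ?thesis using nn[of z] by (simp add: algebra_simps)
    qed
    then show ?case using \<psi>0 K[OF Suc] by (auto simp: weighted_bounded_def S_Suc)
  qed (simp add: S_0 wb0)
  have step: "weighted_bounded N w (c0 / 2 ^ n) (\<lambda>z. S (Suc n) z - S n z)" for n
  proof (induction n)
    case 0
    then show ?case using \<psi>0 by (simp add: S_0 S_Suc K0)
  next
    case (Suc n)
    have "(\<lambda>z. S (Suc (Suc n)) z - S (Suc n) z) = K (\<lambda>z. S (Suc n) z - S n z)"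
      using diff[OF Sm[of "Suc n"] Sm[of n]] by (simp add: S_Suc[of "Suc n"] S_Suc[of n] fun_eq_iff)
    then show ?case using K[OF Suc] by (simp add: mult.commute)
  qed
  have stepb: "\<bar>S (Suc n) z - S n z\<bar> \<le> c0 * w z * (1/2) ^ n" for n z
    using step[of n] sp by (simp add: weighted_bounded_def power_one_over divide_simps)
  have geo: "summable (\<lambda>n. c0 * w z * (1/2) ^ n)" for z by (intro summable_mult summable_geometric) auto
  have summ: "summable (\<lambda>n. S (Suc n) z - S n z)" for z
    by (rule summable_comparison_test'[OF geo[of z], of 0]) (use stepb in auto)
  define \<psi> where "\<psi> z = (\<Sum>n. S (Suc n) z - S n z)" for z
  have lim: "(\<lambda>n. S n z) \<longlonglongrightarrow> \<psi> z" for z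
  proof -
    have "(\<lambda>n. \<Sum>i<n. S (Suc i) z - S i z) \<longlonglongrightarrow> \<psi> z"
      unfolding \<psi>_def using summ by (rule summable_LIMSEQ)
    moreover have "(\<Sum>i<n. S (Suc i) z - S i z) = S n z" for n
      by (induction n) (simp_all add: S_0)
    ultimately show ?thesis by simp
  qed
  have tail: "\<bar>\<psi> z - S m z\<bar> \<le> 2 * c0 / 2 ^ m * w z" for z m
  proof -
    have le: "\<bar>S (m + k) z - S m z\<bar> \<le> 2 * c0 / 2 ^ m * w z" for k
    proof -
      have cw: "0 \<le> c0 * w z" using \<psi>0 sp order_trans[OF abs_ge_zero] by (auto simp: weighted_bounded_def)
      have "\<bar>S (m + k) z - S m z\<bar> \<le> 2 * (c0 * w z) * (1/2) ^ m * (1 - (1/2) ^ k)"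
      proof (induction k)
        case (Suc k)
        have "\<bar>S (m + Suc k) z - S m z\<bar> \<le> \<bar>S (m + k) z - S m z\<bar> + \<bar>S (Suc (m + k)) z - S (m + k) z\<bar>" by simp
        also have "\<dots> \<le> 2 * (c0 * w z) * (1/2) ^ m * (1 - (1/2) ^ k) + c0 * w z * (1/2) ^ (m + k)"
          by (intro add_mono Suc.IH stepb)
        also have "\<dots> = 2 * (c0 * w z) * (1/2) ^ m * (1 - (1/2) ^ Suc k)"
          by (simp add: power_add algebra_simps)
        finally show ?case .
      qed simp
      also have "\<dots> \<le> 2 * (c0 * w z) * (1/2) ^ m"
        using cw by (simp add: mult_left_le)
      finally show ?thesis by (simp add: power_one_over divide_simps)
    qed
    have "(\<lambda>k. \<bar>S (k + m) z - S m z\<bar>) \<longlonglongrightarrow> \<bar>\<psi> z - S m z\<bar>"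
      by (intro tendsto_intros LIMSEQ_ignore_initial_segment[OF lim])
    then show ?thesis
      by (rule LIMSEQ_le_const2) (use le in \<open>auto simp: add.commute\<close>)
  qed
  have \<psi>m: "\<psi> \<in> borel_measurable N"
    by (rule borel_measurable_LIMSEQ_real[of _ S]) (use lim Sm in \<open>auto simp: weighted_bounded_def\<close>)
  have wb: "weighted_bounded N w (2 * c0 / 2 ^ m) (\<lambda>z. \<psi> z - S m z)" for m
    using tail[of _ m] \<psi>m Sm[of m] by (auto simp: weighted_bounded_def)
  have \<psi>b: "weighted_bounded N w (2 * c0) \<psi>" using wb[of 0] by (simp add: S_0)
  have "\<psi> z = \<psi>0 z + K \<psi> z" for z
  proof (rule LIMSEQ_unique)
    show "(\<lambda>n. S (Suc n) z) \<longlonglongrightarrow> \<psi> z" using LIMSEQ_Suc[OF lim] .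
    have b: "\<bar>S (Suc m) z - (\<psi>0 z + K \<psi> z)\<bar> \<le> c0 * w z * (1/2) ^ m" for m
    proof -
      \<comment> \<open>\<open>K\<close> is passed to the limit through its contraction bound,
        applied to the tail \<psi> - \<open>S m\<close>.\<close>
      have "K (\<lambda>z. \<psi> z - S m z) z = K \<psi> z - K (S m) z" using diff[OF \<psi>b Sm[of m]] by simp
      moreover have "\<bar>K (\<lambda>z. \<psi> z - S m z) z\<bar> \<le> c0 * w z * (1/2) ^ m"
        using K[OF wb[of m]] sp by (simp add: weighted_bounded_def power_one_over divide_simps)
      ultimately show ?thesis by (simp add: S_Suc abs_minus_commute)
    qed
    have "(\<lambda>m. c0 * w z * (1/2) ^ m) \<longlonglongrightarrow> c0 * w z * 0"
      by (intro tendsto_intros LIMSEQ_power_zero) auto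
    then have "(\<lambda>m. c0 * w z * (1/2) ^ m) \<longlonglongrightarrow> 0" by simp
    then have "(\<lambda>m. S (Suc m) z - (\<psi>0 z + K \<psi> z)) \<longlonglongrightarrow> 0"
      by (rule Lim_null_comparison[rotated]) (use b in auto)
    then show "(\<lambda>m. S (Suc m) z) \<longlonglongrightarrow> \<psi>0 z + K \<psi> z"
      by (simp add: LIM_zero_iff)
  qed
  then show ?thesis using \<psi>b by blast
qed

subsection \<open>The fixed point argument for a smoothing kernel\<close>

lemma gradient_eqI:
  assumes "(f has_derivative (\<lambda>k. g \<bullet> k)) (at x)"
  shows "partial_deriv i f x = g $ i" and "gradient f x = g"
proof -
  have *: "partial_deriv i f x = g $ i" for i
  proof -
    have "((\<lambda>h. f (x + h *\<^sub>R axis i 1)) has_derivative (\<lambda>h. g \<bullet> (h *\<^sub>R axis i 1))) (at 0)"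
      by (rule has_derivative_compose[where g=f and f="\<lambda>h. x + h *\<^sub>R axis i 1"])
         (auto intro!: derivative_eq_intros assms)
    moreover have "(\<lambda>h::real. g \<bullet> (h *\<^sub>R axis i 1)) = (*) (g $ i)"
      by (auto simp: inner_axis mult.commute)
    ultimately have "((\<lambda>h. f (x + h *\<^sub>R axis i 1)) has_field_derivative (g $ i)) (at 0)"
      by (simp add: has_field_derivative_def)
    then show ?thesis unfolding partial_deriv_def by (rule DERIV_imp_deriv)
  qed
  show "partial_deriv i f x = g $ i" by (rule *)
  show "gradient f x = g" by (simp add: gradient_def vec_eq_iff *)
qed

lemma gradient_component: "gradient f x $ i = partial_deriv i f x"
  by (simp add: gradient_def)

lemma has_derivative_gradient:
  fixes f :: "real ^ 'n \<Rightarrow> real"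
  assumes "f differentiable (at x)"
  shows "(f has_derivative (\<lambda>k. gradient f x \<bullet> k)) (at x)"
proof -
  obtain D where D: "(f has_derivative D) (at x)" using assms by (auto simp: differentiable_def)
  then interpret bounded_linear D by (rule has_derivative_bounded_linear)
  define g where "g = (\<chi> i. D (axis i 1))"
  have "D = (\<lambda>k. g \<bullet> k)"
  proof
    fix k :: "real ^ 'n"
    have "D k = D (\<Sum>i\<in>UNIV. (k $ i) *\<^sub>R axis i 1)"
      using basis_expansion[of k] by (simp add: scalar_mult_eq_scaleR)
    also have "\<dots> = (\<Sum>i\<in>UNIV. (k $ i) * D (axis i 1))" by (simp add: sum scaleR)
    also have "\<dots> = g \<bullet> k" by (simp add: g_def inner_vec_def mult.commute)
    finally show "D k = g \<bullet> k" .
  qed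
  with D gradient_eqI(2)[of f g x] show ?thesis by simp
qed

lemma Cb1I:
  assumes "\<And>x. (f has_derivative (\<lambda>k. g x \<bullet> k)) (at x)" "continuous_on UNIV g"
    and "\<And>x. \<bar>f x\<bar> \<le> a" "\<And>x. norm (g x) \<le> b"
  shows "f \<in> Cb1" and "sup_norm f \<le> a" and "sup_norm (partial_deriv i f) \<le> b"
proof -
  have pd: "partial_deriv i f = (\<lambda>x. g x $ i)" for i
    using gradient_eqI(1)[OF assms(1)] by blast
  have gb: "\<bar>g x $ i\<bar> \<le> b" for x i using component_le_norm_cart assms(4) order_trans by blast
  show "f \<in> Cb1"
    unfolding Cb1_def pd mem_Collect_eq
    by (intro conjI allI continuous_intros assms(2) boundedI[of _ a] boundedI[of _ b])
       (use assms gb in \<open>auto simp: differentiable_def\<close>)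
  show "sup_norm f \<le> a" unfolding sup_norm_def by (rule cSUP_least) (use assms in auto)
  show "sup_norm (partial_deriv i f) \<le> b"
    unfolding sup_norm_def pd by (rule cSUP_least) (use gb in auto)
qed

text \<open>Nothing is known about the measurability of \<open>F\<close>, so almost everywhere
  equality alone does not transfer integrability. But the difference \<open>p\<close> of the two
  integrands lives on two points, hence is measurable and null for every \<open>F\<close>.\<close>

lemma set_integral_Icc_Ioo:
  fixes F :: "real \<Rightarrow> real"
  shows "set_integrable lborel {a..b} F \<longleftrightarrow> set_integrable lborel {a<..<b} F"
    and "(LINT r:{a..b}|lborel. F r) = (LINT r:{a<..<b}|lborel. F r)"
proof -
  define p where "p = (\<lambda>r. indicator {a..b} r *\<^sub>R F r - indicator {a<..<b} r *\<^sub>R F r)"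
  have AE: "AE r in lborel. p r = 0"
  proof (rule AE_mp[OF AE_conjI[OF AE_lborel_singleton[of a] AE_lborel_singleton[of b]]], rule AE_I2)
    show "r \<noteq> a \<and> r \<noteq> b \<longrightarrow> p r = 0" for r by (auto simp: p_def indicator_def)
  qed
  have "p = (\<lambda>r. if r = a then p a else if r = b then p b else 0)"
    by (auto simp: fun_eq_iff p_def indicator_def)
  also have "\<dots> \<in> borel_measurable borel" by measurable
  finally have pm: "p \<in> borel_measurable lborel" by simp
  have pi: "integrable lborel p" and p0: "(\<integral>r. p r \<partial>lborel) = 0"
    using integrable_cong_AE[OF pm _ AE] integral_cong_AE[OF pm _ AE] by auto
  have e1: "(\<lambda>r. indicator {a..b} r *\<^sub>R F r) = (\<lambda>r. indicator {a<..<b} r *\<^sub>R F r + p r)"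
   and e2: "(\<lambda>r. indicator {a<..<b} r *\<^sub>R F r) = (\<lambda>r. indicator {a..b} r *\<^sub>R F r - p r)"
    by (auto simp: p_def)
  show iff: "set_integrable lborel {a..b} F \<longleftrightarrow> set_integrable lborel {a<..<b} F"
    unfolding set_integrable_def
  proof
    assume "integrable lborel (\<lambda>r. indicator {a..b} r *\<^sub>R F r)"
    then show "integrable lborel (\<lambda>r. indicator {a<..<b} r *\<^sub>R F r)"
      by (subst e2) (intro Bochner_Integration.integrable_diff pi)
  next
    assume "integrable lborel (\<lambda>r. indicator {a<..<b} r *\<^sub>R F r)"
    then show "integrable lborel (\<lambda>r. indicator {a..b} r *\<^sub>R F r)"
      by (subst e1) (intro Bochner_Integration.integrable_add pi)
  qed
  show "(LINT r:{a..b}|lborel. F r) = (LINT r:{a<..<b}|lborel. F r)"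
  proof (cases "set_integrable lborel {a<..<b} F")
    case True
    then show ?thesis unfolding set_lebesgue_integral_def set_integrable_def
      by (subst e1) (simp add: pi p0)
  next
    case False
    then show ?thesis using iff
      by (simp add: set_lebesgue_integral_def set_integrable_def not_integrable_integral_eq)
  qed
qed

section \<open>Transition kernels with a gradient estimate\<close>

locale smoothing_kernel =
  fixes R :: "real \<Rightarrow> real \<Rightarrow> (real ^ 'n \<Rightarrow> real) \<Rightarrow> real ^ 'n \<Rightarrow> real"
    and \<kappa> :: "real \<Rightarrow> real \<Rightarrow> real ^ 'n \<Rightarrow> (real ^ 'n) measure"
    and T \<gamma> C :: real
  assumes gamma: "0 < \<gamma>" "\<gamma> < 1" and C_nonneg: "C \<ge> 0"
    and prob_kernel: "\<And>s r x. 0 \<le> s \<Longrightarrow> s < r \<Longrightarrow> r \<le> T \<Longrightarrow> prob_space (\<kappa> s r x)"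
    and sets_kernel: "\<And>s r x. 0 \<le> s \<Longrightarrow> s < r \<Longrightarrow> r \<le> T \<Longrightarrow> sets (\<kappa> s r x) = sets borel"
    and R_eq: "\<And>s r x \<phi>. 0 \<le> s \<Longrightarrow> s < r \<Longrightarrow> r \<le> T \<Longrightarrow> \<phi> \<in> bounded_borel \<Longrightarrow>
       R s r \<phi> x = (\<integral>y. \<phi> y \<partial>\<kappa> s r x)"
    and R_continuous: "\<And>\<phi>. \<phi> \<in> bounded_borel \<Longrightarrow>
       continuous_on {(s, r, x). 0 \<le> s \<and> s < r \<and> r \<le> T} (\<lambda>(s, r, x). R s r \<phi> x)"
    and R_smooth: "\<And>s r \<phi> c. 0 \<le> s \<Longrightarrow> s < r \<Longrightarrow> r \<le> T \<Longrightarrow> \<phi> \<in> bounded_borel \<Longrightarrow> (\<And>y. \<bar>\<phi> y\<bar> \<le> c) \<Longrightarrow>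
       \<exists>g. continuous_on UNIV g \<and> (\<forall>x. (R s r \<phi> has_derivative (\<lambda>k. g x \<bullet> k)) (at x)) \<and>
         (\<forall>x. norm (g x) \<le> C * c * (r - s) powr (-\<gamma>))"
begin

abbreviation "\<Delta> \<equiv> {(s :: real, r, x :: real ^ 'n). 0 \<le> s \<and> s < r \<and> r \<le> T}"

lemma R_gradient:
  assumes "0 \<le> s" "s < r" "r \<le> T" "\<phi> \<in> bounded_borel"
  shows "(R s r \<phi> has_derivative (\<lambda>k. gradient (R s r \<phi>) x \<bullet> k)) (at x)"
    and "continuous_on UNIV (gradient (R s r \<phi>))"
    and "(\<And>y. \<bar>\<phi> y\<bar> \<le> c) \<Longrightarrow> norm (gradient (R s r \<phi>) x) \<le> C * c * (r - s) powr (-\<gamma>)"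
proof -
  obtain d where "\<And>y. \<bar>\<phi> y\<bar> \<le> d" using assms(4) by (auto simp: bounded_borel_def bounded_iff)
  note * = R_smooth[OF assms this]
  from * obtain g where g: "continuous_on UNIV g" "\<And>x. (R s r \<phi> has_derivative (\<lambda>k. g x \<bullet> k)) (at x)" by blast
  have "gradient (R s r \<phi>) = g" using gradient_eqI(2)[OF g(2)] by blast
  with g show "(R s r \<phi> has_derivative (\<lambda>k. gradient (R s r \<phi>) x \<bullet> k)) (at x)"
     "continuous_on UNIV (gradient (R s r \<phi>))" by auto
next
  assume "\<And>y. \<bar>\<phi> y\<bar> \<le> c"
  from R_smooth[OF assms this] obtain g where "\<And>x. (R s r \<phi> has_derivative (\<lambda>k. g x \<bullet> k)) (at x)"
    "\<And>x. norm (g x) \<le> C * c * (r - s) powr (-\<gamma>)" by blast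
  with gradient_eqI(2) show "norm (gradient (R s r \<phi>) x) \<le> C * c * (r - s) powr (-\<gamma>)" by metis
qed

lemma kernel_integrable:
  assumes "0 \<le> s" "s < r" "r \<le> T" "\<phi> \<in> bounded_borel"
  shows "integrable (\<kappa> s r x) \<phi>"
proof -
  interpret prob_space "\<kappa> s r x" using assms by (intro prob_kernel)
  obtain d where "\<And>y. \<bar>\<phi> y\<bar> \<le> d" using assms(4) by (auto simp: bounded_borel_def bounded_iff)
  then show ?thesis
    by (intro integrable_const_bound[of _ d])
      (use assms in \<open>auto simp: bounded_borel_def measurable_cong_sets[OF sets_kernel refl]\<close>)
qed

lemma R_bound:
  assumes "0 \<le> s" "s < r" "r \<le> T" "\<phi> \<in> bounded_borel" "\<And>y. \<bar>\<phi> y\<bar> \<le> c"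
  shows "\<bar>R s r \<phi> x\<bar> \<le> c"
proof -
  interpret prob_space "\<kappa> s r x" using assms by (intro prob_kernel)
  have "\<bar>\<integral>y. \<phi> y \<partial>\<kappa> s r x\<bar> \<le> (\<integral>y. \<bar>\<phi> y\<bar> \<partial>\<kappa> s r x)" by (rule integral_abs_bound)
  also have "\<dots> \<le> c"
    by (rule integral_le_const) (use kernel_integrable[OF assms(1-4)] assms(5) in auto)
  finally show ?thesis using assms by (simp add: R_eq)
qed

lemma R_diff:
  assumes "0 \<le> s" "s < r" "r \<le> T" "\<phi> \<in> bounded_borel" "\<eta> \<in> bounded_borel"
  shows "R s r (\<lambda>y. \<phi> y - \<eta> y) x = R s r \<phi> x - R s r \<eta> x"
proof -
  have "(\<lambda>y. \<phi> y - \<eta> y) \<in> bounded_borel"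
    using assms(4,5) by (auto simp: bounded_borel_def intro: bounded_minus_comp)
  then show ?thesis using kernel_integrable assms by (simp add: R_eq)
qed

lemma Delta_measurable: "\<Delta> \<in> sets borel"
proof -
  have "Measurable.pred (borel \<Otimes>\<^sub>M borel \<Otimes>\<^sub>M borel) (\<lambda>(s :: real, r, x :: real ^ 'n). 0 \<le> s \<and> s < r \<and> r \<le> T)"
    by measurable
  then show ?thesis
    unfolding borel_prod[symmetric] pred_def by (simp add: space_pair_measure)
qed

text \<open>Here the test function varies with \<open>r\<close>, so continuity of \<open>R\<close>
  for a fixed \<phi> does not apply directly. For indicators it shows that \<kappa> is a measurable
  kernel on the set \<Delta>, and integrating a jointly measurable function against a measurable
  kernel is measurable. Outside \<Delta> nothing is known of \<open>R\<close>, so it is replaced by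
  zero there.\<close>

lemma R_measurable:
  assumes \<psi>: "\<psi> \<in> borel_measurable borel" and b: "\<And>r. (\<lambda>y. \<psi> (r, y)) \<in> bounded_borel"
  shows "(\<lambda>(s, r, x). indicator \<Delta> (s, r, x) *\<^sub>R R s r (\<lambda>y. \<psi> (r, y)) x) \<in> borel_measurable borel"
proof -
  let ?D = "restrict_space borel \<Delta>"
  have ker: "(\<lambda>(s, r, x). \<kappa> s r x) \<in> ?D \<rightarrow>\<^sub>M subprob_algebra borel"
  proof (rule measurable_subprob_algebra)
    fix A :: "(real ^ 'n) set" assume A: "A \<in> sets borel"
    have ib: "indicator A \<in> bounded_borel"
      using A by (auto simp: bounded_borel_def bounded_iff intro!: exI[of _ 1] simp: indicator_def)
    have "(\<lambda>(s, r, x). ennreal (R s r (indicator A) x)) \<in> borel_measurable ?D"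
      using borel_measurable_continuous_on_restrict[OF R_continuous[OF ib]]
      by (simp add: split_def)
    moreover have "(\<lambda>p. emeasure (case p of (s, r, x) \<Rightarrow> \<kappa> s r x) A) \<in> borel_measurable ?D \<longleftrightarrow>
      (\<lambda>(s, r, x). ennreal (R s r (indicator A) x)) \<in> borel_measurable ?D"
    proof (rule measurable_cong)
      fix p assume "p \<in> space ?D"
      then obtain s r x where p: "p = (s, r, x)" "0 \<le> s" "s < r" "r \<le> T"
        by (auto simp: space_restrict_space)
      interpret prob_space "\<kappa> s r x" using p by (intro prob_kernel)
      show "emeasure (case p of (s, r, x) \<Rightarrow> \<kappa> s r x) A = (case p of (s, r, x) \<Rightarrow> ennreal (R s r (indicator A) x))"
        using p A ib sets_kernel[OF p(2-4)] by (simp add: R_eq emeasure_eq_measure)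
    qed
    ultimately show "(\<lambda>p. emeasure (case p of (s, r, x) \<Rightarrow> \<kappa> s r x) A) \<in> borel_measurable ?D" by simp
  qed (auto simp: space_restrict_space sets_kernel intro: prob_space_imp_subprob_space prob_kernel)
  have "(\<lambda>d :: real \<times> real \<times> (real ^ 'n). fst (snd d)) \<in> ?D \<rightarrow>\<^sub>M borel"
    unfolding borel_prod[symmetric] by (rule measurable_restrict_space1) measurable
  then have [measurable]: "(\<lambda>p. fst (snd (fst p))) \<in> ?D \<Otimes>\<^sub>M (borel :: (real ^ 'n) measure) \<rightarrow>\<^sub>M borel"
    by (rule measurable_compose[OF measurable_fst])
  have [measurable]: "\<psi> \<in> borel_measurable (borel \<Otimes>\<^sub>M borel)" using \<psi> by (simp add: borel_prod)
  have [measurable]: "(\<lambda>p. \<psi> (fst (snd (fst p)), snd p)) \<in> borel_measurable (?D \<Otimes>\<^sub>M borel)" by measurable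
  \<comment> \<open>The integral is handled as the difference of its positive and negative parts,
    each a nonnegative integral against the kernel.\<close>
  have pos: "(\<lambda>(p, y). ennreal (\<psi> (fst (snd p), y))) \<in> borel_measurable (?D \<Otimes>\<^sub>M borel)"
  proof -
    have "(\<lambda>q. ennreal (\<psi> (fst (snd (fst q)), snd q))) \<in> borel_measurable (?D \<Otimes>\<^sub>M borel)" by measurable
    then show ?thesis by (rule back_subst[where P="\<lambda>f. f \<in> borel_measurable _"]) (auto simp: fun_eq_iff)
  qed
  have neg: "(\<lambda>(p, y). ennreal (- \<psi> (fst (snd p), y))) \<in> borel_measurable (?D \<Otimes>\<^sub>M borel)"
  proof -
    have "(\<lambda>q. ennreal (- \<psi> (fst (snd (fst q)), snd q))) \<in> borel_measurable (?D \<Otimes>\<^sub>M borel)" by measurable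
    then show ?thesis by (rule back_subst[where P="\<lambda>f. f \<in> borel_measurable _"]) (auto simp: fun_eq_iff)
  qed
  have nn: "(\<lambda>p. enn2real (\<integral>\<^sup>+y. ennreal (\<psi> (fst (snd p), y)) \<partial>(case p of (s, r, x) \<Rightarrow> \<kappa> s r x))
      - enn2real (\<integral>\<^sup>+y. ennreal (- \<psi> (fst (snd p), y)) \<partial>(case p of (s, r, x) \<Rightarrow> \<kappa> s r x))) \<in> borel_measurable ?D"
    by (intro borel_measurable_diff borel_measurable_enn2real
          nn_integral_measurable_subprob_algebra2[OF pos ker] nn_integral_measurable_subprob_algebra2[OF neg ker])
  have "(\<lambda>(s, r, x). \<integral>y. \<psi> (r, y) \<partial>\<kappa> s r x) \<in> borel_measurable ?D"
    by (subst measurable_cong[OF _, of _ _ "\<lambda>p. enn2real (\<integral>\<^sup>+y. ennreal (\<psi> (fst (snd p), y)) \<partial>(case p of (s, r, x) \<Rightarrow> \<kappa> s r x))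
      - enn2real (\<integral>\<^sup>+y. ennreal (- \<psi> (fst (snd p), y)) \<partial>(case p of (s, r, x) \<Rightarrow> \<kappa> s r x))"])
      (use nn in \<open>auto simp: space_restrict_space intro!: real_lebesgue_integral_def kernel_integrable b\<close>)
  moreover have "(\<lambda>(s, r, x). \<integral>y. \<psi> (r, y) \<partial>\<kappa> s r x) \<in> borel_measurable ?D \<longleftrightarrow>
      (\<lambda>(s, r, x). R s r (\<lambda>y. \<psi> (r, y)) x) \<in> borel_measurable ?D"
    by (rule measurable_cong) (auto simp: space_restrict_space R_eq b)
  ultimately have "(\<lambda>(s, r, x). R s r (\<lambda>y. \<psi> (r, y)) x) \<in> borel_measurable ?D" by simp
  then show ?thesis
    by (subst (asm) borel_measurable_restrict_space_iff) (use Delta_measurable in \<open>auto simp: split_def\<close>)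
qed

end

section \<open>Time integrals of a smoothing kernel\<close>

context smoothing_kernel
begin

text \<open>The open interval leaves out r = s, where the kernel does not smooth, and r = t, where
  the field may be undefined.\<close>

definition potential :: "real \<Rightarrow> (real \<times> (real ^ 'n) \<Rightarrow> real) \<Rightarrow> real \<Rightarrow> real ^ 'n \<Rightarrow> real" where
  "potential t \<psi> s x = (\<integral>r. indicator {s<..<t} r *\<^sub>R R s r (\<lambda>y. \<psi> (r, y)) x \<partial>lborel)"

definition wt :: "real \<Rightarrow> real \<Rightarrow> real \<times> (real ^ 'n) \<Rightarrow> real" where
  "wt \<rho> t z = weight \<gamma> \<rho> t (fst z)"

abbreviation "adm \<rho> t \<equiv> weighted_bounded borel (wt \<rho> t)"

lemma adm_section:
  assumes "adm \<rho> t c \<psi>"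
  shows "(\<lambda>y. \<psi> (r, y)) \<in> bounded_borel" and "\<bar>\<psi> (r, y)\<bar> \<le> c * weight \<gamma> \<rho> t r"
proof -
  have [measurable]: "\<psi> \<in> borel_measurable (borel \<Otimes>\<^sub>M borel)"
    using assms by (simp add: borel_prod weighted_bounded_def)
  show b: "\<bar>\<psi> (r, y)\<bar> \<le> c * weight \<gamma> \<rho> t r" for y
    using assms by (simp add: weighted_bounded_def wt_def)
  show "(\<lambda>y. \<psi> (r, y)) \<in> bounded_borel"
    using b by (auto simp: bounded_borel_def bounded_iff intro!: exI[of _ "c * weight \<gamma> \<rho> t r"])
qed

text \<open>The jointly measurable version of the integrand; on the range of integration it agrees
  with \<open>R\<close>, and Fubini arguments are run on it.\<close>

definition masked :: "(real \<times> (real ^ 'n) \<Rightarrow> real) \<Rightarrow> real \<times> real \<times> (real ^ 'n) \<Rightarrow> real" where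
  "masked \<psi> = (\<lambda>(s, r, x). indicator \<Delta> (s, r, x) *\<^sub>R R s r (\<lambda>y. \<psi> (r, y)) x)"

lemma masked_measurable:
  assumes "adm \<rho> t c \<psi>"
  shows "masked \<psi> \<in> borel_measurable (borel \<Otimes>\<^sub>M borel \<Otimes>\<^sub>M borel)"
  using R_measurable[of \<psi>] adm_section(1)[OF assms] assms
  unfolding masked_def[symmetric] by (simp add: borel_prod weighted_bounded_def)

lemma masked_Ioo:
  assumes "0 \<le> s" "t \<le> T"
  shows "indicator {s<..<t} r *\<^sub>R R s r (\<lambda>y. \<psi> (r, y)) x = indicator {s<..<t} r *\<^sub>R masked \<psi> (s, r, x)"
  using assms by (auto simp: indicator_def masked_def)

lemma potential_integrand_measurable:
  assumes "adm \<rho> t c \<psi>" "0 \<le> s" "t \<le> T"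
  shows "(\<lambda>r. indicator {s<..<t} r *\<^sub>R R s r (\<lambda>y. \<psi> (r, y)) x) \<in> borel_measurable borel"
proof -
  note [measurable] = masked_measurable[OF assms(1)]
  show ?thesis by (subst masked_Ioo[OF assms(2,3)]) measurable
qed

lemma potential_measurable:
  assumes "adm \<rho> t c \<psi>" "t \<le> T"
  shows "(\<lambda>(s, x). indicator {0..<t} s *\<^sub>R potential t \<psi> s x) \<in> borel_measurable (borel \<Otimes>\<^sub>M borel)"
proof -
  note [measurable] = masked_measurable[OF assms(1)]
  have "(\<lambda>q. \<integral>r. indicator {0..<t} (fst q) *\<^sub>R (indicator {fst q<..<t} r *\<^sub>R masked \<psi> (fst q, r, snd q)) \<partial>lborel)
    \<in> borel_measurable (borel \<Otimes>\<^sub>M borel)"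
  proof (rule lborel.borel_measurable_lebesgue_integral)
    have "(\<lambda>p. indicator {0..<t} (fst (fst p)) *\<^sub>R ((if fst (fst p) < snd p \<and> snd p < t then 1 else 0) *\<^sub>R
      masked \<psi> (fst (fst p), snd p, snd (fst p))))
      \<in> borel_measurable ((borel \<Otimes>\<^sub>M borel) \<Otimes>\<^sub>M lborel)" by measurable
    then show "(\<lambda>(q, r). indicator {0..<t} (fst q) *\<^sub>R (indicator {fst q<..<t} r *\<^sub>R masked \<psi> (fst q, r, snd q)))
     \<in> borel_measurable ((borel \<Otimes>\<^sub>M borel) \<Otimes>\<^sub>M lborel)"
      by (rule back_subst[where P="\<lambda>f. f \<in> borel_measurable _"]) (auto simp: fun_eq_iff indicator_def)
  qed
  moreover have eq: "(\<integral>r. indicator {0..<t} s *\<^sub>R (indicator {s<..<t} r *\<^sub>R masked \<psi> (s, r, x)) \<partial>lborel) = indicator {0..<t} s *\<^sub>R potential t \<psi> s x" for s x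
  proof (cases "0 \<le> s")
    case True
    then show ?thesis
      by (simp only: potential_def masked_Ioo[OF _ assms(2)]) (simp only: real_scaleR_def integral_mult_right_zero)
  qed simp
  ultimately show ?thesis by (simp only: eq split_def)
qed

text \<open>\<open>R s r\<close> does not increase the sup bound of its argument, so the weight
  itself is the majorant, uniformly in \<open>s\<close> and \<open>x\<close>.\<close>

lemma potential_integrable:
  assumes "adm \<rho> t c \<psi>" "\<rho> \<ge> 0" "0 \<le> s" "t \<le> T"
  shows "integrable lborel (\<lambda>r. indicator {s<..<t} r *\<^sub>R R s r (\<lambda>y. \<psi> (r, y)) x)"
    and "\<bar>potential t \<psi> s x\<bar> \<le> c * (\<integral>r. weight \<gamma> \<rho> t r \<partial>lborel)"
proof -
  have iw: "integrable lborel (\<lambda>r. c * weight \<gamma> \<rho> t r)" using integrable_weight gamma assms(2) by simp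
  have cw: "0 \<le> c * weight \<gamma> \<rho> t r" for r using adm_section(2)[OF assms(1)] abs_ge_zero order_trans by blast
  have b: "\<bar>indicator {s<..<t} r *\<^sub>R R s r (\<lambda>y. \<psi> (r, y)) x\<bar> \<le> c * weight \<gamma> \<rho> t r" for r
    using R_bound[of s r "\<lambda>y. \<psi> (r, y)"] adm_section[OF assms(1)] assms cw[of r] by (auto simp: indicator_def)
  show i: "integrable lborel (\<lambda>r. indicator {s<..<t} r *\<^sub>R R s r (\<lambda>y. \<psi> (r, y)) x)"
    by (rule Bochner_Integration.integrable_bound[OF iw])
      (use potential_integrand_measurable[OF assms(1,3,4)] b in \<open>auto intro!: order_trans[OF b[unfolded real_scaleR_def] abs_ge_self]\<close>)
  have "\<bar>potential t \<psi> s x\<bar> \<le> (\<integral>r. \<bar>indicator {s<..<t} r *\<^sub>R R s r (\<lambda>y. \<psi> (r, y)) x\<bar> \<partial>lborel)"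
    unfolding potential_def by (rule integral_abs_bound)
  also have "\<dots> \<le> (\<integral>r. c * weight \<gamma> \<rho> t r \<partial>lborel)"
    by (rule integral_mono) (use i iw b in auto)
  finally show "\<bar>potential t \<psi> s x\<bar> \<le> c * (\<integral>r. weight \<gamma> \<rho> t r \<partial>lborel)" by simp
qed

lemma potential_diff:
  assumes "adm \<rho> t c \<psi>" "adm \<rho> t d \<eta>" "\<rho> \<ge> 0" "0 \<le> s" "t \<le> T"
  shows "potential t (\<lambda>z. \<psi> z - \<eta> z) s x = potential t \<psi> s x - potential t \<eta> s x"
proof -
  have "potential t \<psi> s x - potential t \<eta> s x = (\<integral>r. indicator {s<..<t} r *\<^sub>R R s r (\<lambda>y. \<psi> (r, y)) x -
     indicator {s<..<t} r *\<^sub>R R s r (\<lambda>y. \<eta> (r, y)) x \<partial>lborel)"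
    unfolding potential_def
    by (rule Bochner_Integration.integral_diff[symmetric]) (rule potential_integrable assms | rule assms)+
  also have "\<dots> = potential t (\<lambda>z. \<psi> z - \<eta> z) s x"
    unfolding potential_def
    by (rule Bochner_Integration.integral_cong)
       (use assms in \<open>auto simp: indicator_def R_diff adm_section(1)[OF assms(1)] adm_section(1)[OF assms(2)]\<close>)
  finally show ?thesis by simp
qed

text \<open>Dominated convergence with the weight as majorant. The moving lower endpoint makes the
  integrand discontinuous only at r = a, a null set.\<close>

lemma potential_continuous:
  assumes "adm \<rho> t c \<psi>" "\<rho> \<ge> 0" "t \<le> T"
  shows "continuous_on {0..<t} (\<lambda>s. potential t \<psi> s x)"
proof (unfold continuous_on_sequentially, intro allI ballI impI, elim conjE)
  fix X :: "nat \<Rightarrow> real" and a assume a: "a \<in> {0..<t}" and X: "\<forall>n. X n \<in> {0..<t}" "X \<longlonglongrightarrow> a"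
  have iw: "integrable lborel (\<lambda>r. c * weight \<gamma> \<rho> t r)" using integrable_weight gamma assms(2) by simp
  have cw: "0 \<le> c * weight \<gamma> \<rho> t r" for r using adm_section(2)[OF assms(1)] abs_ge_zero order_trans by blast
  have "(\<lambda>n. potential t \<psi> (X n) x) \<longlonglongrightarrow> potential t \<psi> a x"
    unfolding potential_def
  proof (rule integral_dominated_convergence[OF _ _ iw])
    show "(\<lambda>r. indicator {a<..<t} r *\<^sub>R R a r (\<lambda>y. \<psi> (r, y)) x) \<in> borel_measurable lborel"
      "\<And>n. (\<lambda>r. indicator {X n<..<t} r *\<^sub>R R (X n) r (\<lambda>y. \<psi> (r, y)) x) \<in> borel_measurable lborel"
      using potential_integrand_measurable[OF assms(1) _ assms(3)] a X by auto
    show "AE r in lborel. norm (indicator {X n<..<t} r *\<^sub>R R (X n) r (\<lambda>y. \<psi> (r, y)) x) \<le> c * weight \<gamma> \<rho> t r" for n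
      using R_bound[of "X n" _ "\<lambda>y. \<psi> (_, y)"] adm_section[OF assms(1)] assms cw X(1)[rule_format, of n]
      by (intro AE_I2) (auto simp: indicator_def)
    show "AE r in lborel. (\<lambda>n. indicator {X n<..<t} r *\<^sub>R R (X n) r (\<lambda>y. \<psi> (r, y)) x)
        \<longlonglongrightarrow> indicator {a<..<t} r *\<^sub>R R a r (\<lambda>y. \<psi> (r, y)) x"
    proof (rule AE_mp[OF AE_lborel_singleton[of a]], rule AE_I2, rule impI)
      fix r assume "r \<noteq> a"
      then consider "a < r" "r < t" | "r < a" | "r \<ge> t" by linarith
      then show "(\<lambda>n. indicator {X n<..<t} r *\<^sub>R R (X n) r (\<lambda>y. \<psi> (r, y)) x)
        \<longlonglongrightarrow> indicator {a<..<t} r *\<^sub>R R a r (\<lambda>y. \<psi> (r, y)) x"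
      proof cases
        case 1
        from order_tendstoD(2)[OF X(2) 1(1)] have ev: "eventually (\<lambda>n. X n < r) sequentially" .
        have "continuous_on {0..<r} (\<lambda>s. case (s, r, x) of (s, r', x) \<Rightarrow> R s r' (\<lambda>y. \<psi> (r, y)) x)"
          by (rule continuous_on_compose2[OF R_continuous[OF adm_section(1)[OF assms(1), of r]], of _ "\<lambda>s. (s, r, x)"])
             (use 1 assms in \<open>auto intro!: continuous_intros\<close>)
        then have "continuous_on {0..<r} (\<lambda>s. R s r (\<lambda>y. \<psi> (r, y)) x)" by simp
        then have "(\<lambda>n. R (X n) r (\<lambda>y. \<psi> (r, y)) x) \<longlonglongrightarrow> R a r (\<lambda>y. \<psi> (r, y)) x"
          by (rule continuous_on_tendsto_compose[OF _ X(2)]) (use a 1 ev X in \<open>auto elim!: eventually_mono\<close>)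
        moreover have "eventually (\<lambda>n. R (X n) r (\<lambda>y. \<psi> (r, y)) x = indicator {X n<..<t} r *\<^sub>R R (X n) r (\<lambda>y. \<psi> (r, y)) x) sequentially"
          using ev 1 by (auto elim!: eventually_mono simp: indicator_def)
        ultimately show ?thesis using 1 by (simp add: Lim_transform_eventually)
      next
        case 2
        from order_tendstoD(1)[OF X(2) 2] have "eventually (\<lambda>n. indicator {X n<..<t} r *\<^sub>R R (X n) r (\<lambda>y. \<psi> (r, y)) x = 0) sequentially"
          by (rule eventually_mono) auto
        then show ?thesis using 2 by (auto intro!: tendsto_eventually)
      qed auto
    qed
  qed
  then show "((\<lambda>s. potential t \<psi> s x) \<circ> X) \<longlonglongrightarrow> potential t \<psi> a x" by (simp add: o_def)
qed

definition contraction_weight :: "real \<Rightarrow> real \<Rightarrow> bool" where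
  "contraction_weight \<epsilon> \<rho> \<longleftrightarrow> \<rho> \<ge> 0 \<and> (\<forall>s t. 0 \<le> s \<longrightarrow> s < t \<longrightarrow> t \<le> T \<longrightarrow>
     integrable lborel (\<lambda>r. indicator {s<..<t} r * ((r - s) powr (-\<gamma>) * weight \<gamma> \<rho> t r)) \<and>
     (\<integral>r. indicator {s<..<t} r * ((r - s) powr (-\<gamma>) * weight \<gamma> \<rho> t r) \<partial>lborel) \<le> \<epsilon> * weight \<gamma> \<rho> t s)"

text \<open>Differentiation under the time integral. The gradient of the integrand is at most
  \<open>C * c\<close> times (r - s) powr (-\<gamma>) times the weight at \<open>r\<close>, and the
  choice of \<rho> makes the integral of that product at most \<epsilon> times the weight at
  \<open>s\<close>.\<close>

lemma potential_gradient:
  assumes adm: "adm \<rho> t c \<psi>" and \<rho>: "contraction_weight \<epsilon> \<rho>" and st: "0 \<le> s" "s < t" "t \<le> T"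
  shows "(potential t \<psi> s has_derivative (\<lambda>k. gradient (potential t \<psi> s) x \<bullet> k)) (at x)"
    and "continuous_on UNIV (gradient (potential t \<psi> s))"
    and "norm (gradient (potential t \<psi> s) x) \<le> C * c * \<epsilon> * weight \<gamma> \<rho> t s"
proof -
  let ?h = "\<lambda>x r. indicator {s<..<t} r *\<^sub>R R s r (\<lambda>y. \<psi> (r, y)) x"
  let ?g = "\<lambda>x r. indicator {s<..<t} r *\<^sub>R gradient (R s r (\<lambda>y. \<psi> (r, y))) x"
  let ?b = "\<lambda>r. C * c * (indicator {s<..<t} r * ((r - s) powr (-\<gamma>) * weight \<gamma> \<rho> t r))"
  have \<rho>0: "\<rho> \<ge> 0" using \<rho> by (simp add: contraction_weight_def)
  have bi: "integrable lborel ?b" using \<rho> st by (simp add: contraction_weight_def)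
  have ble: "(\<integral>r. ?b r \<partial>lborel) \<le> C * c * \<epsilon> * weight \<gamma> \<rho> t s"
  proof -
    have "0 \<le> c * weight \<gamma> \<rho> t s" using adm_section(2)[OF adm] abs_ge_zero order_trans by blast
    moreover have "weight \<gamma> \<rho> t s > 0" using st by (simp add: weight_def)
    ultimately have "c \<ge> 0" by (simp add: zero_le_mult_iff)
    then have "C * c * (\<integral>r. indicator {s<..<t} r * ((r - s) powr (-\<gamma>) * weight \<gamma> \<rho> t r) \<partial>lborel) \<le> C * c * (\<epsilon> * weight \<gamma> \<rho> t s)"
      using \<rho> st C_nonneg by (intro mult_left_mono) (auto simp: contraction_weight_def)
    then show ?thesis by simp
  qed
  have der: "((\<lambda>x. ?h x r) has_derivative (\<lambda>k. ?g x r \<bullet> k)) (at x)" for x r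
    using R_gradient(1)[of s r "\<lambda>y. \<psi> (r, y)" x] adm_section(1)[OF adm] st
    by (cases "r \<in> {s<..<t}") auto
  have bnd: "norm (?g x r) \<le> ?b r" for x r
    using R_gradient(3)[of s r "\<lambda>y. \<psi> (r, y)" "c * weight \<gamma> \<rho> t r" x] adm_section[OF adm] st
    by (cases "r \<in> {s<..<t}") (auto simp: mult_ac)
  have cont: "isCont (\<lambda>x. ?g x r) x" for x r
    using R_gradient(2)[of s r "\<lambda>y. \<psi> (r, y)"] adm_section(1)[OF adm] st
    by (cases "r \<in> {s<..<t}") (auto simp: continuous_on_eq_continuous_at)
  note dui = open_UNIV convex_UNIV UNIV_I potential_integrable(1)[OF adm \<rho>0 st(1,3)] der bnd bi
  have d: "(potential t \<psi> s has_derivative (\<lambda>k. (\<integral>r. ?g x r \<partial>lborel) \<bullet> k)) (at x)" for x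
    using has_derivative_integral[where h="?h" and g="?g" and N=lborel and U=UNIV, OF dui]
    unfolding potential_def[abs_def] .
  have eq: "gradient (potential t \<psi> s) = (\<lambda>x. \<integral>r. ?g x r \<partial>lborel)"
    using gradient_eqI(2)[OF d] by blast
  show "(potential t \<psi> s has_derivative (\<lambda>k. gradient (potential t \<psi> s) x \<bullet> k)) (at x)"
    using d by (simp add: eq)
  show "continuous_on UNIV (gradient (potential t \<psi> s))"
    unfolding eq continuous_on_eq_continuous_at[OF open_UNIV]
    using isCont_integral_gradient[where h="?h" and g="?g" and N=lborel and U=UNIV, OF dui cont] by blast
  have "norm (\<integral>r. ?g x r \<partial>lborel) \<le> (\<integral>r. norm (?g x r) \<partial>lborel)" by (rule integral_norm_bound)
  also have "\<dots> \<le> (\<integral>r. ?b r \<partial>lborel)"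
    by (rule integral_mono[OF _ bi bnd])
       (rule integrable_norm, rule integrable_gradient[where h="?h" and g="?g" and N=lborel and U=UNIV, OF dui])
  also note ble
  finally show "norm (gradient (potential t \<psi> s) x) \<le> C * c * \<epsilon> * weight \<gamma> \<rho> t s" by (simp add: eq)
qed

end

section \<open>Measurable gradients and the space \<open>Lambda1\<close>\<close>

lemma gradient_measurable:
  fixes F :: "real \<Rightarrow> real ^ 'n \<Rightarrow> real"
  assumes [measurable]: "(\<lambda>(s, x). indicator S s *\<^sub>R F s x) \<in> borel_measurable (borel \<Otimes>\<^sub>M borel)"
    and der: "\<And>s x. s \<in> S \<Longrightarrow> F s differentiable (at x)"
  shows "(\<lambda>(s, x). indicator S s *\<^sub>R gradient (F s) x) \<in> borel_measurable (borel \<Otimes>\<^sub>M borel)"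
proof -
  \<comment> \<open>The gradient at the varying point \<open>snd z\<close> is the gradient at the
    fixed point 0 of the function translated by \<open>snd z\<close>, so that only the parameter
    \<open>z\<close> varies.\<close>
  have "(\<lambda>z. indicator S (fst z) *\<^sub>R gradient (F (fst z)) (snd z)) \<in> borel_measurable (borel \<Otimes>\<^sub>M borel)"
  proof (rule borel_measurable_gradient[OF open_UNIV UNIV_I,
        where h="\<lambda>x z. indicator S (fst z) *\<^sub>R F (fst z) (snd z + x)" and x=0])
    fix x :: "real ^ 'n"
    have "(\<lambda>z. (\<lambda>(s, x). indicator S s *\<^sub>R F s x) (fst z, snd z + x)) \<in> borel_measurable (borel \<Otimes>\<^sub>M borel)"
      by measurable
    then show "(\<lambda>z. indicator S (fst z) *\<^sub>R F (fst z) (snd z + x)) \<in> borel_measurable (borel \<Otimes>\<^sub>M borel)" by simp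
  next
    fix z :: "real \<times> (real ^ 'n)"
    show "((\<lambda>x. indicator S (fst z) *\<^sub>R F (fst z) (snd z + x)) has_derivative
       (\<lambda>k. indicator S (fst z) *\<^sub>R gradient (F (fst z)) (snd z) \<bullet> k)) (at 0)"
    proof (cases "fst z \<in> S")
      case True
      have "((\<lambda>x. F (fst z) (snd z + x)) has_derivative (\<lambda>k. gradient (F (fst z)) (snd z) \<bullet> k)) (at 0)"
        by (rule has_derivative_compose[where f="\<lambda>x. snd z + x" and g="F (fst z)"])
           (auto intro!: derivative_eq_intros has_derivative_gradient der True)
      then show ?thesis using True by simp
    qed simp
  qed
  then show ?thesis by (simp add: split_def)
qed

lemma Cb1_D:
  assumes "f \<in> Cb1"
  shows "f differentiable (at x)" and "0 \<le> sup_norm f"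
    and "\<bar>partial_deriv i f x\<bar> \<le> (SUP i. sup_norm (partial_deriv i f))"
proof -
  show "f differentiable (at x)" using assms by (simp add: Cb1_def)
  have bdd: "bdd_above (range (\<lambda>x. \<bar>g x\<bar>))" if "bounded (range g)" for g :: "real ^ 'n \<Rightarrow> real"
    using that by (auto simp: bounded_iff bdd_above_def)
  have "\<bar>f undefined\<bar> \<le> sup_norm f"
    unfolding sup_norm_def using assms by (intro cSUP_upper bdd) (auto simp: Cb1_def)
  then show "0 \<le> sup_norm f" by linarith
  have "\<bar>partial_deriv i f x\<bar> \<le> sup_norm (partial_deriv i f)"
    unfolding sup_norm_def using assms by (intro cSUP_upper bdd) (auto simp: Cb1_def)
  also have "\<dots> \<le> (SUP i. sup_norm (partial_deriv i f))"
    by (intro cSUP_upper bdd_above_finite) auto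
  finally show "\<bar>partial_deriv i f x\<bar> \<le> (SUP i. sup_norm (partial_deriv i f))" .
qed

lemma Lambda1_D:
  fixes v :: "real \<Rightarrow> real ^ 'n \<Rightarrow> real"
  assumes "(\<lambda>s x. v (t - s) x) \<in> Lambda1 \<gamma> t"
  shows "(\<lambda>(s, x). indicator {0..<t} s *\<^sub>R v s x) \<in> borel_measurable (borel \<Otimes>\<^sub>M borel)"
    and "s \<in> {0..<t} \<Longrightarrow> v s differentiable (at x)"
    and "\<exists>d. \<forall>s\<in>{0..<t}. \<forall>x. norm (gradient (v s) x) \<le> d * (t - s) powr (-\<gamma>)"
proof -
  let ?S = "{0<..t} \<times> (UNIV :: (real ^ 'n) set)"
  have cb: "v s \<in> Cb1" if "s \<in> {0..<t}" for s
    using assms that by (auto simp: Lambda1_def dest!: bspec[of _ _ "t - s"])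
  then show "s \<in> {0..<t} \<Longrightarrow> v s differentiable (at x)" using Cb1_D by blast
  have "(\<lambda>(s, x). v (t - s) x) \<in> borel_measurable (restrict_space borel ?S)"
    using assms by (simp add: Lambda1_def)
  moreover have "?S \<in> sets borel"
    unfolding borel_prod[symmetric] by (intro pair_measureI) auto
  ultimately have *: "(\<lambda>z. indicator ?S z *\<^sub>R (case z of (s, x) \<Rightarrow> v (t - s) x)) \<in> borel_measurable (borel \<Otimes>\<^sub>M borel)"
    by (subst (asm) borel_measurable_restrict_space_iff) (auto simp: borel_prod)
  have "(\<lambda>z. (t - fst z, snd z)) \<in> borel \<Otimes>\<^sub>M borel \<rightarrow>\<^sub>M (borel \<Otimes>\<^sub>M borel :: (real \<times> (real ^ 'n)) measure)" by measurable
  from measurable_compose[OF this *]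
  show "(\<lambda>(s, x). indicator {0..<t} s *\<^sub>R v s x) \<in> borel_measurable (borel \<Otimes>\<^sub>M borel)"
    by (rule back_subst[where P="\<lambda>f. f \<in> borel_measurable _"]) (auto simp: fun_eq_iff indicator_def)
  have "bdd_above ((\<lambda>s. s powr \<gamma> *
        (sup_norm (v (t - s)) + (SUP i. sup_norm (partial_deriv i (v (t - s)))))) ` {0<..t})"
    using assms by (simp add: Lambda1_def)
  then obtain c where c: "\<And>s. s \<in> {0<..t} \<Longrightarrow> s powr \<gamma> *
        (sup_norm (v (t - s)) + (SUP i. sup_norm (partial_deriv i (v (t - s))))) \<le> c"
    by (meson bdd_above.E imageI)
  \<comment> \<open>Membership bounds each partial derivative; the Euclidean norm is at most the sum
    of their absolute values, which costs the factor \<open>CARD('n)\<close>.\<close>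
  show "\<exists>d. \<forall>s\<in>{0..<t}. \<forall>x. norm (gradient (v s) x) \<le> d * (t - s) powr (-\<gamma>)"
  proof (intro exI[of _ "CARD('n) * c"] ballI allI)
    fix s x assume s: "s \<in> {0..<t}"
    let ?m = "SUP i. sup_norm (partial_deriv i (v s))"
    have "(t - s) powr \<gamma> * ?m \<le> (t - s) powr \<gamma> * (sup_norm (v s) + ?m)"
      using Cb1_D(2)[OF cb[OF s]] by (intro mult_left_mono) auto
    also have "\<dots> \<le> c" using c[of "t - s"] s by simp
    finally have m: "?m \<le> c * (t - s) powr (-\<gamma>)"
      using s by (simp add: powr_minus field_simps)
    have "norm (gradient (v s) x) \<le> (\<Sum>i\<in>UNIV. \<bar>gradient (v s) x $ i\<bar>)" by (rule norm_le_l1_cart)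
    also have "\<dots> \<le> (\<Sum>i\<in>(UNIV :: 'n set). c * (t - s) powr (-\<gamma>))"
      using order_trans[OF Cb1_D(3)[OF cb[OF s]] m] by (intro sum_mono) (simp add: gradient_component)
    finally show "norm (gradient (v s) x) \<le> CARD('n) * c * (t - s) powr (-\<gamma>)" by simp
  qed
qed

lemma Lambda1_I:
  fixes u :: "real \<Rightarrow> real ^ 'n \<Rightarrow> real"
  assumes "\<gamma> > 0"
    and meas: "(\<lambda>(s, x). indicator {0..<t} s *\<^sub>R u s x) \<in> borel_measurable (borel \<Otimes>\<^sub>M borel)"
    and cont: "\<And>x. continuous_on {0..<t} (\<lambda>s. u s x)"
    and der: "\<And>s x. s \<in> {0..<t} \<Longrightarrow> (u s has_derivative (\<lambda>k. g s x \<bullet> k)) (at x)"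
    and gc: "\<And>s. s \<in> {0..<t} \<Longrightarrow> continuous_on UNIV (g s)"
    and ub: "\<And>s x. s \<in> {0..<t} \<Longrightarrow> \<bar>u s x\<bar> \<le> a"
    and gb: "\<And>s x. s \<in> {0..<t} \<Longrightarrow> norm (g s x) \<le> d * (t - s) powr (-\<gamma>)"
  shows "(\<lambda>s x. u (t - s) x) \<in> Lambda1 \<gamma> t"
  unfolding Lambda1_def mem_Collect_eq
proof (intro conjI allI ballI)
  let ?S = "{0<..t} \<times> (UNIV :: (real ^ 'n) set)"
  have S: "?S \<in> sets borel"
    unfolding borel_prod[symmetric] by (intro pair_measureI) auto
  have "(\<lambda>z. (t - fst z, snd z)) \<in> borel \<Otimes>\<^sub>M borel \<rightarrow>\<^sub>M (borel \<Otimes>\<^sub>M borel :: (real \<times> (real ^ 'n)) measure)" by measurable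
  from measurable_compose[OF this meas]
  have "(\<lambda>z. indicator ?S z *\<^sub>R (case z of (s, x) \<Rightarrow> u (t - s) x)) \<in> borel_measurable (borel \<Otimes>\<^sub>M borel)"
    by (rule back_subst[where P="\<lambda>f. f \<in> borel_measurable _"]) (auto simp: fun_eq_iff indicator_def)
  then show "(\<lambda>(s, x). u (t - s) x) \<in> borel_measurable (restrict_space borel ?S)"
    using S by (subst borel_measurable_restrict_space_iff) (auto simp: borel_prod)
  show "continuous_on {0<..t} (\<lambda>s. u (t - s) x)" for x
    by (rule continuous_on_compose2[OF cont]) (auto intro!: continuous_intros)
  note cb = Cb1I[of "u s" "g s" a "d * (t - s) powr (-\<gamma>)" for s, OF der gc ub gb]
  show "u (t - s) \<in> Cb1" if "s \<in> {0<..t}" for s using that by (intro cb(1)) auto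
  show "bdd_above ((\<lambda>s. s powr \<gamma> * (sup_norm (u (t - s)) + (SUP i. sup_norm (partial_deriv i (u (t - s)))))) ` {0<..t})"
  proof (rule bdd_aboveI2[where M="\<bar>a\<bar> * t powr \<gamma> + d"])
    fix s assume s: "s \<in> {0<..t}"
    have "sup_norm (u (t - s)) \<le> a" using s by (intro cb(2)) auto
    moreover have "(SUP i. sup_norm (partial_deriv i (u (t - s)))) \<le> d * s powr (-\<gamma>)"
      by (rule cSUP_least) (use s cb(3)[of "t - s"] in auto)
    ultimately have "s powr \<gamma> * (sup_norm (u (t - s)) + (SUP i. sup_norm (partial_deriv i (u (t - s)))))
      \<le> s powr \<gamma> * (a + d * s powr (-\<gamma>))" by (intro mult_left_mono add_mono) auto
    also have "\<dots> = a * s powr \<gamma> + d" using s by (simp add: powr_minus field_simps)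
    also have "\<dots> \<le> \<bar>a\<bar> * t powr \<gamma> + d"
      using s assms(1) by (intro add_mono mult_mono powr_mono2) auto
    finally show "s powr \<gamma> * (sup_norm (u (t - s)) + (SUP i. sup_norm (partial_deriv i (u (t - s))))) \<le> \<bar>a\<bar> * t powr \<gamma> + d" .
  qed
qed

text \<open>The cut-off removes the final time, at which \<open>F\<close> may fail to be
  differentiable, and makes the function vanish wherever the weight does.\<close>

definition drift_deriv ::
    "real \<Rightarrow> (real \<Rightarrow> real ^ 'n \<Rightarrow> real ^ 'n) \<Rightarrow> (real \<Rightarrow> real ^ 'n \<Rightarrow> real) \<Rightarrow> real \<times> (real ^ 'n) \<Rightarrow> real" where
  "drift_deriv t B F z = indicator {0..<t} (fst z) * (B (fst z) (snd z) \<bullet> gradient (F (fst z)) (snd z))"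

section \<open>The Kolmogorov equation as a fixed point equation\<close>

locale drifted_kernel = smoothing_kernel R \<kappa> T \<gamma> C
  for R :: "real \<Rightarrow> real \<Rightarrow> (real ^ 'n \<Rightarrow> real) \<Rightarrow> real ^ 'n \<Rightarrow> real"
    and \<kappa> :: "real \<Rightarrow> real \<Rightarrow> real ^ 'n \<Rightarrow> (real ^ 'n) measure" and T \<gamma> C :: real +
  fixes B :: "real \<Rightarrow> real ^ 'n \<Rightarrow> real ^ 'n" and t b :: real
  assumes t: "0 < t" "t \<le> T"
    and B_measurable: "(\<lambda>(s, x). indicator {0..<t} s *\<^sub>R B s x) \<in> borel_measurable (borel \<Otimes>\<^sub>M borel)"
    and B_bounded: "\<And>s x. s \<in> {0..<t} \<Longrightarrow> norm (B s x) \<le> b"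
begin

lemma b_nonneg: "b \<ge> 0"
proof -
  have "norm (B 0 0) \<le> b" using t by (intro B_bounded) auto
  then show ?thesis using norm_ge_zero order_trans by blast
qed

lemma adm_nonneg:
  assumes "adm \<rho> t c \<psi>"
  shows "c \<ge> 0"
proof -
  have "0 \<le> c * weight \<gamma> \<rho> t 0" using adm_section(2)[OF assms] abs_ge_zero order_trans by blast
  moreover have "weight \<gamma> \<rho> t 0 > 0" using t by (simp add: weight_def)
  ultimately show ?thesis by (simp add: zero_le_mult_iff)
qed

lemma drift_deriv_adm:
  assumes meas: "(\<lambda>(s, x). indicator {0..<t} s *\<^sub>R F s x) \<in> borel_measurable (borel \<Otimes>\<^sub>M borel)"
    and der: "\<And>s x. s \<in> {0..<t} \<Longrightarrow> F s differentiable (at x)"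
    and bnd: "\<And>s x. s \<in> {0..<t} \<Longrightarrow> norm (gradient (F s) x) \<le> d * weight \<gamma> \<rho> t s"
    and bd: "b * d \<le> c"
  shows "adm \<rho> t c (drift_deriv t B F)"
  unfolding weighted_bounded_def
proof (intro conjI ballI)
  have "(\<lambda>z. (case z of (s, x) \<Rightarrow> indicator {0..<t} s *\<^sub>R B s x) \<bullet>
      (case z of (s, x) \<Rightarrow> indicator {0..<t} s *\<^sub>R gradient (F s) x)) \<in> borel_measurable (borel \<Otimes>\<^sub>M borel)"
    by (intro borel_measurable_inner gradient_measurable[OF meas der] B_measurable)
  then show "drift_deriv t B F \<in> borel_measurable borel"
    unfolding borel_prod
    by (rule back_subst[where P="\<lambda>f. f \<in> borel_measurable _"])
       (auto simp: fun_eq_iff drift_deriv_def indicator_def)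
next
  fix z :: "real \<times> (real ^ 'n)"
  show "\<bar>drift_deriv t B F z\<bar> \<le> c * wt \<rho> t z"
  proof (cases "fst z \<in> {0..<t}")
    case True
    have "\<bar>B (fst z) (snd z) \<bullet> gradient (F (fst z)) (snd z)\<bar> \<le> norm (B (fst z) (snd z)) * norm (gradient (F (fst z)) (snd z))"
      by (rule Cauchy_Schwarz_ineq2)
    also have "\<dots> \<le> b * (d * weight \<gamma> \<rho> t (fst z))"
      by (intro mult_mono B_bounded bnd True b_nonneg) auto
    also have "\<dots> \<le> c * weight \<gamma> \<rho> t (fst z)"
      using mult_right_mono[OF bd weight_nonneg] by (simp add: mult.assoc)
    finally show ?thesis using True by (simp add: drift_deriv_def wt_def)
  qed (simp add: drift_deriv_def wt_def weight_def)
qed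

text \<open>The radius is multiplied by b C \<epsilon>: \<open>C * \<epsilon>\<close> from the
  gradient of the potential, \<open>b\<close> from the drift. The value 1/2 is the contraction
  factor of the abstract fixed point lemmas.\<close>

lemma drift_potential_adm:
  assumes "adm \<rho> t c \<psi>" "contraction_weight \<epsilon> \<rho>" "b * C * \<epsilon> \<le> 1 / 2"
  shows "adm \<rho> t (c / 2) (drift_deriv t B (potential t \<psi>))"
proof (rule drift_deriv_adm)
  show "(\<lambda>(s, x). indicator {0..<t} s *\<^sub>R potential t \<psi> s x) \<in> borel_measurable (borel \<Otimes>\<^sub>M borel)"
    using potential_measurable[OF assms(1) t(2)] .
  show "potential t \<psi> s differentiable (at x)" if "s \<in> {0..<t}" for s x
    using potential_gradient(1)[OF assms(1,2)] that t by (auto simp: differentiable_def)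
  show "norm (gradient (potential t \<psi> s) x) \<le> C * c * \<epsilon> * weight \<gamma> \<rho> t s" if "s \<in> {0..<t}" for s x
    using potential_gradient(3)[OF assms(1,2)] that t by auto
  show "b * (C * c * \<epsilon>) \<le> c / 2"
    using mult_right_mono[OF assms(3) adm_nonneg[OF assms(1)]] by (simp add: mult_ac)
qed

text \<open>Used with \<open>k = -1\<close> for the linearity of the fixed point map and with
  \<open>k = 1\<close> to split a solution into free part and potential.\<close>

lemma drift_deriv_lincomb:
  assumes "\<And>s. s \<in> {0..<t} \<Longrightarrow> F s = (\<lambda>x. G s x + k * H s x)"
    and "\<And>s x. s \<in> {0..<t} \<Longrightarrow> G s differentiable (at x)"
    and "\<And>s x. s \<in> {0..<t} \<Longrightarrow> H s differentiable (at x)"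
  shows "drift_deriv t B F z = drift_deriv t B G z + k * drift_deriv t B H z"
proof (cases "fst z \<in> {0..<t}")
  case True
  have "gradient (F (fst z)) (snd z) = gradient (G (fst z)) (snd z) + k *\<^sub>R gradient (H (fst z)) (snd z)"
    unfolding assms(1)[OF True]
    by (rule gradient_eqI(2), rule has_derivative_eq_rhs,
        rule has_derivative_add[OF has_derivative_gradient has_derivative_mult_right[OF has_derivative_gradient]])
       (use assms True in \<open>auto simp: inner_add_left\<close>)
  then show ?thesis by (simp add: drift_deriv_def inner_add_right algebra_simps)
qed (simp add: drift_deriv_def)

lemma drift_potential_diff:
  assumes "adm \<rho> t c \<psi>" "adm \<rho> t d \<eta>" "contraction_weight \<epsilon> \<rho>"
  shows "drift_deriv t B (potential t (\<lambda>z. \<psi> z - \<eta> z)) =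
     (\<lambda>z. drift_deriv t B (potential t \<psi>) z - drift_deriv t B (potential t \<eta>) z)"
proof
  fix z
  have "\<rho> \<ge> 0" using assms(3) by (simp add: contraction_weight_def)
  have "drift_deriv t B (potential t (\<lambda>z. \<psi> z - \<eta> z)) z =
     drift_deriv t B (potential t \<psi>) z + (-1) * drift_deriv t B (potential t \<eta>) z"
  proof (rule drift_deriv_lincomb)
    show "potential t (\<lambda>z. \<psi> z - \<eta> z) s = (\<lambda>x. potential t \<psi> s x + (-1) * potential t \<eta> s x)" if "s \<in> {0..<t}" for s
      using potential_diff[OF assms(1,2) \<open>\<rho> \<ge> 0\<close>] that t by (auto simp: fun_eq_iff)
  qed (use differentiableI[OF potential_gradient(1)[OF assms(1,3)]] differentiableI[OF potential_gradient(1)[OF assms(2,3)]] t in auto)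
  then show "drift_deriv t B (potential t (\<lambda>z. \<psi> z - \<eta> z)) z =
     drift_deriv t B (potential t \<psi>) z - drift_deriv t B (potential t \<eta>) z" by simp
qed

text \<open>\<open>F\<close> and \<psi> are compared only before time \<open>t\<close>; the set
  integral over the closed interval does not see its endpoints.\<close>

lemma potential_eq:
  assumes "adm \<rho> t c \<psi>" "\<rho> \<ge> 0" "s \<in> {0..t}"
    and eq: "\<And>r. r \<in> {0..<t} \<Longrightarrow> F r = (\<lambda>y. \<psi> (r, y))"
  shows "set_integrable lborel {s..t} (\<lambda>r. R s r (F r) x)"
    and "(LINT r:{s..t}|lborel. R s r (F r) x) = potential t \<psi> s x"
proof -
  have *: "(\<lambda>r. indicator {s<..<t} r *\<^sub>R R s r (F r) x) = (\<lambda>r. indicator {s<..<t} r *\<^sub>R R s r (\<lambda>y. \<psi> (r, y)) x)"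
    using assms(3) by (intro ext) (auto simp: indicator_def eq)
  show "set_integrable lborel {s..t} (\<lambda>r. R s r (F r) x)"
    unfolding set_integral_Icc_Ioo unfolding set_integrable_def *
    using potential_integrable(1)[OF assms(1,2) _ t(2)] assms(3) by simp
  show "(LINT r:{s..t}|lborel. R s r (F r) x) = potential t \<psi> s x"
    unfolding set_integral_Icc_Ioo unfolding set_lebesgue_integral_def * potential_def ..
qed

theorem kolmogorov_wellposed:
  assumes \<phi>: "\<phi> \<in> bounded_borel"
  shows "\<exists>u. solves_kolmogorov R B \<phi> t u \<and> (\<lambda>s x. u (t - s) x) \<in> Lambda1 \<gamma> t \<and>
     (\<forall>v. solves_kolmogorov R B \<phi> t v \<and> (\<lambda>s x. v (t - s) x) \<in> Lambda1 \<gamma> t \<longrightarrow>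
       (\<forall>s\<in>{0..t}. \<forall>x. v s x = u s x))"
proof -
  \<comment> \<open>The summand 1 keeps the denominator positive when
    \<open>b * C = 0\<close>.\<close>
  define \<epsilon> where "\<epsilon> = 1 / (2 * (b * C + 1))"
  have bC: "b * C \<ge> 0" using b_nonneg C_nonneg by simp
  then have \<epsilon>: "\<epsilon> > 0" "b * C * \<epsilon> \<le> 1 / 2" by (auto simp: \<epsilon>_def divide_simps)
  obtain \<rho> where \<rho>: "contraction_weight \<epsilon> \<rho>"
    using ex_contraction_weight[OF gamma \<epsilon>(1), of T] unfolding contraction_weight_def by blast
  then have \<rho>0: "\<rho> \<ge> 0" by (simp add: contraction_weight_def)
  obtain a where a: "\<And>y. \<bar>\<phi> y\<bar> \<le> a" using \<phi> by (auto simp: bounded_borel_def bounded_iff)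
  then have a0: "a \<ge> 0" using abs_ge_zero order_trans by blast
  let ?K = "\<lambda>\<psi>. drift_deriv t B (potential t \<psi>)"
  let ?F = "\<lambda>s. R s t \<phi>"
  define \<psi>0 where "\<psi>0 = drift_deriv t B ?F"
  \<comment> \<open>Bounds of pure power type, as for the free part or for a member of
    \<open>Lambda1\<close>, are in particular bounds by the weight.\<close>
  have wle: "(t - s) powr (-\<gamma>) \<le> weight \<gamma> \<rho> t s" if "s \<in> {0..<t}" for s
  proof -
    have "(t - s) powr (-\<gamma>) * 1 \<le> (t - s) powr (-\<gamma>) * exp (\<rho> * (t - s))"
      using that \<rho>0 by (intro mult_left_mono) auto
    then show ?thesis using that by (simp add: weight_def)
  qed
  have Fm: "(\<lambda>(s, x). indicator {0..<t} s *\<^sub>R ?F s x) \<in> borel_measurable (borel \<Otimes>\<^sub>M borel)"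
  proof -
    have "continuous_on ({0..<t} \<times> UNIV) (\<lambda>z. case (fst z, t, snd z) of (s, r, x) \<Rightarrow> R s r \<phi> x)"
      by (rule continuous_on_compose2[OF R_continuous[OF \<phi>], of _ "\<lambda>z. (fst z, t, snd z)"])
        (use t in \<open>auto intro!: continuous_intros\<close>)
    moreover have "{0..<t} \<times> (UNIV :: (real ^ 'n) set) \<in> sets borel"
      unfolding borel_prod[symmetric] by (intro pair_measureI) auto
    ultimately have "(\<lambda>z. indicator ({0..<t} \<times> UNIV) z *\<^sub>R (case (fst z, t, snd z) of (s, r, x) \<Rightarrow> R s r \<phi> x)) \<in> borel_measurable borel"
      by (intro borel_measurable_continuous_on_indicator)
    then show ?thesis unfolding borel_prod
      by (rule back_subst[where P="\<lambda>f. f \<in> borel_measurable _"]) (auto simp: fun_eq_iff indicator_def)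
  qed
  have Fg: "norm (gradient (?F s) x) \<le> C * a * (t - s) powr (-\<gamma>)" if "s \<in> {0..<t}" for s x
    using R_gradient(3)[of s t \<phi> a x] that t \<phi> a by auto
  have Fd: "(?F s has_derivative (\<lambda>k. gradient (?F s) x \<bullet> k)) (at x)" if "s \<in> {0..<t}" for s x
    using R_gradient(1)[of s t \<phi> x] that t \<phi> by auto
  have \<psi>0a: "adm \<rho> t (b * (C * a)) \<psi>0"
    unfolding \<psi>0_def
  proof (rule drift_deriv_adm[OF Fm _ _ order_refl])
    show "?F s differentiable (at x)" if "s \<in> {0..<t}" for s x using Fd[OF that] by (auto simp: differentiable_def)
    show "norm (gradient (?F s) x) \<le> C * a * weight \<gamma> \<rho> t s" if "s \<in> {0..<t}" for s x
      by (rule order_trans[OF Fg[OF that]]) (use wle[OF that] C_nonneg a0 in \<open>auto intro!: mult_left_mono\<close>)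
  qed
  note K = drift_potential_adm[OF _ \<rho> \<epsilon>(2)]
  note Kd = drift_potential_diff[OF _ _ \<rho>]
  have "\<exists>\<psi>. adm \<rho> t (2 * (b * (C * a))) \<psi> \<and> \<psi> = (\<lambda>z. \<psi>0 z + ?K \<psi> z)"
    by (rule weighted_contraction_fixpoint[where K="?K"]) (use K Kd \<psi>0a weight_nonneg in \<open>auto simp: wt_def\<close>)
  then obtain \<psi> where \<psi>: "adm \<rho> t (2 * (b * (C * a))) \<psi>" "\<psi> = (\<lambda>z. \<psi>0 z + ?K \<psi> z)" by blast
  define u where "u s x = ?F s x + potential t \<psi> s x" for s x
  have pot: "(potential t \<eta> s has_derivative (\<lambda>k. gradient (potential t \<eta> s) x \<bullet> k)) (at x)"
    if "adm \<rho> t c \<eta>" "s \<in> {0..<t}" for c \<eta> s x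
    using potential_gradient(1)[OF that(1) \<rho>] that(2) t by auto
  \<comment> \<open>Applied to the constructed solution and again to any competitor: whatever
    satisfies the integral equation with field \<eta> has as its own drift derivative the right-hand
    side of the fixed point equation at \<eta>.\<close>
  have split: "drift_deriv t B w = (\<lambda>z. \<psi>0 z + ?K \<eta> z)"
    if w: "\<And>s x. s \<in> {0..<t} \<Longrightarrow> w s x = ?F s x + potential t \<eta> s x" and \<eta>: "adm \<rho> t c \<eta>" for w \<eta> c
  proof
    fix z
    have "drift_deriv t B w z = drift_deriv t B ?F z + 1 * ?K \<eta> z"
      by (rule drift_deriv_lincomb) (use w differentiableI[OF Fd] differentiableI[OF pot[OF \<eta>]] in auto)
    then show "drift_deriv t B w z = \<psi>0 z + ?K \<eta> z" by (simp add: \<psi>0_def)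
  qed
  \<comment> \<open>The field from which \<open>u\<close> was built is recovered from
    \<open>u\<close>; this is exactly the fixed point equation for \<psi>.\<close>
  have u\<psi>: "drift_deriv t B u = \<psi>" using split[OF _ \<psi>(1), of u] \<psi>(2) by (simp add: u_def)
  have sol: "solves_kolmogorov R B \<phi> t u"
    unfolding solves_kolmogorov_def
  proof (intro ballI allI conjI)
    fix s x assume s: "s \<in> {0..t}"
    have eq: "(\<lambda>y. B r y \<bullet> gradient (u r) y) = (\<lambda>y. \<psi> (r, y))" if "r \<in> {0..<t}" for r
      using that by (simp add: u\<psi>[symmetric] drift_deriv_def)
    note pe = potential_eq[where F="\<lambda>r y. B r y \<bullet> gradient (u r) y" and x=x, OF \<psi>(1) \<rho>0 s eq]
    show "set_integrable lborel {s..t} (\<lambda>r. R s r (\<lambda>y. B r y \<bullet> gradient (u r) y) x)" by (rule pe(1))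
    show "u s x = R s t \<phi> x + (LINT r:{s..t}|lborel. R s r (\<lambda>y. B r y \<bullet> gradient (u r) y) x)"
      by (simp only: pe(2)) (simp only: u_def)
  qed
  have lam: "(\<lambda>s x. u (t - s) x) \<in> Lambda1 \<gamma> t"
  proof (rule Lambda1_I[where g="\<lambda>s x. gradient (?F s) x + gradient (potential t \<psi> s) x"
        and a="a + 2 * (b * (C * a)) * (\<integral>r. weight \<gamma> \<rho> t r \<partial>lborel)" and d="C * a + C * (2 * (b * (C * a))) * \<epsilon> * exp (\<rho> * t)"])
    show "\<gamma> > 0" by (rule gamma)
    have "(\<lambda>z. (case z of (s, x) \<Rightarrow> indicator {0..<t} s *\<^sub>R ?F s x) + (case z of (s, x) \<Rightarrow> indicator {0..<t} s *\<^sub>R potential t \<psi> s x))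
        \<in> borel_measurable (borel \<Otimes>\<^sub>M borel)"
      by (intro borel_measurable_add Fm potential_measurable[OF \<psi>(1) t(2)])
    then show "(\<lambda>(s, x). indicator {0..<t} s *\<^sub>R u s x) \<in> borel_measurable (borel \<Otimes>\<^sub>M borel)"
      by (rule back_subst[where P="\<lambda>f. f \<in> borel_measurable _"]) (auto simp: fun_eq_iff u_def algebra_simps)
  next
    fix x
    have "continuous_on {0..<t} (\<lambda>s. case (s, t, x) of (s, r, x) \<Rightarrow> R s r \<phi> x)"
      by (rule continuous_on_compose2[OF R_continuous[OF \<phi>], of _ "\<lambda>s. (s, t, x)"])
        (use t in \<open>auto intro!: continuous_intros\<close>)
    then show "continuous_on {0..<t} (\<lambda>s. u s x)"
      unfolding u_def using potential_continuous[OF \<psi>(1) \<rho>0 t(2)] by (auto intro!: continuous_intros)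
  next
    fix s x assume s: "s \<in> {0..<t}"
    have "(u s has_derivative (\<lambda>k. gradient (?F s) x \<bullet> k + gradient (potential t \<psi> s) x \<bullet> k)) (at x)"
      unfolding u_def[abs_def] by (intro has_derivative_add Fd pot[OF \<psi>(1)] s)
    then show "(u s has_derivative (\<lambda>k. (gradient (?F s) x + gradient (potential t \<psi> s) x) \<bullet> k)) (at x)"
      by (simp add: inner_add_left)
    show "continuous_on UNIV (\<lambda>x. gradient (?F s) x + gradient (potential t \<psi> s) x)"
      using R_gradient(2)[of s t \<phi>] potential_gradient(2)[OF \<psi>(1) \<rho>] s t \<phi> by (auto intro!: continuous_intros)
    show "\<bar>u s x\<bar> \<le> a + 2 * (b * (C * a)) * (\<integral>r. weight \<gamma> \<rho> t r \<partial>lborel)"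
      unfolding u_def
      by (rule order_trans[OF abs_triangle_ineq add_mono[OF R_bound potential_integrable(2)[OF \<psi>(1) \<rho>0]]])
         (use s t \<phi> a in auto)
    have "norm (gradient (?F s) x + gradient (potential t \<psi> s) x) \<le>
       C * a * (t - s) powr (-\<gamma>) + C * (2 * (b * (C * a))) * \<epsilon> * weight \<gamma> \<rho> t s"
      by (rule norm_triangle_le[OF add_mono[OF Fg[OF s] potential_gradient(3)[OF \<psi>(1) \<rho>]]]) (use s t in auto)
    \<comment> \<open>Returning from the weight to the bare power costs at most
      \<open>exp (\<rho> * t)\<close>.\<close>
    also have "C * (2 * (b * (C * a))) * \<epsilon> * weight \<gamma> \<rho> t s \<le> C * (2 * (b * (C * a))) * \<epsilon> * (exp (\<rho> * t) * (t - s) powr (-\<gamma>))"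
      using s \<rho>0 \<epsilon>(1) C_nonneg b_nonneg a0 by (intro mult_left_mono) (auto simp: weight_def mult_left_mono)
    finally show "norm (gradient (?F s) x + gradient (potential t \<psi> s) x) \<le>
       (C * a + C * (2 * (b * (C * a))) * \<epsilon> * exp (\<rho> * t)) * (t - s) powr (-\<gamma>)"
      by (simp add: algebra_simps)
  qed
  have uniq: "v s x = u s x"
    if v: "solves_kolmogorov R B \<phi> t v" "(\<lambda>s x. v (t - s) x) \<in> Lambda1 \<gamma> t" and s: "s \<in> {0..t}" for v s x
  proof -
    obtain d where d: "\<And>s x. s \<in> {0..<t} \<Longrightarrow> norm (gradient (v s) x) \<le> d * (t - s) powr (-\<gamma>)"
      using Lambda1_D(3)[OF v(2)] by blast
    have d0: "d \<ge> 0"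
    proof -
      have "0 \<le> d * (t - 0) powr (-\<gamma>)" using order_trans[OF norm_ge_zero d[of 0 0]] t by simp
      then show ?thesis using t by (simp add: zero_le_mult_iff)
    qed
    \<comment> \<open>The competitor enters only through its field. Membership in
      \<open>Lambda1\<close> puts that field into the class in which fixed points are
      unique.\<close>
    define \<eta> where "\<eta> = drift_deriv t B v"
    have \<eta>: "adm \<rho> t (b * d) \<eta>"
      unfolding \<eta>_def
    proof (rule drift_deriv_adm[OF Lambda1_D(1,2)[OF v(2)] _ order_refl])
      show "norm (gradient (v s) x) \<le> d * weight \<gamma> \<rho> t s" if "s \<in> {0..<t}" for s x
        by (rule order_trans[OF d[OF that]]) (use wle[OF that] d0 in \<open>auto intro!: mult_left_mono\<close>)
    qed
    \<comment> \<open>This holds on the closed interval, so once the fields agree the functions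
      agree at s = t as well.\<close>
    have veq: "v s x = ?F s x + potential t \<eta> s x" if "s \<in> {0..t}" for s x
    proof -
      have "v s x = R s t \<phi> x + (LINT r:{s..t}|lborel. R s r (\<lambda>y. B r y \<bullet> gradient (v r) y) x)"
        using v(1) that by (simp add: solves_kolmogorov_def)
      also have "(LINT r:{s..t}|lborel. R s r (\<lambda>y. B r y \<bullet> gradient (v r) y) x) = potential t \<eta> s x"
        by (rule potential_eq(2)[OF \<eta> \<rho>0 that]) (simp add: \<eta>_def drift_deriv_def)
      finally show ?thesis .
    qed
    have fix\<eta>: "\<eta> = (\<lambda>z. \<psi>0 z + ?K \<eta> z)"
      using split[OF _ \<eta>, of v] veq by (simp add: \<eta>_def)
    have "\<eta> z = \<psi> z" for z
      by (rule weighted_contraction_unique[where K="?K", OF K Kd \<eta> fix\<eta> \<psi>]) auto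
    then have "\<eta> = \<psi>" by blast
    then show ?thesis using veq[OF s] by (simp add: u_def)
  qed
  show ?thesis using sol lam uniq by blast
qed

end

subsection \<open>Gaussian measures with diagonal covariance\<close>

text \<open>The vector \<open>a\<close> holds standard deviations, not variances.\<close>

definition gauss_density :: "real ^ 'n \<Rightarrow> real ^ 'n \<Rightarrow> real ^ 'n \<Rightarrow> real" where
  "gauss_density m a y = (\<Prod>j\<in>UNIV. normal_density (m $ j) (a $ j) (y $ j))"

definition gauss :: "real ^ 'n \<Rightarrow> real ^ 'n \<Rightarrow> (real ^ 'n) measure" where
  "gauss m a = density lborel (\<lambda>y. ennreal (gauss_density m a y))"

lemma vec_nth_measurable [measurable]: "(\<lambda>y :: real ^ 'n. y $ j) \<in> borel_measurable borel"
  by (intro borel_measurable_continuous_onI continuous_intros)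

lemma vec_lambda_measurable [measurable]:
  assumes "\<And>j. (\<lambda>\<omega>. f \<omega> j) \<in> borel_measurable M"
  shows "(\<lambda>\<omega>. (\<chi> j. f \<omega> j) :: real ^ 'n) \<in> borel_measurable M"
  by (subst borel_measurable_euclidean_space) (auto simp: Basis_vec_def inner_axis assms)

lemma gauss_density_measurable [measurable]: "gauss_density m a \<in> borel_measurable borel"
  unfolding gauss_density_def[abs_def] by measurable

lemma gauss_density_nonneg: "gauss_density m a y \<ge> 0"
  unfolding gauss_density_def by (intro prod_nonneg) auto

lemma sets_gauss [measurable_cong, simp]: "sets (gauss m a) = sets borel" and space_gauss [simp]: "space (gauss m a) = UNIV"
  by (simp_all add: gauss_def)

text \<open>The product formula over \<open>Basis\<close>, reindexed by the bijection from
  \<open>j\<close> to \<open>axis j 1\<close>. Finiteness lets each \<open>F j\<close> pass through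
  the reals and back.\<close>

lemma nn_integral_lborel_vec:
  fixes F :: "'n::finite \<Rightarrow> real \<Rightarrow> ennreal"
  assumes [measurable]: "\<And>j. F j \<in> borel_measurable borel"
    and fin: "\<And>j x. F j x \<noteq> \<infinity>"
  shows "(\<integral>\<^sup>+y. (\<Prod>j\<in>UNIV. F j (y $ j)) \<partial>(lborel :: (real ^ 'n) measure)) = (\<Prod>j\<in>UNIV. \<integral>\<^sup>+x. F j x \<partial>lborel)"
proof -
  have B: "(Basis :: (real ^ 'n) set) = range (\<lambda>j. axis j 1)" by (auto simp: Basis_vec_def)
  have inj: "inj (\<lambda>j. axis j (1::real) :: real ^ 'n)" by (auto simp: inj_on_def axis_eq_axis)
  define G where "G b x = enn2real (F (inv (\<lambda>j. axis j 1) b) x)" for b :: "real ^ 'n" and x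
  have G: "G (axis j 1) x = enn2real (F j x)" for j x by (simp add: G_def inv_f_f[OF inj])
  have e: "ennreal (enn2real (F j x)) = F j x" for j x using fin[of j x] by (auto simp: less_top)
  have "(\<integral>\<^sup>+y. (\<Prod>j\<in>UNIV. F j (y $ j)) \<partial>(lborel :: (real ^ 'n) measure)) =
     (\<integral>\<^sup>+y. ennreal (\<Prod>b\<in>Basis. G b (y \<bullet> b)) \<partial>lborel)"
    unfolding B by (simp add: prod.reindex[OF inj] G inner_axis prod_ennreal[symmetric] e)
  also have "\<dots> = (\<integral>\<^sup>+y. (\<Prod>b\<in>Basis. ennreal (G b (y \<bullet> b))) \<partial>lborel)"
    by (simp add: prod_ennreal G_def)
  also have "\<dots> = (\<Prod>b\<in>Basis. \<integral>\<^sup>+x. ennreal (G b x) \<partial>lborel)"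
    using nn_integral_lborel_prod[of "G"] by (simp add: G_def prod_ennreal)
  also have "\<dots> = (\<Prod>j\<in>UNIV. \<integral>\<^sup>+x. F j x \<partial>lborel)"
    unfolding B by (simp add: prod.reindex[OF inj] G e)
  finally show ?thesis .
qed

text \<open>Vectors and coordinate functions determine each other by mutually inverse measurable
  maps, so it is enough to identify the image of \<open>gauss m a\<close> in the product space,
  where boxes decide.\<close>

lemma gauss_eq_distr_PiM:
  fixes m a :: "real ^ 'n"
  assumes a: "\<And>j. a $ j > 0"
  shows "gauss m a = distr (PiM UNIV (\<lambda>j. density lborel (normal_density (m $ j) (a $ j)))) borel (\<lambda>f. \<chi> j. f j)"
proof -
  let ?N = "\<lambda>j. density lborel (normal_density (m $ j) (a $ j))"
  interpret product_sigma_finite ?N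
    by (rule product_sigma_finite.intro) (intro prob_space_imp_sigma_finite prob_space_normal_density a)
  have m1 [measurable]: "(\<lambda>y :: real ^ 'n. \<lambda>j. y $ j) \<in> borel \<rightarrow>\<^sub>M PiM UNIV ?N"
    by (rule measurable_PiM_single')
       (auto simp: measurable_cong_sets[OF refl, of "density lborel (normal_density (m $ _) (a $ _))" borel])
  have m2 [measurable]: "(\<lambda>f. (\<chi> j. f j) :: real ^ 'n) \<in> PiM UNIV ?N \<rightarrow>\<^sub>M borel"
  proof (rule vec_lambda_measurable)
    fix j
    have "(\<lambda>f. f j) \<in> PiM UNIV ?N \<rightarrow>\<^sub>M ?N j" by (rule measurable_component_singleton) simp
    then show "(\<lambda>f. f j) \<in> borel_measurable (PiM UNIV ?N)"
      using measurable_cong_sets[OF refl, of "?N j" borel] by simp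
  qed
  have "distr (gauss m a) (PiM UNIV ?N) (\<lambda>y j. y $ j) = PiM UNIV ?N"
  proof (rule PiM_eqI)
    fix A assume A: "\<And>i. i \<in> UNIV \<Longrightarrow> A i \<in> sets (?N i)"
    then have [measurable]: "A i \<in> sets borel" for i by simp
    have "emeasure (distr (gauss m a) (PiM UNIV ?N) (\<lambda>y j. y $ j)) (Pi\<^sub>E UNIV A) = emeasure (gauss m a) {y. \<forall>j. y $ j \<in> A j}"
      using A by (subst emeasure_distr) (auto intro!: sets_PiM_I_finite arg_cong2[where f=emeasure])
    also have "\<dots> = (\<integral>\<^sup>+y. ennreal (gauss_density m a y) * indicator {y. \<forall>j. y $ j \<in> A j} y \<partial>lborel)"
    proof -
      have "{y :: real ^ 'n. \<forall>j. y $ j \<in> A j} = (\<Inter>j. {y. y $ j \<in> A j})" by auto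
      also have "\<dots> \<in> sets borel" by (intro sets.finite_INT) (auto intro!: borel_measurable_vimage measurable_sets_borel[OF vec_nth_measurable, unfolded vimage_def])
      finally show ?thesis unfolding gauss_def by (subst emeasure_density) auto
    qed
    also have "\<dots> = (\<integral>\<^sup>+y. (\<Prod>j\<in>UNIV. ennreal (normal_density (m $ j) (a $ j) (y $ j)) * indicator (A j) (y $ j)) \<partial>lborel)"
      by (intro nn_integral_cong)
         (auto simp: gauss_density_def prod_ennreal indicator_def prod.distrib prod_zero_iff)
    also have "\<dots> = (\<Prod>j\<in>UNIV. \<integral>\<^sup>+x. ennreal (normal_density (m $ j) (a $ j) x) * indicator (A j) x \<partial>lborel)"
      by (rule nn_integral_lborel_vec) (auto simp: indicator_def)
    also have "\<dots> = (\<Prod>j\<in>UNIV. emeasure (?N j) (A j))"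
      by (simp add: emeasure_density)
    finally show "emeasure (distr (gauss m a) (PiM UNIV ?N) (\<lambda>y j. y $ j)) (Pi\<^sub>E UNIV A) = (\<Prod>i\<in>UNIV. emeasure (?N i) (A i))" .
  qed simp_all
  then have "distr (PiM UNIV ?N) borel (\<lambda>f. \<chi> j. f j) = distr (distr (gauss m a) (PiM UNIV ?N) (\<lambda>y j. y $ j)) borel (\<lambda>f. (\<chi> j. f j) :: real ^ 'n)"
    by simp
  also have "\<dots> = distr (gauss m a) borel ((\<lambda>f. (\<chi> j. f j)) \<circ> (\<lambda>y j. y $ j))"
    by (rule distr_distr) (use m1 m2 in \<open>simp_all add: measurable_cong_sets[OF sets_gauss refl]\<close>)
  also have "\<dots> = gauss m a"
    by (simp add: o_def distr_id2)
  finally show ?thesis by simp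
qed

lemma prob_space_gauss:
  fixes m a :: "real ^ 'n"
  assumes "\<And>j. a $ j > 0"
  shows "prob_space (gauss m a)"
proof (rule prob_spaceI)
  have "(\<integral>\<^sup>+y. (\<Prod>j\<in>UNIV. ennreal (normal_density (m $ j) (a $ j) (y $ j))) \<partial>lborel) =
      (\<Prod>j\<in>UNIV. \<integral>\<^sup>+x. ennreal (normal_density (m $ j) (a $ j) x) \<partial>lborel)"
    by (rule nn_integral_lborel_vec) auto
  moreover have "(\<integral>\<^sup>+x. ennreal (normal_density (m $ j) (a $ j) x) \<partial>lborel) = 1" for j
    using prob_space.emeasure_space_1[OF prob_space_normal_density[OF assms[of j], of "m $ j"]]
    by (simp add: emeasure_density)
  ultimately show "emeasure (gauss m a) (space (gauss m a)) = 1"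
    by (simp add: gauss_def emeasure_density gauss_density_def prod_ennreal)
qed

lemma (in prob_space) distr_indep_normal_vec:
  fixes m a :: "real ^ 'n" and X :: "'n \<Rightarrow> 'a \<Rightarrow> real"
  assumes ind: "indep_vars (\<lambda>_. borel) X UNIV"
    and X: "\<And>j. distributed M lborel (X j) (normal_density (m $ j) (a $ j))"
    and a: "\<And>j. a $ j > 0"
  shows "distr M borel (\<lambda>\<omega>. \<chi> j. X j \<omega>) = gauss m a"
proof -
  have rv [measurable]: "X j \<in> borel_measurable M" for j using distributed_measurable[OF X[of j]] by simp
  have "distr M (PiM UNIV (\<lambda>_. borel)) (\<lambda>x. \<lambda>i\<in>UNIV. X i x) = (\<Pi>\<^sub>M i\<in>UNIV. distr M borel (X i))"
    using ind by (subst indep_vars_iff_distr_eq_PiM[symmetric]) auto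
  also have "\<dots> = PiM UNIV (\<lambda>j. density lborel (normal_density (m $ j) (a $ j)))"
    using distributed_distr_eq_density[OF X] by (simp cong: distr_cong)
  finally have *: "PiM UNIV (\<lambda>j. density lborel (normal_density (m $ j) (a $ j))) = distr M (PiM UNIV (\<lambda>_. borel)) (\<lambda>x i. X i x)"
    by (simp add: restrict_def)
  show ?thesis
    unfolding gauss_eq_distr_PiM[OF a] *
    by (subst distr_distr) (auto simp: o_def intro!: measurable_PiM_single' vec_lambda_measurable)
qed

lemma integral_gauss:
  assumes [measurable]: "\<phi> \<in> borel_measurable borel"
  shows "(\<integral>y. \<phi> y \<partial>gauss m a) = (\<integral>y. gauss_density m a y * \<phi> y \<partial>lborel)"
  unfolding gauss_def by (subst integral_density) (auto simp: gauss_density_nonneg)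

lemma integrable_gauss_density:
  fixes m a :: "real ^ 'n"
  assumes "\<And>j. a $ j > 0"
  shows "integrable lborel (gauss_density m a)" "(\<integral>\<^sup>+y. ennreal (gauss_density m a y) \<partial>lborel) = 1"
proof -
  have "emeasure (gauss m a) (space (gauss m a)) = 1"
    using prob_space_gauss[OF assms] by (rule prob_space.emeasure_space_1)
  then show *: "(\<integral>\<^sup>+y. ennreal (gauss_density m a y) \<partial>lborel) = 1"
    by (simp add: gauss_def emeasure_density)
  show "integrable lborel (gauss_density m a)"
    by (rule integrableI_nonneg) (auto simp: gauss_density_nonneg *)
qed

lemma gauss_density_tendsto:
  fixes m a :: "real ^ 'n"
  assumes "M \<longlonglongrightarrow> m" "A \<longlonglongrightarrow> a" "\<And>j. a $ j > 0"
  shows "(\<lambda>n. gauss_density (M n) (A n) y) \<longlonglongrightarrow> gauss_density m a y"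
  unfolding gauss_density_def normal_density_def
  using assms(3) by (intro tendsto_intros tendsto_vec_nth assms(1,2)) (auto simp: less_imp_neq[THEN not_sym])

text \<open>For Borel \<phi> weak convergence would not suffice. The densities converge pointwise
  and all have mass 1, so Scheffe's lemma gives convergence in L1, hence for every bounded
  integrand.\<close>

lemma integral_gauss_tendsto:
  fixes m a :: "real ^ 'n"
  assumes lim: "M \<longlonglongrightarrow> m" "A \<longlonglongrightarrow> a" and a: "\<And>j. a $ j > 0" and A: "\<And>n j. A n $ j > 0"
    and \<phi>: "\<phi> \<in> bounded_borel"
  shows "(\<lambda>n. \<integral>y. \<phi> y \<partial>gauss (M n) (A n)) \<longlonglongrightarrow> (\<integral>y. \<phi> y \<partial>gauss m a)"
proof -
  have [measurable]: "\<phi> \<in> borel_measurable borel" using \<phi> by (simp add: bounded_borel_def)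
  obtain c where c: "\<And>y. \<bar>\<phi> y\<bar> \<le> c" using \<phi> by (auto simp: bounded_borel_def bounded_iff)
  note I = integrable_gauss_density[of "A _" "M _", OF A] integrable_gauss_density[OF a]
  have 1: "(\<lambda>n. \<integral>\<^sup>+y. norm (gauss_density (M n) (A n) y - gauss_density m a y) \<partial>lborel) \<longlonglongrightarrow> 0"
    by (rule Scheffe_lemma1) (use I gauss_density_tendsto[OF lim a] in \<open>auto simp: gauss_density_nonneg abs_of_nonneg Limsup_const\<close>)
  have id: "integrable lborel (\<lambda>y. \<bar>gauss_density (M n) (A n) y - gauss_density m a y\<bar>)" for n
    using I by auto
  have 2: "(\<lambda>n. \<integral>y. \<bar>gauss_density (M n) (A n) y - gauss_density m a y\<bar> \<partial>lborel) \<longlonglongrightarrow> 0"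
    using tendsto_enn2real[OF 1[unfolded ennreal_0[symmetric]]] by (simp add: integral_eq_nn_integral)
  have ip: "integrable lborel (\<lambda>y. gauss_density m a y * \<phi> y)" if "\<And>j. a $ j > 0" for m a :: "real ^ 'n"
    by (rule Bochner_Integration.integrable_bound[OF integrable_mult_left[OF integrable_gauss_density(1)[OF that, of m], of c]])
       (use c in \<open>auto simp: abs_mult gauss_density_nonneg intro!: mult_left_mono order_trans[OF c abs_ge_self]\<close>)
  show ?thesis
  proof (rule LIM_zero_cancel, rule Lim_null_comparison[OF always_eventually])
    show "(\<lambda>n. c * (\<integral>y. \<bar>gauss_density (M n) (A n) y - gauss_density m a y\<bar> \<partial>lborel)) \<longlonglongrightarrow> 0"
      using tendsto_mult_right_zero[OF 2] .
    show "\<forall>n. norm ((\<integral>y. \<phi> y \<partial>gauss (M n) (A n)) - (\<integral>y. \<phi> y \<partial>gauss m a)) \<le>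
      c * (\<integral>y. \<bar>gauss_density (M n) (A n) y - gauss_density m a y\<bar> \<partial>lborel)"
    proof
      fix n
      have "norm ((\<integral>y. \<phi> y \<partial>gauss (M n) (A n)) - (\<integral>y. \<phi> y \<partial>gauss m a)) =
        norm (\<integral>y. (gauss_density (M n) (A n) y - gauss_density m a y) * \<phi> y \<partial>lborel)"
        using ip[OF A[of n], of "M n"] ip[OF a, of m] by (simp add: integral_gauss left_diff_distrib)
      also have "\<dots> \<le> (\<integral>y. c * \<bar>gauss_density (M n) (A n) y - gauss_density m a y\<bar> \<partial>lborel)"
      proof (rule order_trans[OF integral_norm_bound integral_mono])
        show "integrable lborel (\<lambda>y. norm ((gauss_density (M n) (A n) y - gauss_density m a y) * \<phi> y))"
          using ip[OF A[of n], of "M n"] ip[OF a, of m] by (simp add: left_diff_distrib)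
        show "norm ((gauss_density (M n) (A n) y - gauss_density m a y) * \<phi> y) \<le> c * \<bar>gauss_density (M n) (A n) y - gauss_density m a y\<bar>" for y
          using mult_right_mono[OF c[of y], of "\<bar>gauss_density (M n) (A n) y - gauss_density m a y\<bar>"]
          by (simp add: abs_mult mult.commute)
      qed (use id in simp)
      finally show "norm ((\<integral>y. \<phi> y \<partial>gauss (M n) (A n)) - (\<integral>y. \<phi> y \<partial>gauss m a)) \<le>
        c * (\<integral>y. \<bar>gauss_density (M n) (A n) y - gauss_density m a y\<bar> \<partial>lborel)" by simp
    qed
  qed
qed

section \<open>Differentiating Gaussian integrals in the mean\<close>

definition score :: "real ^ 'n \<Rightarrow> real ^ 'n \<Rightarrow> real ^ 'n \<Rightarrow> real ^ 'n" where
  "score m a y = (\<chi> i. (y $ i - m $ i) / (a $ i)\<^sup>2)"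

text \<open>\<open>score m a y\<close> is the gradient of the logarithm of the density in the mean.
  Differentiating in the mean, not in \<open>y\<close>, leaves the test function untouched.\<close>

lemma gauss_density_has_derivative:
  fixes m a :: "real ^ 'n"
  assumes "\<And>j. a $ j > 0"
  shows "((\<lambda>m. gauss_density m a y) has_derivative (\<lambda>k. (gauss_density m a y *\<^sub>R score m a y) \<bullet> k)) (at m)"
proof -
  define c where "c = (\<Prod>j\<in>UNIV. 1 / sqrt (2 * pi * (a $ j)\<^sup>2))"
  have eq: "gauss_density m a y = c * exp (\<Sum>j\<in>UNIV. - (y $ j - m $ j)\<^sup>2 / (2 * (a $ j)\<^sup>2))" for m
    by (simp add: gauss_density_def normal_density_def exp_sum c_def prod.distrib[symmetric])
  have *: "((\<lambda>m. c * exp (\<Sum>j\<in>UNIV. - (y $ j - m $ j)\<^sup>2 / (2 * (a $ j)\<^sup>2))) has_derivative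
     (\<lambda>k. c * (exp (\<Sum>j\<in>UNIV. - (y $ j - m $ j)\<^sup>2 / (2 * (a $ j)\<^sup>2)) * (\<Sum>j\<in>UNIV. (y $ j - m $ j) / (a $ j)\<^sup>2 * k $ j)))) (at m)"
  proof -
    have "((\<lambda>m. - (y $ j - m $ j)\<^sup>2 / (2 * (a $ j)\<^sup>2)) has_derivative (\<lambda>k. (y $ j - m $ j) / (a $ j)\<^sup>2 * k $ j)) (at m)" for j
    proof -
      have "((\<lambda>t. - (y $ j - t)\<^sup>2 / (2 * (a $ j)\<^sup>2)) has_field_derivative (y $ j - m $ j) / (a $ j)\<^sup>2) (at (m $ j))"
        using assms[of j] by (auto intro!: derivative_eq_intros simp: field_simps)
      from has_derivative_compose[OF bounded_linear.has_derivative[OF bounded_linear_vec_nth has_derivative_ident] this[unfolded has_field_derivative_def]]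
      show ?thesis by simp
    qed
    then show ?thesis
      by (intro has_derivative_eq_rhs[OF has_derivative_mult_right[OF has_derivative_exp[OF has_derivative_sum]]])
         (auto simp: mult_ac)
  qed
  show ?thesis
    unfolding eq by (rule has_derivative_eq_rhs[OF *]) (simp add: score_def inner_vec_def sum_distrib_left sum_distrib_right mult_ac)
qed

text \<open>A majorant that does not depend on the mean, as long as it stays within distance 1 of
  \<mu>0. Half of the Gaussian exponent absorbs the linear factor. The other half, with z = x -
  \<mu>, w = x - \<mu>0 and variance s, beats the density of doubled deviation because z^2 / (4 s) +
  1 / (4 s) >= w^2 / (8 s). The leading 2 is the ratio of the normalising constants.\<close>

lemma normal_density_score_bound:
  fixes \<mu> \<mu>0 \<sigma> x :: real
  assumes "\<sigma> > 0" "\<bar>\<mu> - \<mu>0\<bar> \<le> 1"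
  shows "normal_density \<mu> \<sigma> x * (1 + \<bar>x - \<mu>\<bar> / \<sigma>\<^sup>2) \<le>
    2 * (5 + 1 / \<sigma>\<^sup>2) * exp (1 / (4 * \<sigma>\<^sup>2)) * normal_density \<mu>0 (2 * \<sigma>) x"
proof -
  let ?z = "x - \<mu>" and ?w = "x - \<mu>0" and ?s = "\<sigma>\<^sup>2"
  have s: "?s > 0" using assms by simp
  have sq: "sqrt (2 * pi * (2 * \<sigma>)\<^sup>2) = 2 * sqrt (2 * pi * ?s)"
  proof -
    have "2 * pi * (2 * \<sigma>)\<^sup>2 = 4 * (2 * pi * ?s)" by (simp add: power_mult_distrib)
    then show ?thesis by (simp only: real_sqrt_mult real_sqrt_four)
  qed
  have abs: "\<bar>z\<bar> \<le> 1 + z\<^sup>2" for z :: real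
  proof -
    have "0 \<le> (\<bar>z\<bar> - 1)\<^sup>2" "0 \<le> \<bar>z\<bar>" by auto
    then show ?thesis by (simp add: power2_diff)
  qed
  have lin: "1 + \<bar>?z\<bar> / ?s \<le> (5 + 1 / ?s) * exp (?z\<^sup>2 / (4 * ?s))"
  proof -
    have "1 + \<bar>?z\<bar> / ?s \<le> 1 + (1 + ?z\<^sup>2) / ?s" using abs s by (intro add_mono divide_right_mono) auto
    also have "\<dots> = (1 + 1 / ?s) + 4 * (?z\<^sup>2 / (4 * ?s))" using s by (simp add: field_simps)
    also have "\<dots> \<le> (1 + 1 / ?s) * exp (?z\<^sup>2 / (4 * ?s)) + 4 * exp (?z\<^sup>2 / (4 * ?s))"
    proof (rule add_mono)
      have "(1 + 1 / ?s) * 1 \<le> (1 + 1 / ?s) * exp (?z\<^sup>2 / (4 * ?s))"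
        using s by (intro mult_left_mono) auto
      then show "1 + 1 / ?s \<le> (1 + 1 / ?s) * exp (?z\<^sup>2 / (4 * ?s))" by simp
      have "?z\<^sup>2 / (4 * ?s) \<le> exp (?z\<^sup>2 / (4 * ?s))" using exp_ge_add_one_self[of "?z\<^sup>2 / (4 * ?s)"] by linarith
      then show "4 * (?z\<^sup>2 / (4 * ?s)) \<le> 4 * exp (?z\<^sup>2 / (4 * ?s))" by linarith
    qed
    finally show ?thesis by (simp add: algebra_simps)
  qed
  have gau: "exp (- ?z\<^sup>2 / (4 * ?s)) \<le> exp (1 / (4 * ?s)) * exp (- ?w\<^sup>2 / (2 * (2 * \<sigma>)\<^sup>2))"
  proof -
    have "?w\<^sup>2 \<le> 2 * ?z\<^sup>2 + 2"
    proof -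
      have "(?w - ?z)\<^sup>2 \<le> 1" using assms(2) by (simp add: abs_square_le_1 abs_minus_commute)
      \<comment> \<open>By the identity w^2 = 2 z^2 + 2 (w - z)^2 - (w - 2 z)^2.\<close>
      moreover have "0 \<le> (?w - 2 * ?z)\<^sup>2" by simp
      ultimately show ?thesis unfolding power2_eq_square by (simp add: algebra_simps)
    qed
    then have "- ?z\<^sup>2 / (4 * ?s) \<le> 1 / (4 * ?s) + - ?w\<^sup>2 / (2 * (2 * \<sigma>)\<^sup>2)"
      using s by (simp add: field_simps power_mult_distrib)
    then show ?thesis by (simp add: exp_add[symmetric])
  qed
  have "exp (- ?z\<^sup>2 / (2 * ?s)) * (1 + \<bar>?z\<bar> / ?s) \<le> exp (- ?z\<^sup>2 / (2 * ?s)) * ((5 + 1 / ?s) * exp (?z\<^sup>2 / (4 * ?s)))"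
    by (intro mult_left_mono lin) auto
  also have "\<dots> = (5 + 1 / ?s) * exp (- ?z\<^sup>2 / (4 * ?s))"
    using s by (simp add: exp_add[symmetric] field_simps)
  also have "\<dots> \<le> (5 + 1 / ?s) * (exp (1 / (4 * ?s)) * exp (- ?w\<^sup>2 / (2 * (2 * \<sigma>)\<^sup>2)))"
    using s by (intro mult_left_mono gau) auto
  finally have "(1 / sqrt (2 * pi * ?s)) * (exp (- ?z\<^sup>2 / (2 * ?s)) * (1 + \<bar>?z\<bar> / ?s)) \<le>
     (1 / sqrt (2 * pi * ?s)) * ((5 + 1 / ?s) * (exp (1 / (4 * ?s)) * exp (- ?w\<^sup>2 / (2 * (2 * \<sigma>)\<^sup>2))))"
    by (rule mult_left_mono) auto
  moreover have "2 * k * e * (1 / (2 * r) * g) = 1 / r * (k * (e * g))" for k e r g :: real by simp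
  ultimately show ?thesis unfolding normal_density_def sq by (simp only: mult.assoc)
qed

text \<open>Only coordinate \<open>i\<close> carries a linear factor. Bounding it by the product of
  the factors 1 + |y_j - m_j| / a_j^2, all at least 1, lets the one-dimensional estimate be applied
  to every coordinate alike.\<close>

lemma gauss_score_bound:
  fixes m m0 a :: "real ^ 'n"
  assumes a: "\<And>j. a $ j > 0" and m: "norm (m - m0) \<le> 1"
  shows "gauss_density m a y * \<bar>score m a y $ i\<bar> \<le>
    (\<Prod>j\<in>UNIV. 2 * (5 + 1 / (a $ j)\<^sup>2) * exp (1 / (4 * (a $ j)\<^sup>2))) * gauss_density m0 (2 *\<^sub>R a) y"
proof -
  let ?F = "\<lambda>j. normal_density (m $ j) (a $ j) (y $ j) * (1 + \<bar>y $ j - m $ j\<bar> / (a $ j)\<^sup>2)"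
  have "\<bar>score m a y $ i\<bar> \<le> 1 + \<bar>y $ i - m $ i\<bar> / (a $ i)\<^sup>2" by (simp add: score_def abs_divide)
  also have "\<dots> \<le> (\<Prod>j\<in>UNIV. 1 + \<bar>y $ j - m $ j\<bar> / (a $ j)\<^sup>2)"
  proof -
    have "(\<Prod>j\<in>UNIV - {i}. 1 + \<bar>y $ j - m $ j\<bar> / (a $ j)\<^sup>2) \<ge> 1" by (rule prod_ge_1) auto
    then have "(1 + \<bar>y $ i - m $ i\<bar> / (a $ i)\<^sup>2) * 1 \<le>
        (1 + \<bar>y $ i - m $ i\<bar> / (a $ i)\<^sup>2) * (\<Prod>j\<in>UNIV - {i}. 1 + \<bar>y $ j - m $ j\<bar> / (a $ j)\<^sup>2)"
      by (rule mult_left_mono) simp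
    then show ?thesis
      by (subst prod.remove[of UNIV i]) auto
  qed
  finally have "gauss_density m a y * \<bar>score m a y $ i\<bar> \<le> (\<Prod>j\<in>UNIV. ?F j)"
    by (simp add: gauss_density_def prod.distrib mult_left_mono prod_nonneg)
  also have "\<dots> \<le> (\<Prod>j\<in>UNIV. 2 * (5 + 1 / (a $ j)\<^sup>2) * exp (1 / (4 * (a $ j)\<^sup>2)) * normal_density (m0 $ j) (2 * a $ j) (y $ j))"
  proof (rule prod_mono, intro conjI)
    fix j
    have "\<bar>m $ j - m0 $ j\<bar> \<le> 1"
      using order_trans[OF component_le_norm_cart[of "m - m0" j] m] by simp
    then show "?F j \<le> 2 * (5 + 1 / (a $ j)\<^sup>2) * exp (1 / (4 * (a $ j)\<^sup>2)) * normal_density (m0 $ j) (2 * a $ j) (y $ j)"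
      by (intro normal_density_score_bound a)
  qed auto
  finally show ?thesis by (simp add: gauss_density_def prod.distrib)
qed

text \<open>The integral factorises, with value 1 in every coordinate but \<open>i\<close>. There it
  is the first absolute moment of a normal variable divided by the variance, which is exactly
  \<open>sqrt (2 / pi) / a $ i\<close>.\<close>

lemma integral_gauss_score:
  fixes m a :: "real ^ 'n"
  assumes a: "\<And>j. a $ j > 0"
  shows "(\<integral>\<^sup>+y. ennreal (gauss_density m a y * \<bar>score m a y $ i\<bar>) \<partial>lborel) \<le> ennreal (1 / a $ i)"
proof -
  let ?F = "\<lambda>j x. ennreal (normal_density (m $ j) (a $ j) x * (if j = i then \<bar>x - m $ i\<bar> / (a $ i)\<^sup>2 else 1))"
  have "gauss_density m a y * \<bar>score m a y $ i\<bar> =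
     (\<Prod>j\<in>UNIV. normal_density (m $ j) (a $ j) (y $ j) * (if j = i then \<bar>y $ j - m $ i\<bar> / (a $ i)\<^sup>2 else 1))" for y
    by (simp add: gauss_density_def prod.distrib prod.delta score_def abs_divide)
  then have "(\<integral>\<^sup>+y. ennreal (gauss_density m a y * \<bar>score m a y $ i\<bar>) \<partial>lborel) = (\<integral>\<^sup>+y. (\<Prod>j\<in>UNIV. ?F j (y $ j)) \<partial>lborel)"
    by (simp add: prod_ennreal)
  also have "\<dots> = (\<Prod>j\<in>UNIV. \<integral>\<^sup>+x. ?F j x \<partial>lborel)"
    by (rule nn_integral_lborel_vec) auto
  also have "\<dots> = (\<integral>\<^sup>+x. ?F i x \<partial>lborel) * (\<Prod>j\<in>UNIV - {i}. \<integral>\<^sup>+x. ?F j x \<partial>lborel)"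
    by (rule prod.remove) auto
  also have "(\<Prod>j\<in>UNIV - {i}. \<integral>\<^sup>+x. ?F j x \<partial>lborel) = 1"
  proof (rule prod.neutral, rule ballI)
    fix j assume "j \<in> UNIV - {i}"
    then show "(\<integral>\<^sup>+x. ?F j x \<partial>lborel) = 1"
      using prob_space.emeasure_space_1[OF prob_space_normal_density[OF a[of j], of "m $ j"]]
      by (simp add: emeasure_density)
  qed
  also have "(\<integral>\<^sup>+x. ?F i x \<partial>lborel) * 1 \<le> ennreal (1 / a $ i)"
  proof -
    have "has_bochner_integral lborel (\<lambda>x. normal_density (m $ i) (a $ i) x * \<bar>x - m $ i\<bar> ^ (2 * 0 + 1) / (a $ i)\<^sup>2)
       (2 ^ 0 * (a $ i) ^ (2 * 0 + 1) * fact 0 * sqrt (2 / pi) / (a $ i)\<^sup>2)"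
      by (intro has_bochner_integral_divide_zero normal_moment_abs_odd a)
    then have "(\<integral>\<^sup>+x. ennreal (normal_density (m $ i) (a $ i) x * \<bar>x - m $ i\<bar> / (a $ i)\<^sup>2) \<partial>lborel) = ennreal (sqrt (2 / pi) / a $ i)"
      using a[of i] by (subst nn_integral_eq_integral)
        (auto simp: has_bochner_integral_iff power2_eq_square)
    also have "\<dots> \<le> ennreal (1 / a $ i)"
      using a[of i] pi_gt3 by (intro ennreal_leI divide_right_mono) (auto simp: real_sqrt_le_1_iff)
    finally show ?thesis by simp
  qed
  finally show ?thesis .
qed

text \<open>The test function may be discontinuous, so the derivative falls on the density. The
  majorant from the unit ball around the mean serves differentiation only; the final bound on the
  gradient comes from the exact first moment of the score.\<close>

lemma integral_gauss_gradient:
  fixes m a :: "real ^ 'n"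
  assumes a: "\<And>j. a $ j > 0" and \<phi>: "\<phi> \<in> bounded_borel"
  defines "g \<equiv> \<lambda>m. \<integral>y. (\<phi> y * gauss_density m a y) *\<^sub>R score m a y \<partial>lborel"
  shows "((\<lambda>m. \<integral>y. \<phi> y \<partial>gauss m a) has_derivative (\<lambda>k. g m \<bullet> k)) (at m)"
    and "isCont g m"
    and "(\<And>y. \<bar>\<phi> y\<bar> \<le> c) \<Longrightarrow> norm (g m) \<le> c * (\<Sum>i\<in>UNIV. 1 / a $ i)"
proof -
  have [measurable]: "\<phi> \<in> borel_measurable borel" using \<phi> by (simp add: bounded_borel_def)
  have ip: "integrable lborel (\<lambda>y. gauss_density m a y * \<phi> y)" if "\<And>y. \<bar>\<phi> y\<bar> \<le> c" for m c
    by (rule Bochner_Integration.integrable_bound[OF integrable_mult_left[OF integrable_gauss_density(1)[OF a, of m], of c]])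
       (use that in \<open>auto simp: abs_mult gauss_density_nonneg intro!: mult_left_mono order_trans[OF that abs_ge_self]\<close>)
  obtain d where d: "\<And>y. \<bar>\<phi> y\<bar> \<le> d" using \<phi> by (auto simp: bounded_borel_def bounded_iff)
  have d0: "d \<ge> 0" using d abs_ge_zero order_trans by blast
  define K where "K = (\<Prod>j\<in>UNIV. 2 * (5 + 1 / (a $ j)\<^sup>2) * exp (1 / (4 * (a $ j)\<^sup>2)))"
  have l1: "norm ((\<phi> y * gauss_density m a y) *\<^sub>R score m a y) \<le> c * (\<Sum>i\<in>UNIV. gauss_density m a y * \<bar>score m a y $ i\<bar>)"
    if "\<And>y. \<bar>\<phi> y\<bar> \<le> c" for m y c
  proof -
    have "norm ((\<phi> y * gauss_density m a y) *\<^sub>R score m a y) = \<bar>\<phi> y\<bar> * (gauss_density m a y * norm (score m a y))"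
      by (simp add: abs_mult gauss_density_nonneg)
    also have "\<dots> \<le> c * (gauss_density m a y * (\<Sum>i\<in>UNIV. \<bar>score m a y $ i\<bar>))"
      using order_trans[OF abs_ge_zero that]
      by (intro mult_mono that mult_left_mono norm_le_l1_cart mult_nonneg_nonneg) (auto simp: gauss_density_nonneg)
    finally show ?thesis by (simp add: sum_distrib_left)
  qed
  have bnd: "norm ((\<phi> y * gauss_density m a y) *\<^sub>R score m a y) \<le> d * (CARD('n) * (K * gauss_density m0 (2 *\<^sub>R a) y))"
    if "m \<in> ball m0 1" for m m0 y
  proof -
    have "(\<Sum>i\<in>UNIV. gauss_density m a y * \<bar>score m a y $ i\<bar>) \<le> (\<Sum>i\<in>(UNIV :: 'n set). K * gauss_density m0 (2 *\<^sub>R a) y)"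
      unfolding K_def by (intro sum_mono gauss_score_bound a) (use that in \<open>simp add: dist_norm norm_minus_commute\<close>)
    then show ?thesis using l1[OF d, of y m] d0 by (intro order_trans[OF l1[OF d]] mult_left_mono) auto
  qed
  have bi: "integrable lborel (\<lambda>y. d * (CARD('n) * (K * gauss_density m0 (2 *\<^sub>R a) y)))" for m0
    by (intro integrable_mult_right integrable_gauss_density) (use a in auto)
  have der: "((\<lambda>m. gauss_density m a y * \<phi> y) has_derivative (\<lambda>k. ((\<phi> y * gauss_density m a y) *\<^sub>R score m a y) \<bullet> k)) (at m)" for m y
    by (rule has_derivative_eq_rhs[OF has_derivative_mult_left[OF gauss_density_has_derivative[OF a]]]) (auto simp: mult_ac)
  have cont: "isCont (\<lambda>m. (\<phi> y * gauss_density m a y) *\<^sub>R score m a y) m" for m y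
  proof -
    have 1: "isCont (\<lambda>m. gauss_density m a y) m"
      using has_derivative_continuous[OF gauss_density_has_derivative[OF a]] .
    have 2: "isCont (\<lambda>m. score m a y) m"
      unfolding score_def continuous_at_sequentially o_def
      by (auto intro!: tendsto_intros tendsto_vec_lambda simp: a[THEN less_imp_neq, THEN not_sym])
    show ?thesis by (intro continuous_intros 1 2)
  qed
  have U: "m \<in> ball m 1" for m :: "real ^ 'n" by simp
  note dui = open_ball convex_ball U ip[OF d] der bnd bi
  show "((\<lambda>m. \<integral>y. \<phi> y \<partial>gauss m a) has_derivative (\<lambda>k. g m \<bullet> k)) (at m)"
    unfolding integral_gauss[OF \<open>\<phi> \<in> borel_measurable borel\<close>] g_def
    by (rule has_derivative_integral[where N=lborel, OF dui])
  show "isCont g m"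
    unfolding g_def
    by (rule isCont_integral_gradient[where N=lborel, OF dui cont])
  show "norm (g m) \<le> c * (\<Sum>i\<in>UNIV. 1 / a $ i)" if c: "\<And>y. \<bar>\<phi> y\<bar> \<le> c"
  proof -
    have c0: "c \<ge> 0" using c abs_ge_zero order_trans by blast
    have [measurable]: "(\<lambda>y. score m a y $ i) \<in> borel_measurable borel" for i unfolding score_def by simp
    have si: "integrable lborel (\<lambda>y. gauss_density m a y * \<bar>score m a y $ i\<bar>)" for i
      by (rule integrableI_nonneg)
        (use integral_gauss_score[OF a, of m i] in \<open>auto simp: gauss_density_nonneg intro: le_less_trans\<close>)
    have sb: "(\<integral>y. gauss_density m a y * \<bar>score m a y $ i\<bar> \<partial>lborel) \<le> 1 / a $ i" for i
      using integral_gauss_score[OF a, of m i] a[of i]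
      by (subst (asm) nn_integral_eq_integral[OF si]) (auto simp: gauss_density_nonneg ennreal_le_iff)
    have "norm (g m) \<le> (\<integral>y. norm ((\<phi> y * gauss_density m a y) *\<^sub>R score m a y) \<partial>lborel)"
      unfolding g_def by (rule integral_norm_bound)
    also have "\<dots> \<le> (\<integral>y. c * (\<Sum>i\<in>UNIV. gauss_density m a y * \<bar>score m a y $ i\<bar>) \<partial>lborel)"
      by (rule integral_mono[OF integrable_norm[OF integrable_gradient[where N=lborel, OF dui]] _ l1[OF c]])
        (auto intro!: si)
    also have "\<dots> = c * (\<Sum>i\<in>UNIV. \<integral>y. gauss_density m a y * \<bar>score m a y $ i\<bar> \<partial>lborel)"
      using si by simp
    also have "\<dots> \<le> c * (\<Sum>i\<in>UNIV. 1 / a $ i)"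
      using c0 by (intro mult_left_mono sum_mono sb)
    finally show ?thesis .
  qed
qed

subsection \<open>The stable subordinator\<close>

locale stable_driver = prob_space M
  for M :: "'w measure" +
  fixes \<alpha> \<gamma>b :: real and L :: "real \<Rightarrow> 'w \<Rightarrow> real"
  assumes alpha: "1 / 2 < \<alpha>" "\<alpha> < 1" and gb: "\<gamma>b > 0"
    and stable: "stable_subordinator M \<alpha> \<gamma>b L"
begin

lemma L_measurable: "t \<ge> 0 \<Longrightarrow> L t \<in> borel_measurable M"
  using stable by (simp add: stable_subordinator_def subordinator_def levy_process_def)

lemma L_0: "AE \<omega> in M. L 0 \<omega> = 0"
  using stable by (simp add: stable_subordinator_def subordinator_def levy_process_def)

lemma L_mono: "AE \<omega> in M. mono_on {0..} (\<lambda>t. L t \<omega>)"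
  using stable by (simp add: stable_subordinator_def subordinator_def)

lemma L_nonneg: "AE \<omega> in M. \<forall>t\<ge>0. 0 \<le> L t \<omega>"
  using L_0 L_mono
proof eventually_elim
  case (elim \<omega>)
  show ?case
  proof (intro allI impI)
    fix t :: real assume "t \<ge> 0"
    then have "L 0 \<omega> \<le> L t \<omega>" using elim(2) by (auto simp: mono_on_def)
    then show "0 \<le> L t \<omega>" using elim(1) by simp
  qed
qed

lemma distr_increment:
  assumes "0 \<le> s" "s < t"
  shows "distr M borel (\<lambda>\<omega>. L t \<omega> - L s \<omega>) = distr M borel (\<lambda>\<omega>. (t - s) powr (1 / \<alpha>) * L 1 \<omega>)"
proof -
  have "distr M borel (\<lambda>\<omega>. L t \<omega> - L s \<omega>) = distr M borel (L (t - s))"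
    using stable assms by (simp add: stable_subordinator_def subordinator_def levy_process_def)
  also have "\<dots> = distr M borel (L ((t - s) * 1))" by simp
  also have "\<dots> = distr M borel (\<lambda>\<omega>. (t - s) powr (1 / \<alpha>) * L 1 \<omega>)"
    using stable assms by (simp add: stable_subordinator_def strictly_stable_def del: mult_1_right)
  finally show ?thesis .
qed

lemma integral_increment:
  fixes h :: "real \<Rightarrow> real"
  assumes "0 \<le> s" "s < t" and [measurable]: "h \<in> borel_measurable borel"
  shows "(\<integral>\<omega>. h (L t \<omega> - L s \<omega>) \<partial>M) = (\<integral>\<omega>. h ((t - s) powr (1 / \<alpha>) * L 1 \<omega>) \<partial>M)"
    and "integrable M (\<lambda>\<omega>. h (L t \<omega> - L s \<omega>)) \<longleftrightarrow> integrable M (\<lambda>\<omega>. h ((t - s) powr (1 / \<alpha>) * L 1 \<omega>))"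
proof -
  note [measurable] = L_measurable[of s] L_measurable[of t] L_measurable[of 1]
  show "(\<integral>\<omega>. h (L t \<omega> - L s \<omega>) \<partial>M) = (\<integral>\<omega>. h ((t - s) powr (1 / \<alpha>) * L 1 \<omega>) \<partial>M)"
    using integral_distr[of "\<lambda>\<omega>. L t \<omega> - L s \<omega>" M borel h] assms
      integral_distr[of "\<lambda>\<omega>. (t - s) powr (1 / \<alpha>) * L 1 \<omega>" M borel h]
    by (simp add: distr_increment)
  show "integrable M (\<lambda>\<omega>. h (L t \<omega> - L s \<omega>)) \<longleftrightarrow> integrable M (\<lambda>\<omega>. h ((t - s) powr (1 / \<alpha>) * L 1 \<omega>))"
    using integrable_distr_eq[of "\<lambda>\<omega>. L t \<omega> - L s \<omega>" M borel h] assms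
      integrable_distr_eq[of "\<lambda>\<omega>. (t - s) powr (1 / \<alpha>) * L 1 \<omega>" M borel h]
    by (simp add: distr_increment)
qed

definition laplace_1 :: real where
  "laplace_1 = (\<integral>\<omega>. exp (- L 1 \<omega>) \<partial>M)"

lemma integrable_exp_L:
  assumes "c \<ge> 0" "t \<ge> 0"
  shows "integrable M (\<lambda>\<omega>. exp (- (c * L t \<omega>)))"
proof (rule integrable_const_bound[of _ 1])
  show "AE \<omega> in M. norm (exp (- (c * L t \<omega>))) \<le> 1"
    using L_nonneg by eventually_elim (use assms in auto)
qed (use L_measurable[OF assms(2)] in measurable)

text \<open>Self-similarity turns the multiplicativity of the Laplace transform in time into
  multiplicativity along the scales \<open>n powr (1 / \<alpha>)\<close>.\<close>

lemma laplace_scaled: "(\<integral>\<omega>. exp (- (real n powr (1 / \<alpha>) * L 1 \<omega>)) \<partial>M) = laplace_1 ^ n"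
proof (cases "n = 0")
  case True
  then show ?thesis by (simp add: prob_space)
next
  case False
  let ?I = "\<lambda>i \<omega>. L (real (Suc i)) \<omega> - L (real i) \<omega>"
  have ind: "indep_vars (\<lambda>_. borel) ?I {..<n}"
    using stable
    by (auto simp: stable_subordinator_def subordinator_def levy_process_def independent_increments_def mono_def
         dest!: spec[of _ n] spec[of _ "real"])
  have ind': "indep_vars (\<lambda>_. borel) (\<lambda>i \<omega>. exp (- ?I i \<omega>)) {..<n}"
    by (rule indep_vars_compose2[OF ind]) measurable
  have one: "integrable M (\<lambda>\<omega>. exp (- ?I i \<omega>))" "(\<integral>\<omega>. exp (- ?I i \<omega>) \<partial>M) = laplace_1" for i
    using integral_increment[of "real i" "real (Suc i)" "\<lambda>x. exp (- x)"] integrable_exp_L[of 1 1]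
    by (auto simp: laplace_1_def)
  have "(\<integral>\<omega>. exp (- (real n powr (1 / \<alpha>) * L 1 \<omega>)) \<partial>M) = (\<integral>\<omega>. exp (- (L (real n) \<omega> - L 0 \<omega>)) \<partial>M)"
    using integral_increment(1)[of 0 "real n" "\<lambda>x. exp (- x)"] False by simp
  also have "\<dots> = (\<integral>\<omega>. (\<Prod>i<n. exp (- ?I i \<omega>)) \<partial>M)"
  proof -
    have "exp (- (L (real n) \<omega> - L 0 \<omega>)) = (\<Prod>i<n. exp (- ?I i \<omega>))" for \<omega>
    proof (induction n)
      case (Suc n)
      have "exp (- (L (real (Suc n)) \<omega> - L 0 \<omega>)) = exp (- (L (real n) \<omega> - L 0 \<omega>)) * exp (- ?I n \<omega>)"
        by (simp add: exp_add[symmetric])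
      then show ?case by (simp only: Suc prod.lessThan_Suc)
    qed simp
    then show ?thesis by simp
  qed
  also have "\<dots> = (\<Prod>i<n. \<integral>\<omega>. exp (- ?I i \<omega>) \<partial>M)"
    by (rule indep_vars_lebesgue_integral[OF _ ind' one(1)]) simp
  also have "\<dots> = laplace_1 ^ n" by (simp only: one(2) prod_constant card_lessThan)
  finally show ?thesis .
qed

text \<open>The value 1 would force L 1 = 0 almost surely, hence characteristic function 1, whereas
  the prescribed one has modulus exp (-\<gamma>b powr \<alpha>) < 1 at the argument 1.\<close>

lemma laplace_1_bounds: "0 \<le> laplace_1" "laplace_1 < 1"
proof -
  note [measurable] = L_measurable[of 1]
  show "0 \<le> laplace_1" by (simp add: laplace_1_def)
  show "laplace_1 < 1"
  proof (rule ccontr)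
    assume "\<not> laplace_1 < 1"
    have i: "integrable M (\<lambda>\<omega>. exp (- L 1 \<omega>))" using integrable_exp_L[of 1 1] by simp
    have nn: "AE \<omega> in M. 0 \<le> 1 - exp (- L 1 \<omega>)" using L_nonneg by eventually_elim simp
    have "(\<integral>\<omega>. 1 - exp (- L 1 \<omega>) \<partial>M) = 1 - laplace_1"
      using i by (simp add: laplace_1_def prob_space)
    moreover have "(\<integral>\<omega>. 1 - exp (- L 1 \<omega>) \<partial>M) \<ge> 0" using nn by (rule integral_nonneg_AE)
    ultimately have "(\<integral>\<omega>. 1 - exp (- L 1 \<omega>) \<partial>M) = 0" using \<open>\<not> laplace_1 < 1\<close> by simp
    then have "AE \<omega> in M. 1 - exp (- L 1 \<omega>) = 0"
      using integral_nonneg_eq_0_iff_AE[OF _ nn] i by simp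
    then have L1: "AE \<omega> in M. L 1 \<omega> = 0" by eventually_elim simp
    have "char (distr M borel (L 1)) 1 = (CLINT \<omega>|M. iexp (L 1 \<omega>))"
      unfolding char_def by (subst integral_distr) auto
    also have "\<dots> = (CLINT \<omega>|M. 1)"
      by (rule integral_cong_AE) (use L1 in auto)
    also have "\<dots> = 1" by (simp add: prob_space)
    finally have "norm (char (distr M borel (L 1)) 1) = 1" by simp
    moreover have "norm (char (distr M borel (L 1)) 1) = exp (- (\<gamma>b powr \<alpha>))"
      using stable by (simp add: stable_subordinator_def)
    moreover have "\<gamma>b powr \<alpha> > 0" using gb by simp
    ultimately show False by simp
  qed
qed

text \<open>Where L 1 is at most 0 the exponential of -\<open>n powr (1 / \<alpha>) * L 1\<close> is
  at least 1 for every \<open>n\<close>, yet its expectation is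
  \<open>laplace_1 ^ n\<close>.\<close>

lemma L1_pos: "AE \<omega> in M. 0 < L 1 \<omega>"
proof -
  note [measurable] = L_measurable[of 1]
  have le: "prob {\<omega>\<in>space M. L 1 \<omega> \<le> 0} \<le> laplace_1 ^ n" for n
  proof -
    have "prob {\<omega>\<in>space M. L 1 \<omega> \<le> 0} = (\<integral>\<omega>. indicator {\<omega>\<in>space M. L 1 \<omega> \<le> 0} \<omega> \<partial>M)" by simp
    also have "\<dots> \<le> (\<integral>\<omega>. exp (- (real n powr (1 / \<alpha>) * L 1 \<omega>)) \<partial>M)"
    proof (rule integral_mono_AE)
      show "integrable M (indicator {\<omega>\<in>space M. L 1 \<omega> \<le> 0} :: 'w \<Rightarrow> real)"
        by (intro integrable_real_indicator) (auto simp: less_top[symmetric])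
      show "integrable M (\<lambda>\<omega>. exp (- (real n powr (1 / \<alpha>) * L 1 \<omega>)))" by (intro integrable_exp_L) auto
      show "AE \<omega> in M. indicator {\<omega>\<in>space M. L 1 \<omega> \<le> 0} \<omega> \<le> exp (- (real n powr (1 / \<alpha>) * L 1 \<omega>))"
        by (rule AE_I2) (auto simp: indicator_def mult_nonneg_nonpos)
    qed
    finally show ?thesis by (simp add: laplace_scaled)
  qed
  have "(\<lambda>n. laplace_1 ^ n) \<longlonglongrightarrow> 0" using laplace_1_bounds by (intro LIMSEQ_power_zero) auto
  then have "prob {\<omega>\<in>space M. L 1 \<omega> \<le> 0} \<le> 0" by (rule LIMSEQ_le_const) (use le in auto)
  then have "prob {\<omega>\<in>space M. L 1 \<omega> \<le> 0} = 0" by (simp add: measure_le_0_iff)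
  then have "AE \<omega> in M. \<not> L 1 \<omega> \<le> 0" by (subst (asm) prob_eq_0) auto
  then show ?thesis by eventually_elim simp
qed

text \<open>Take \<open>n\<close> to be the integer part of y = \<open>x powr (-\<alpha>)\<close>.
  Then \<open>n powr (1 / \<alpha>) * x\<close> is at most 1, so the exponential is at least 1/e,
  while 1 / sqrt x = y powr (1 / (2 \<alpha>)) is at most \<open>Suc n\<close> because the exponent
  is at most 1.\<close>

lemma inverse_sqrt_le_exponential_sum:
  fixes x :: real
  assumes "x > 0"
  shows "\<exists>n. 1 / sqrt x \<le> exp 1 * real (Suc n) * exp (- (real n powr (1 / \<alpha>) * x))"
proof -
  define y where "y = x powr (-\<alpha>)"
  define n where "n = nat \<lfloor>y\<rfloor>"
  have y0: "y > 0" using assms by (simp add: y_def)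
  have "real n = real_of_int \<lfloor>y\<rfloor>" using y0 by (simp add: n_def)
  then have n: "real n \<le> y" "y < real (Suc n)" by linarith+
  have "y powr (1 / (2 * \<alpha>)) = x powr (- (1 / 2))"
    unfolding y_def powr_powr using alpha by simp
  then have "1 / sqrt x = y powr (1 / (2 * \<alpha>))"
    using assms by (simp add: powr_minus_divide powr_half_sqrt)
  also have "\<dots> \<le> real (Suc n)"
  proof (cases "y \<ge> 1")
    case True
    have "y powr (1 / (2 * \<alpha>)) \<le> y powr 1" using True alpha by (intro powr_mono) auto
    then show ?thesis using n y0 by simp
  next
    case False
    have "y powr (1 / (2 * \<alpha>)) \<le> 1" using False y0 alpha by (intro powr_le1) auto
    then show ?thesis by simp
  qed
  also have "\<dots> \<le> exp 1 * real (Suc n) * exp (- (real n powr (1 / \<alpha>) * x))"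
  proof -
    have "real n powr (1 / \<alpha>) * x \<le> y powr (1 / \<alpha>) * x"
      using n alpha assms by (intro mult_right_mono powr_mono2) auto
    also have "y powr (1 / \<alpha>) = x powr (-1)" unfolding y_def powr_powr using alpha by simp
    also have "x powr (-1) * x = 1" using assms by (simp add: powr_minus_divide)
    finally have "1 \<le> exp (1 - real n powr (1 / \<alpha>) * x)" by simp
    then have "real (Suc n) * 1 \<le> real (Suc n) * exp (1 - real n powr (1 / \<alpha>) * x)"
      by (intro mult_left_mono) auto
    then show ?thesis by (simp add: exp_diff exp_minus divide_inverse mult_ac)
  qed
  finally show ?thesis by blast
qed

text \<open>The preceding term depends on \<omega> through \<open>n\<close>; summing over all
  \<open>n\<close> removes the dependence, and the expectation becomes e times the sum of (n + 1)
  \<open>laplace_1 ^ n\<close>, which is finite.\<close>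

lemma integrable_inverse_sqrt_L1: "integrable M (\<lambda>\<omega>. 1 / sqrt (L 1 \<omega>))"
proof (rule integrableI_nonneg)
  note [measurable] = L_measurable[of 1]
  show "(\<lambda>\<omega>. 1 / sqrt (L 1 \<omega>)) \<in> borel_measurable M" by measurable
  show "AE \<omega> in M. 0 \<le> 1 / sqrt (L 1 \<omega>)" using L1_pos by eventually_elim simp
  let ?e = "\<lambda>n \<omega>. exp 1 * real (Suc n) * exp (- (real n powr (1 / \<alpha>) * L 1 \<omega>))"
  have "(\<integral>\<^sup>+\<omega>. ennreal (1 / sqrt (L 1 \<omega>)) \<partial>M) \<le> (\<integral>\<^sup>+\<omega>. (\<Sum>n. ennreal (?e n \<omega>)) \<partial>M)"
  proof (rule nn_integral_mono_AE)
    show "AE \<omega> in M. ennreal (1 / sqrt (L 1 \<omega>)) \<le> (\<Sum>n. ennreal (?e n \<omega>))"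
      using L1_pos
    proof eventually_elim
      case (elim \<omega>)
      obtain n where "1 / sqrt (L 1 \<omega>) \<le> ?e n \<omega>" using inverse_sqrt_le_exponential_sum[OF elim] by blast
      then have "ennreal (1 / sqrt (L 1 \<omega>)) \<le> ennreal (?e n \<omega>)" by (rule ennreal_leI)
      also have "\<dots> = (\<Sum>n\<in>{n}. ennreal (?e n \<omega>))" by simp
      also have "\<dots> \<le> (\<Sum>n. ennreal (?e n \<omega>))" by (rule sum_le_suminf) auto
      finally show ?case .
    qed
  qed
  also have "\<dots> = (\<Sum>n. \<integral>\<^sup>+\<omega>. ennreal (?e n \<omega>) \<partial>M)"
    by (rule nn_integral_suminf) measurable
  also have "\<dots> = (\<Sum>n. ennreal (exp 1 * (real (Suc n) * laplace_1 ^ n)))"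
  proof (rule suminf_cong)
    fix n
    have "(\<integral>\<^sup>+\<omega>. ennreal (?e n \<omega>) \<partial>M) = ennreal (\<integral>\<omega>. ?e n \<omega> \<partial>M)"
      by (rule nn_integral_eq_integral) (auto intro!: integrable_mult_right integrable_exp_L)
    also have "(\<integral>\<omega>. ?e n \<omega> \<partial>M) = exp 1 * (real (Suc n) * laplace_1 ^ n)"
      by (simp add: laplace_scaled)
    finally show "(\<integral>\<^sup>+\<omega>. ennreal (?e n \<omega>) \<partial>M) = ennreal (exp 1 * (real (Suc n) * laplace_1 ^ n))" .
  qed
  also have "\<dots> = ennreal (\<Sum>n. exp 1 * (real (Suc n) * laplace_1 ^ n))"
    using geometric_deriv_sums[of laplace_1] laplace_1_bounds
    by (intro suminf_ennreal2 summable_mult) (auto simp: sums_iff)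
  also have "\<dots> < \<infinity>" by simp
  finally show "(\<integral>\<^sup>+\<omega>. ennreal (1 / sqrt (L 1 \<omega>)) \<partial>M) < \<infinity>" .
qed

lemma increment_pos:
  assumes "0 \<le> s" "s < t"
  shows "AE \<omega> in M. L s \<omega> < L t \<omega>"
proof -
  note [measurable] = L_measurable[of s] L_measurable[of t] L_measurable[of 1]
  have "AE x in distr M borel (\<lambda>\<omega>. (t - s) powr (1 / \<alpha>) * L 1 \<omega>). 0 < x"
    using L1_pos assms by (subst AE_distr_iff) auto
  then have "AE x in distr M borel (\<lambda>\<omega>. L t \<omega> - L s \<omega>). 0 < x" unfolding distr_increment[OF assms] .
  then show ?thesis using assms by (subst (asm) AE_distr_iff) auto
qed

lemma inverse_sqrt_increment:
  assumes "0 \<le> s" "s < t"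
  shows "integrable M (\<lambda>\<omega>. 1 / sqrt (L t \<omega> - L s \<omega>))"
    and "(\<integral>\<omega>. 1 / sqrt (L t \<omega> - L s \<omega>) \<partial>M) = (t - s) powr (- (1 / (2 * \<alpha>))) * (\<integral>\<omega>. 1 / sqrt (L 1 \<omega>) \<partial>M)"
proof -
  have "sqrt ((t - s) powr (1 / \<alpha>)) = (t - s) powr (1 / (2 * \<alpha>))"
    using assms by (simp add: powr_half_sqrt[symmetric] powr_powr mult.commute)
  then have *: "1 / sqrt ((t - s) powr (1 / \<alpha>) * x) = (t - s) powr (- (1 / (2 * \<alpha>))) * (1 / sqrt x)" for x
    by (simp add: real_sqrt_mult powr_minus_divide)
  show "integrable M (\<lambda>\<omega>. 1 / sqrt (L t \<omega> - L s \<omega>))"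
    by (subst integral_increment(2)[OF assms, of "\<lambda>x. 1 / sqrt x"])
       (auto simp only: * intro!: integrable_mult_right integrable_inverse_sqrt_L1 borel_measurable_divide borel_measurable_sqrt borel_measurable_const measurable_ident_sets)
  show "(\<integral>\<omega>. 1 / sqrt (L t \<omega> - L s \<omega>) \<partial>M) = (t - s) powr (- (1 / (2 * \<alpha>))) * (\<integral>\<omega>. 1 / sqrt (L 1 \<omega>) \<partial>M)"
    by (subst integral_increment(1)[OF assms, of "\<lambda>x. 1 / sqrt x"]) (simp, simp only: * integral_mult_right_zero)
qed

text \<open>By scaling, the increment over an interval shrinking to \<open>t0\<close> has the law of
  a vanishing multiple of L 1, while pathwise it decreases to a limit that dominates the oscillation
  at \<open>t0\<close>. Convergence in law to 0 forces that limit to vanish. The maximum with 0 lets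
  t0 = 0 be treated like any other time.\<close>

lemma no_fixed_jump:
  assumes "t0 \<ge> 0"
  shows "AE \<omega> in M. isCont (\<lambda>t. L (max 0 t) \<omega>) t0"
proof -
  define r where "r n = t0 + 1 / real (Suc n)" for n
  define l where "l n = max 0 (t0 - 1 / real (Suc n))" for n
  have lr: "0 \<le> l n" "l n < r n" for n using assms by (auto simp: l_def r_def intro: add_nonneg_pos)
  have lr_mono: "l n \<le> l (Suc n)" "r (Suc n) \<le> r n" for n
  proof -
    have "1 / real (Suc (Suc n)) \<le> 1 / real (Suc n)" by (simp add: frac_le)
    then show "l n \<le> l (Suc n)" "r (Suc n) \<le> r n" unfolding l_def r_def by (simp_all add: max.coboundedI2 del: of_nat_Suc)
  qed
  note [measurable] = L_measurable[of 1]
  have Lm [measurable]: "L (l n) \<in> borel_measurable M" "L (r n) \<in> borel_measurable M" for n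
    using lr[of n] by (auto intro!: L_measurable)
  \<comment> \<open>\<open>lim\<close> is total, so \<open>J\<close> is measurable everywhere; it is
    the limit of the increments on the almost sure event that the path is monotone.\<close>
  define J where "J \<omega> = lim (\<lambda>n. L (r n) \<omega> - L (l n) \<omega>)" for \<omega>
  have Jm [measurable]: "J \<in> borel_measurable M"
    unfolding J_def[abs_def] by (rule borel_measurable_lim_metric) measurable
  have Jlim: "AE \<omega> in M. (\<lambda>n. L (r n) \<omega> - L (l n) \<omega>) \<longlonglongrightarrow> J \<omega> \<and> 0 \<le> J \<omega>"
    using L_mono
  proof eventually_elim
    case (elim \<omega>)
    have m: "L x \<omega> \<le> L y \<omega>" if "0 \<le> x" "x \<le> y" for x y using elim that by (auto simp: mono_on_def)
    have dec: "decseq (\<lambda>n. L (r n) \<omega> - L (l n) \<omega>)"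
      by (rule decseq_SucI) (intro diff_mono m lr_mono lr order_trans[OF lr(1) less_imp_le[OF lr(2)]])
    have nn: "0 \<le> L (r n) \<omega> - L (l n) \<omega>" for n using m[OF lr(1) less_imp_le[OF lr(2)], of n] by simp
    obtain c where "(\<lambda>n. L (r n) \<omega> - L (l n) \<omega>) \<longlonglongrightarrow> c"
      using decseq_convergent[OF dec, of 0] nn by blast
    then have "convergent (\<lambda>n. L (r n) \<omega> - L (l n) \<omega>)" by (rule convergentI)
    then have "(\<lambda>n. L (r n) \<omega> - L (l n) \<omega>) \<longlonglongrightarrow> J \<omega>" unfolding J_def by (simp add: convergent_LIMSEQ_iff)
    moreover from this have "0 \<le> J \<omega>" by (rule LIMSEQ_le_const) (use nn in auto)
    ultimately show ?case by simp
  qed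
  \<comment> \<open>Truncation at 1 provides a majorant without any moment of L 1.\<close>
  have lim1: "(\<lambda>n. \<integral>\<omega>. min 1 (L (r n) \<omega> - L (l n) \<omega>) \<partial>M) \<longlonglongrightarrow> (\<integral>\<omega>. min 1 (J \<omega>) \<partial>M)"
  proof (rule integral_dominated_convergence[where w="\<lambda>_. 1"])
    show "AE \<omega> in M. (\<lambda>n. min 1 (L (r n) \<omega> - L (l n) \<omega>)) \<longlonglongrightarrow> min 1 (J \<omega>)"
      using Jlim by eventually_elim (auto intro!: tendsto_intros)
    show "AE \<omega> in M. norm (min 1 (L (r n) \<omega> - L (l n) \<omega>)) \<le> 1" for n
      using increment_pos[OF lr, of n] by eventually_elim auto
  qed auto
  have lim2: "(\<lambda>n. \<integral>\<omega>. min 1 ((r n - l n) powr (1 / \<alpha>) * L 1 \<omega>) \<partial>M) \<longlonglongrightarrow> (\<integral>\<omega>. min 1 0 \<partial>M)"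
  proof (rule integral_dominated_convergence[where w="\<lambda>_. 1"])
    have "(\<lambda>n. 1 / real (Suc n)) \<longlonglongrightarrow> 0" using LIMSEQ_inverse_real_of_nat by (simp add: inverse_eq_divide)
    then have "(\<lambda>n. r n - l n) \<longlonglongrightarrow> t0 + 0 - max 0 (t0 - 0)"
      unfolding r_def l_def by (intro tendsto_intros)
    then have "(\<lambda>n. r n - l n) \<longlonglongrightarrow> 0" using assms by simp
    then have "(\<lambda>n. (r n - l n) powr (1 / \<alpha>)) \<longlonglongrightarrow> 0 powr (1 / \<alpha>)"
      by (intro tendsto_powr' tendsto_const) (use alpha lr less_imp_le in \<open>auto intro!: always_eventually\<close>)
    then have p: "(\<lambda>n. (r n - l n) powr (1 / \<alpha>)) \<longlonglongrightarrow> 0" by simp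
    show "AE \<omega> in M. (\<lambda>n. min 1 ((r n - l n) powr (1 / \<alpha>) * L 1 \<omega>)) \<longlonglongrightarrow> min 1 0"
      by (intro AE_I2 tendsto_min tendsto_const tendsto_mult_left_zero p)
    show "AE \<omega> in M. norm (min 1 ((r n - l n) powr (1 / \<alpha>) * L 1 \<omega>)) \<le> 1" for n
      using L1_pos by eventually_elim (auto simp: min_def)
  qed auto
  have "(\<integral>\<omega>. min 1 (L (r n) \<omega> - L (l n) \<omega>) \<partial>M) = (\<integral>\<omega>. min 1 ((r n - l n) powr (1 / \<alpha>) * L 1 \<omega>) \<partial>M)" for n
    by (rule integral_increment(1)[OF lr, of "\<lambda>x. min 1 x"]) measurable
  with lim2 have "(\<lambda>n. \<integral>\<omega>. min 1 (L (r n) \<omega> - L (l n) \<omega>) \<partial>M) \<longlonglongrightarrow> 0" by simp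
  with lim1 have "(\<integral>\<omega>. min 1 (J \<omega>) \<partial>M) = 0" by (rule LIMSEQ_unique)
  moreover have "AE \<omega> in M. 0 \<le> min 1 (J \<omega>)" using Jlim by eventually_elim auto
  moreover have "integrable M (\<lambda>\<omega>. min 1 (J \<omega>))"
  proof (rule integrable_const_bound[of _ 1])
    show "AE \<omega> in M. norm (min 1 (J \<omega>)) \<le> 1" using Jlim by eventually_elim (auto simp: min_def)
  qed measurable
  ultimately have "AE \<omega> in M. min 1 (J \<omega>) = 0"
    by (subst (asm) integral_nonneg_eq_0_iff_AE) auto
  then show ?thesis using Jlim L_mono
  proof eventually_elim
    case (elim \<omega>)
    have J: "(\<lambda>n. L (r n) \<omega> - L (l n) \<omega>) \<longlonglongrightarrow> 0" using elim(1,2) by (simp add: min_def split: if_splits)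
    have m: "L x \<omega> \<le> L y \<omega>" if "0 \<le> x" "x \<le> y" for x y using elim(3) that by (auto simp: mono_on_def)
    show "isCont (\<lambda>t. L (max 0 t) \<omega>) t0"
    proof (subst continuous_at_eps_delta, intro allI impI)
      fix e :: real assume "e > 0"
      then obtain n where n: "L (r n) \<omega> - L (l n) \<omega> < e"
        using order_tendstoD(2)[OF J] eventually_happens by fastforce
      show "\<exists>d>0. \<forall>t. dist t t0 < d \<longrightarrow> dist (L (max 0 t) \<omega>) (L (max 0 t0) \<omega>) < e"
      proof (intro exI[of _ "1 / real (Suc n)"] conjI allI impI)
        fix t assume "dist t t0 < 1 / real (Suc n)"
        then have "l n \<le> max 0 t" "max 0 t \<le> r n" "l n \<le> max 0 t0" "max 0 t0 \<le> r n"
          using assms by (auto simp: l_def r_def dist_real_def)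
        then have "L (l n) \<omega> \<le> L (max 0 t) \<omega>" "L (max 0 t) \<omega> \<le> L (r n) \<omega>"
          "L (l n) \<omega> \<le> L (max 0 t0) \<omega>" "L (max 0 t0) \<omega> \<le> L (r n) \<omega>"
          using lr(1)[of n] by (auto intro!: m)
        then show "dist (L (max 0 t) \<omega>) (L (max 0 t0) \<omega>) < e" using n by (simp add: dist_real_def)
      qed simp
    qed
  qed
qed

end

subsection \<open>Riemann--Stieltjes sums with exponential weights\<close>

lemma integral_exp_weight:
  fixes c a b t :: real
  assumes "a \<le> b"
  shows "set_integrable lborel {a..b} (\<lambda>q. c * exp (- c * (t - q)))"
    and "(LINT q:{a..b}|lborel. c * exp (- c * (t - q))) = exp (- c * (t - b)) - exp (- c * (t - a))"
proof -
  have cont: "continuous_on {a..b} (\<lambda>q. c * exp (- c * (t - q)))" by (intro continuous_intros)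
  have der: "((\<lambda>q. exp (- c * (t - q))) has_vector_derivative c * exp (- c * (t - q))) (at q within {a..b})" for q
    unfolding has_real_derivative_iff_has_vector_derivative[symmetric]
    by (auto intro!: derivative_eq_intros)
  show "set_integrable lborel {a..b} (\<lambda>q. c * exp (- c * (t - q)))"
    using borel_integrable_atLeastAtMost'[OF cont] .
  show "(LINT q:{a..b}|lborel. c * exp (- c * (t - q))) = exp (- c * (t - b)) - exp (- c * (t - a))"
    using integral_FTC_atLeastAtMost[OF assms der cont] unfolding set_lebesgue_integral_def .
qed

lemma abel_summation:
  fixes e y :: "nat \<Rightarrow> real"
  shows "(\<Sum>k<n. e k * (y (Suc k) - y k)) = e n * y n - e 0 * y 0 - (\<Sum>k<n. (e (Suc k) - e k) * y (Suc k))"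
  by (induction n) (simp_all add: algebra_simps)

text \<open>There are \<open>Suc n\<close> cells, so the mesh is defined for every \<open>n\<close>
  and the right endpoint has index \<open>Suc n\<close>.\<close>

definition grid :: "real \<Rightarrow> real \<Rightarrow> nat \<Rightarrow> nat \<Rightarrow> real" where
  "grid s t n k = s + (t - s) * real k / real (Suc n)"

lemma grid_0 [simp]: "grid s t n 0 = s" and grid_Suc_n [simp]: "grid s t n (Suc n) = t"
  unfolding grid_def by (simp_all del: of_nat_Suc)

lemma grid_mono: "s \<le> t \<Longrightarrow> i \<le> j \<Longrightarrow> grid s t n i \<le> grid s t n j"
  by (auto simp: grid_def intro!: divide_right_mono mult_left_mono)

lemma grid_bounds: "s \<le> t \<Longrightarrow> k \<le> Suc n \<Longrightarrow> grid s t n k \<in> {s..t}"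
  using grid_mono[of s t 0 k n] grid_mono[of s t k "Suc n" n] by simp

text \<open>Riemann--Stieltjes sums converge along approximate values \<open>Y\<close> of a path \<open>y\<close>, because
  summation by parts moves the increments onto the exponential weight.\<close>

lemma stieltjes_sum_tendsto:
  fixes y :: "real \<Rightarrow> real" and Y :: "nat \<Rightarrow> nat \<Rightarrow> real" and c s t K :: real
  assumes st: "s < t"
    and ym [measurable]: "y \<in> borel_measurable borel"
    and Ys: "(\<lambda>n. Y n 0) \<longlonglongrightarrow> y s" and Yt: "(\<lambda>n. Y n (Suc n)) \<longlonglongrightarrow> y t"
    and Yq: "AE q in lborel. s < q \<longrightarrow> q < t \<longrightarrow>
       (\<forall>k. (\<forall>n. k n \<le> Suc n) \<longrightarrow> (\<lambda>n. grid s t n (k n)) \<longlonglongrightarrow> q \<longrightarrow> (\<lambda>n. Y n (k n)) \<longlonglongrightarrow> y q)"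
    and bd: "\<And>n k. k \<le> Suc n \<Longrightarrow> \<bar>Y n k\<bar> \<le> K"
  shows "(\<lambda>n. \<Sum>k<Suc n. exp (- c * (t - grid s t n k)) * (Y n (Suc k) - Y n k)) \<longlonglongrightarrow>
     y t - exp (- c * (t - s)) * y s - (LINT q:{s..t}|lborel. c * exp (- c * (t - q)) * y q)"
proof -
  define e where "e q = exp (- c * (t - q))" for q
  \<comment> \<open>The step function that summation by parts produces: on each cell it takes the
    value of \<open>Y\<close> at the right end.\<close>
  define F where "F n q = (\<Sum>k<Suc n. Y n (Suc k) * indicator {grid s t n k<..grid s t n (Suc k)} q)" for n q
  \<comment> \<open>The index of the right end of the cell containing \<open>q\<close>. The cells
    are open on the left, hence the ceiling.\<close>
  define \<kappa> where "\<kappa> n q = nat \<lceil>(q - s) / (t - s) * real (Suc n)\<rceil>" for n q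
  have F: "F n q = Y n (\<kappa> n q)" and \<kappa>: "\<kappa> n q \<le> Suc n" "\<bar>grid s t n (\<kappa> n q) - q\<bar> \<le> (t - s) / real (Suc n)"
    if q: "s < q" "q \<le> t" for n q
  proof -
    define z where "z = (q - s) / (t - s) * real (Suc n)"
    have z: "0 < z" "z \<le> real (Suc n)"
      using q st by (auto simp: z_def divide_simps mult_left_mono simp del: of_nat_Suc)
    have gq: "grid s t n k < q \<longleftrightarrow> real k < z" "q \<le> grid s t n k \<longleftrightarrow> z \<le> real k" for k
      using st by (auto simp: grid_def z_def field_simps simp del: of_nat_Suc)
    have kz: "\<kappa> n q = nat \<lceil>z\<rceil>" by (simp add: \<kappa>_def z_def)
    then have kr: "real (\<kappa> n q) = real_of_int \<lceil>z\<rceil>" using z by simp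
    have c1: "z \<le> real (\<kappa> n q)" "real (\<kappa> n q) < z + 1" unfolding kr by linarith+
    show le: "\<kappa> n q \<le> Suc n" using c1 z by linarith
    obtain m where m: "\<kappa> n q = Suc m" using c1 z by (cases "\<kappa> n q") auto
    have iff: "grid s t n k < q \<and> q \<le> grid s t n (Suc k) \<longleftrightarrow> k = m" for k
      unfolding gq using c1 m by auto
    have "F n q = (\<Sum>k<Suc n. if k = m then Y n (Suc k) else 0)"
      unfolding F_def by (intro sum.cong) (use iff in \<open>auto simp: indicator_def\<close>)
    also have "\<dots> = Y n (\<kappa> n q)" using m le by (simp add: sum.delta)
    finally show "F n q = Y n (\<kappa> n q)" .
    have "grid s t n (\<kappa> n q) - q = (t - s) * (real (\<kappa> n q) - z) / real (Suc n)"
      using st by (simp add: grid_def z_def field_simps del: of_nat_Suc)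
    also have "\<bar>\<dots>\<bar> = (t - s) * \<bar>real (\<kappa> n q) - z\<bar> / real (Suc n)" using st by (simp add: abs_mult)
    also have "\<dots> \<le> (t - s) * 1 / real (Suc n)"
      using c1 st by (intro divide_right_mono mult_left_mono) auto
    finally show "\<bar>grid s t n (\<kappa> n q) - q\<bar> \<le> (t - s) / real (Suc n)" by simp
  qed
  have gl: "(\<lambda>n. grid s t n (\<kappa> n q)) \<longlonglongrightarrow> q" if "s < q" "q \<le> t" for q
  proof (rule LIM_zero_cancel, rule Lim_null_comparison[OF always_eventually])
    show "\<forall>n. norm (grid s t n (\<kappa> n q) - q) \<le> (t - s) * inverse (real (Suc n))"
      using \<kappa>(2)[OF that] by (auto simp: divide_inverse)
    show "(\<lambda>n. (t - s) * inverse (real (Suc n))) \<longlonglongrightarrow> 0"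
      by (intro tendsto_mult_right_zero LIMSEQ_inverse_real_of_nat)
  qed
  have em [measurable]: "e \<in> borel_measurable borel" unfolding e_def[abs_def] by measurable
  \<comment> \<open>Each increment of the weight is the integral of its derivative over a cell, so
    the sum is an integral of the step function and dominated convergence applies.\<close>
  have sumF: "(\<Sum>k<Suc n. (e (grid s t n (Suc k)) - e (grid s t n k)) * Y n (Suc k)) = (\<integral>q. c * e q * F n q \<partial>lborel)" for n
  proof -
    have i: "integrable lborel (\<lambda>q. indicator {a<..b} q * (c * e q))" 
       and v: "(\<integral>q. indicator {a<..b} q * (c * e q) \<partial>lborel) = e b - e a" if "a \<le> b" for a b
    proof -
      have AE: "AE q in lborel. indicator {a<..b} q * (c * e q) = indicator {a..b} q * (c * e q)"
        by (rule AE_mp[OF AE_lborel_singleton[of a]], rule AE_I2) (auto simp: indicator_def)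
      have ii: "integrable lborel (\<lambda>q. indicator {a..b} q * (c * e q))"
        using integral_exp_weight(1)[OF that, of c t] by (simp add: set_integrable_def e_def)
      show "integrable lborel (\<lambda>q. indicator {a<..b} q * (c * e q))"
        by (rule Bochner_Integration.integrable_bound[OF ii]) (auto simp: indicator_def)
      have "(\<integral>q. indicator {a<..b} q * (c * e q) \<partial>lborel) = (\<integral>q. indicator {a..b} q * (c * e q) \<partial>lborel)"
        by (rule integral_cong_AE) (use AE in auto)
      then show "(\<integral>q. indicator {a<..b} q * (c * e q) \<partial>lborel) = e b - e a"
        using integral_exp_weight(2)[OF that, of c t] by (simp only: set_lebesgue_integral_def e_def real_scaleR_def)
    qed
    have g: "grid s t n k \<le> grid s t n (Suc k)" for k using st by (intro grid_mono) auto
    have "(\<integral>q. c * e q * F n q \<partial>lborel) = (\<integral>q. (\<Sum>k<Suc n. Y n (Suc k) * (indicator {grid s t n k<..grid s t n (Suc k)} q * (c * e q))) \<partial>lborel)"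
      unfolding F_def sum_distrib_left
      by (rule Bochner_Integration.integral_cong[OF refl], rule sum.cong[OF refl]) (simp add: mult_ac)
    also have "\<dots> = (\<Sum>k<Suc n. \<integral>q. Y n (Suc k) * (indicator {grid s t n k<..grid s t n (Suc k)} q * (c * e q)) \<partial>lborel)"
      by (intro Bochner_Integration.integral_sum integrable_mult_right i g)
    also have "\<dots> = (\<Sum>k<Suc n. (e (grid s t n (Suc k)) - e (grid s t n k)) * Y n (Suc k))"
      by (rule sum.cong[OF refl]) (simp only: integral_mult_right_zero v[OF g], rule mult.commute)
    finally show ?thesis by simp
  qed
  have "(\<lambda>n. \<integral>q. c * e q * F n q \<partial>lborel) \<longlonglongrightarrow> (\<integral>q. indicator {s..t} q *\<^sub>R (c * e q * y q) \<partial>lborel)"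
  proof (rule integral_dominated_convergence[where w="\<lambda>q. \<bar>K\<bar> * \<bar>indicator {s..t} q *\<^sub>R (c * e q)\<bar>"])
    show "integrable lborel (\<lambda>q. \<bar>K\<bar> * \<bar>indicator {s..t} q *\<^sub>R (c * e q)\<bar>)"
      using integral_exp_weight(1)[of s t c t] st by (intro integrable_mult_right integrable_abs) (simp add: set_integrable_def e_def)
    have F0: "F n q = 0" if "\<not> (s < q \<and> q \<le> t)" for n q
      unfolding F_def
    proof (rule sum.neutral, rule ballI)
      fix k assume "k \<in> {..<Suc n}"
      then have "grid s t n k \<ge> s" "grid s t n (Suc k) \<le> t" using grid_bounds[of s t k n] grid_bounds[of s t "Suc k" n] st by auto
      then show "Y n (Suc k) * indicator {grid s t n k<..grid s t n (Suc k)} q = 0" using that by (auto simp: indicator_def)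
    qed
    show "AE q in lborel. norm (c * e q * F n q) \<le> \<bar>K\<bar> * \<bar>indicator {s..t} q *\<^sub>R (c * e q)\<bar>" for n
    proof (rule AE_I2)
      fix q
      show "norm (c * e q * F n q) \<le> \<bar>K\<bar> * \<bar>indicator {s..t} q *\<^sub>R (c * e q)\<bar>"
      proof (cases "s < q \<and> q \<le> t")
        case True
        then have "\<bar>F n q\<bar> \<le> \<bar>K\<bar>" using F \<kappa>(1) bd by (metis abs_ge_self order_trans)
        then have "\<bar>c * e q\<bar> * \<bar>F n q\<bar> \<le> \<bar>c * e q\<bar> * \<bar>K\<bar>" by (intro mult_left_mono) auto
        then show ?thesis using True by (simp add: abs_mult mult_ac)
      qed (simp add: F0)
    qed
    show "AE q in lborel. (\<lambda>n. c * e q * F n q) \<longlonglongrightarrow> indicator {s..t} q *\<^sub>R (c * e q * y q)"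
      using Yq AE_lborel_singleton[of s] AE_lborel_singleton[of t]
    proof eventually_elim
      case (elim q)
      show ?case
      proof (cases "s < q \<and> q < t")
        case True
        then have "(\<lambda>n. Y n (\<kappa> n q)) \<longlonglongrightarrow> y q" using elim \<kappa>(1) gl by auto
        then have "(\<lambda>n. F n q) \<longlonglongrightarrow> y q" using F True by auto
        then have "(\<lambda>n. c * e q * F n q) \<longlonglongrightarrow> c * e q * y q" by (intro tendsto_intros)
        then show ?thesis using True by simp
      next
        case False
        then show ?thesis using elim F0[of q] by auto
      qed
    qed
    show "(\<lambda>q. c * e q * F n q) \<in> borel_measurable lborel" for n unfolding F_def by measurable
  qed measurable
  then have "(\<lambda>n. e t * Y n (Suc n) - e s * Y n 0 - (\<integral>q. c * e q * F n q \<partial>lborel)) \<longlonglongrightarrow>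
     e t * y t - e s * y s - (\<integral>q. indicator {s..t} q *\<^sub>R (c * e q * y q) \<partial>lborel)"
    by (intro tendsto_intros Ys Yt)
  moreover have "(\<Sum>k<Suc n. e (grid s t n k) * (Y n (Suc k) - Y n k)) = e t * Y n (Suc n) - e s * Y n 0 - (\<integral>q. c * e q * F n q \<partial>lborel)" for n
    unfolding sumF[symmetric] by (subst abel_summation) simp
  ultimately have "(\<lambda>n. \<Sum>k<Suc n. e (grid s t n k) * (Y n (Suc k) - Y n k)) \<longlonglongrightarrow>
     e t * y t - e s * y s - (\<integral>q. indicator {s..t} q *\<^sub>R (c * e q * y q) \<partial>lborel)" by simp
  moreover have "e t = 1" by (simp add: e_def)
  ultimately show ?thesis by (simp only: e_def[symmetric] set_lebesgue_integral_def mult_1_left)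
qed

text \<open>Exchange of integrals on the triangle q <= r: integrated over r in {q..t}, the weight
  gives 1 - exp (-c (t - q)).\<close>

lemma exp_weight_fubini:
  fixes k :: "real \<Rightarrow> real"
  assumes st: "s \<le> t" and k: "set_integrable lborel {s..t} k"
  shows "(LINT r:{s..t}|lborel. c * exp (- c * (t - r)) * (LINT q:{s..r}|lborel. k q)) =
     (LINT q:{s..t}|lborel. k q) - (LINT q:{s..t}|lborel. exp (- c * (t - q)) * k q)"
    and "set_integrable lborel {s..t} (\<lambda>q. exp (- c * (t - q)) * k q)"
    and "set_integrable lborel {s..t} (\<lambda>r. c * exp (- c * (t - r)) * (LINT q:{s..r}|lborel. k q))"
proof -
  define k' where "k' q = indicator {s..t} q * k q" for q
  define e where "e r = indicator {s..t} r * (c * exp (- c * (t - r)))" for r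
  have ki: "integrable lborel k'" using k by (simp add: set_integrable_def k'_def[abs_def])
  then have km [measurable]: "k' \<in> borel_measurable borel" by auto
  have em [measurable]: "e \<in> borel_measurable borel" unfolding e_def by measurable
  have ei: "integrable lborel e" using integral_exp_weight(1)[OF st, of c t] by (simp add: set_integrable_def e_def[abs_def])
  define f where "f r q = (if q \<le> r then e r * k' q else 0)" for r q
  have fm [measurable]: "(\<lambda>(r, q). f r q) \<in> borel_measurable (lborel \<Otimes>\<^sub>M lborel)"
    unfolding f_def split_def by measurable
  have prod: "integrable (lborel \<Otimes>\<^sub>M lborel) (\<lambda>(r, q). e r * k' q)"
  proof (rule lborel_pair.Fubini_integrable)
    show "integrable lborel (\<lambda>r. \<integral>q. norm (case (r, q) of (r, q) \<Rightarrow> e r * k' q) \<partial>lborel)"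
      using ei ki by (simp add: abs_mult)
  qed (use ki in auto)
  have fi: "integrable (lborel \<Otimes>\<^sub>M lborel) (\<lambda>(r, q). f r q)"
    by (rule Bochner_Integration.integrable_bound[OF prod fm]) (auto simp: f_def)
  have inner1: "(\<integral>q. f r q \<partial>lborel) = indicator {s..t} r *\<^sub>R (c * exp (- c * (t - r)) * (LINT q:{s..r}|lborel. k q))" for r
  proof -
    have "f r q = e r * (indicator {s..r} q *\<^sub>R k q)" for q
      by (auto simp: f_def e_def k'_def indicator_def)
    then show ?thesis by (simp only: integral_mult_right_zero set_lebesgue_integral_def e_def real_scaleR_def mult.assoc)
  qed
  have inner2: "(\<integral>r. f r q \<partial>lborel) = indicator {s..t} q *\<^sub>R (k q - exp (- c * (t - q)) * k q)" for q
  proof (cases "q \<in> {s..t}")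
    case True
    have "f r q = k q * (indicator {q..t} r *\<^sub>R (c * exp (- c * (t - r))))" for r
      using True by (auto simp: f_def e_def k'_def indicator_def)
    then have "(\<integral>r. f r q \<partial>lborel) = k q * (LINT r:{q..t}|lborel. c * exp (- c * (t - r)))"
      by (simp only: integral_mult_right_zero set_lebesgue_integral_def)
    also have "(LINT r:{q..t}|lborel. c * exp (- c * (t - r))) = 1 - exp (- c * (t - q))"
      using integral_exp_weight(2)[of q t c t] True by simp
    finally show ?thesis using True by (simp add: algebra_simps)
  next
    case False
    then have "f r q = 0" for r by (auto simp: f_def k'_def)
    then show ?thesis using False by simp
  qed
  show ei': "set_integrable lborel {s..t} (\<lambda>q. exp (- c * (t - q)) * k q)"
  proof -
    have "integrable lborel (\<lambda>q. exp (\<bar>c\<bar> * (t - s)) * k' q)" using ki by simp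
    then have "integrable lborel (\<lambda>q. exp (- c * (t - q)) * k' q)"
    proof (rule Bochner_Integration.integrable_bound)
      show "AE q in lborel. norm (exp (- c * (t - q)) * k' q) \<le> norm (exp (\<bar>c\<bar> * (t - s)) * k' q)"
      proof (rule AE_I2)
        fix q
        show "norm (exp (- c * (t - q)) * k' q) \<le> norm (exp (\<bar>c\<bar> * (t - s)) * k' q)"
        proof (cases "q \<in> {s..t}")
          case True
          have "- c * (t - q) \<le> \<bar>c\<bar> * (t - s)"
            using True by (intro order_trans[OF mult_right_mono[of "-c" "\<bar>c\<bar>"] mult_left_mono]) auto
          then show ?thesis by (auto simp: abs_mult intro!: mult_right_mono)
        qed (simp add: k'_def)
      qed
    qed measurable
    then show ?thesis by (simp add: set_integrable_def k'_def mult_ac)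
  qed
  have "(\<integral>r. (\<integral>q. f r q \<partial>lborel) \<partial>lborel) = (\<integral>q. (\<integral>r. f r q \<partial>lborel) \<partial>lborel)"
    by (rule lborel_pair.Fubini_integral[OF fi, symmetric])
  then have "(LINT r:{s..t}|lborel. c * exp (- c * (t - r)) * (LINT q:{s..r}|lborel. k q)) =
     (LINT q:{s..t}|lborel. k q - exp (- c * (t - q)) * k q)"
    by (simp only: inner1 inner2 set_lebesgue_integral_def)
  also have "\<dots> = (LINT q:{s..t}|lborel. k q) - (LINT q:{s..t}|lborel. exp (- c * (t - q)) * k q)"
    by (rule set_integral_diff(2)[OF k ei'])
  finally show "(LINT r:{s..t}|lborel. c * exp (- c * (t - r)) * (LINT q:{s..r}|lborel. k q)) =
     (LINT q:{s..t}|lborel. k q) - (LINT q:{s..t}|lborel. exp (- c * (t - q)) * k q)" .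
  have "integrable lborel (\<lambda>r. \<integral>q. f r q \<partial>lborel)" using lborel_pair.integrable_fst[OF fi] by simp
  then show "set_integrable lborel {s..t} (\<lambda>r. c * exp (- c * (t - r)) * (LINT q:{s..r}|lborel. k q))"
    by (simp only: inner1 set_integrable_def)
qed

text \<open>The forcing \<open>h\<close> is a path with jumps, so the product of \<open>X\<close>
  with an exponential cannot be differentiated. Instead the equation is solved for \<open>h\<close>,
  integrated against the weight, and the resulting double integral is removed by the triangle
  identity.\<close>

lemma variation_of_constants:
  fixes X f h :: "real \<Rightarrow> real"
  assumes st: "s \<le> t" and c: "c \<noteq> 0"
    and f: "continuous_on {s..t} f"
    and int: "set_integrable lborel {s..t} (\<lambda>r. - c * X r + f r)"
    and X: "\<And>r. r \<in> {s..t} \<Longrightarrow> X r = x + (LINT q:{s..r}|lborel. - c * X q + f q) + h r"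
  shows "X t = exp (- c * (t - s)) * x + (LINT q:{s..t}|lborel. exp (- c * (t - q)) * f q) +
     (h t - (LINT q:{s..t}|lborel. c * exp (- c * (t - q)) * h q))"
proof -
  let ?k = "\<lambda>r. - c * X r + f r" and ?e = "\<lambda>r. exp (- c * (t - r))"
  have fi: "set_integrable lborel {s..t} f" using borel_integrable_atLeastAtMost'[OF f] .
  \<comment> \<open>Only the drift is known to be integrable; since \<open>c\<close> is nonzero,
    \<open>X\<close> is a linear combination of the drift and the continuous
    \<open>f\<close>.\<close>
  have "set_integrable lborel {s..t} (\<lambda>r. (1 / c) * (f r - ?k r))"
    by (intro set_integrable_mult_right set_integral_diff(1) fi int)
  then have Xi: "set_integrable lborel {s..t} X" using c by simp
  note ek = exp_weight_fubini[OF st int, of c]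
  note eX = exp_weight_fubini(2)[OF st Xi, of c] and ef = exp_weight_fubini(2)[OF st fi, of c]
  have eX': "set_integrable lborel {s..t} (\<lambda>r. c * (?e r * X r))" by (intro set_integrable_mult_right eX)
  have e1: "set_integrable lborel {s..t} (\<lambda>r. c * ?e r * x)"
    using set_integrable_mult_left[OF integral_exp_weight(1)[OF st, of c t]] .
  have eh: "(LINT r:{s..t}|lborel. c * ?e r * h r) = (LINT r:{s..t}|lborel. c * (?e r * X r)) - (LINT r:{s..t}|lborel. c * ?e r * x)
      - (LINT r:{s..t}|lborel. c * ?e r * (LINT q:{s..r}|lborel. ?k q))"
  proof -
    have "(LINT r:{s..t}|lborel. c * ?e r * h r) = (LINT r:{s..t}|lborel. (c * (?e r * X r) - c * ?e r * x) - c * ?e r * (LINT q:{s..r}|lborel. ?k q))"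
    proof (rule set_lebesgue_integral_cong)
      show "\<forall>r. r \<in> {s..t} \<longrightarrow> c * ?e r * h r = (c * (?e r * X r) - c * ?e r * x) - c * ?e r * (LINT q:{s..r}|lborel. ?k q)"
      proof (intro allI impI)
        fix r assume "r \<in> {s..t}"
        then have h: "h r = X r - x - (LINT q:{s..r}|lborel. ?k q)" using X by simp
        show "c * ?e r * h r = (c * (?e r * X r) - c * ?e r * x) - c * ?e r * (LINT q:{s..r}|lborel. ?k q)"
          unfolding h by (simp only: right_diff_distrib mult.assoc)
      qed
    qed simp
    also have "\<dots> = (LINT r:{s..t}|lborel. c * (?e r * X r)) - (LINT r:{s..t}|lborel. c * ?e r * x)
      - (LINT r:{s..t}|lborel. c * ?e r * (LINT q:{s..r}|lborel. ?k q))"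
      by (subst set_integral_diff(2)[OF set_integral_diff(1)[OF eX' e1] ek(3)], subst set_integral_diff(2)[OF eX' e1]) simp
    finally show ?thesis .
  qed
  have x: "(LINT r:{s..t}|lborel. c * ?e r * x) = (1 - ?e s) * x"
    using integral_exp_weight(2)[OF st, of c t] by (simp add: set_lebesgue_integral_def mult.assoc[symmetric])
  have "(LINT r:{s..t}|lborel. ?e r * ?k r) = (LINT r:{s..t}|lborel. ?e r * f r - c * (?e r * X r))"
    by (rule set_lebesgue_integral_cong) (auto simp: algebra_simps)
  also have "\<dots> = (LINT r:{s..t}|lborel. ?e r * f r) - (LINT r:{s..t}|lborel. c * (?e r * X r))"
    by (rule set_integral_diff(2)[OF ef eX'])
  finally have kk: "(LINT r:{s..t}|lborel. ?e r * ?k r) = (LINT r:{s..t}|lborel. ?e r * f r) - (LINT r:{s..t}|lborel. c * (?e r * X r))" .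
  have "X t = x + (LINT q:{s..t}|lborel. ?k q) + h t" using X[of t] st by simp
  then show ?thesis using ek(1) eh x kk by (simp add: algebra_simps)
qed

subsection \<open>The subordinated Brownian motion given the subordinator\<close>

text \<open>In a complete space the part of a preimage that lies in the exceptional null set is
  automatically an event. This gives measurability of path integrals that are only almost surely
  limits of measurable sums.\<close>

lemma (in complete_measure) borel_measurable_AE_eq:
  assumes g: "g \<in> M \<rightarrow>\<^sub>M N" and fg: "AE x in M. f x = g x" and sp: "space N = UNIV"
  shows "f \<in> M \<rightarrow>\<^sub>M N"
proof (rule measurableI)
  fix A assume A: "A \<in> sets N"
  define Z where "Z = {x\<in>space M. f x \<noteq> g x}"
  have Z: "Z \<in> null_sets M" using fg unfolding AE_iff_null_sets Z_def by simp
  have "f -` A \<inter> space M = ((g -` A \<inter> space M) - Z) \<union> (f -` A \<inter> Z)" by (auto simp: Z_def)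
  moreover have "f -` A \<inter> Z \<in> sets M" using complete2[OF _ Z, of "f -` A \<inter> Z"] by auto
  ultimately show "f -` A \<inter> space M \<in> sets M"
    using measurable_sets[OF g A] Z by (auto intro!: sets.Un sets.Diff)
qed (simp add: sp)

text \<open>Variances are positive only almost surely; \<open>posvec\<close> repairs them on the exceptional null set.\<close>

definition posvec :: "real ^ 'n \<Rightarrow> real ^ 'n" where
  "posvec a = (\<chi> j. if a $ j > 0 then a $ j else 1)"

lemma posvec_pos: "posvec a $ j > 0"
  by (simp add: posvec_def)

lemma posvec_id: "(\<And>j. a $ j > 0) \<Longrightarrow> posvec a = a"
  by (simp add: posvec_def vec_eq_iff)

lemma posvec_measurable [measurable]: "posvec \<in> borel_measurable borel"
  unfolding posvec_def by (intro vec_lambda_measurable) measurable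

text \<open>The integral is continuous in mean and deviations on the positive orthant, so composing
  with measurable parameters stays measurable.\<close>

lemma integral_gauss_measurable:
  fixes \<phi> :: "real ^ 'n \<Rightarrow> real" and m A :: "'a \<Rightarrow> real ^ 'n"
  assumes \<phi>: "\<phi> \<in> bounded_borel"
    and m: "m \<in> borel_measurable N" and A: "A \<in> borel_measurable N" and pos: "\<And>\<omega> j. A \<omega> $ j > 0"
  shows "(\<lambda>\<omega>. \<integral>y. \<phi> y \<partial>gauss (m \<omega>) (A \<omega>)) \<in> borel_measurable N"
proof -
  let ?P = "{z :: (real ^ 'n) \<times> (real ^ 'n). \<forall>j. snd z $ j > 0}"
  have "continuous_on ?P (\<lambda>z. \<integral>y. \<phi> y \<partial>gauss (fst z) (snd z))"
  proof (unfold continuous_on_sequentially, intro allI ballI impI, elim conjE)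
    fix X z assume z: "z \<in> ?P" and X: "\<forall>n. X n \<in> ?P" "X \<longlonglongrightarrow> z"
    show "((\<lambda>z. \<integral>y. \<phi> y \<partial>gauss (fst z) (snd z)) \<circ> X) \<longlonglongrightarrow> (\<integral>y. \<phi> y \<partial>gauss (fst z) (snd z))"
      unfolding o_def using z X by (intro integral_gauss_tendsto tendsto_fst tendsto_snd \<phi>) auto
  qed
  then have c: "(\<lambda>z. \<integral>y. \<phi> y \<partial>gauss (fst z) (snd z)) \<in> borel_measurable (restrict_space borel ?P)"
    by (rule borel_measurable_continuous_on_restrict)
  have "(\<lambda>\<omega>. (m \<omega>, A \<omega>)) \<in> N \<rightarrow>\<^sub>M restrict_space borel ?P"
    using m A pos by (intro measurable_restrict_space2) auto
  from measurable_compose[OF this c] show ?thesis by simp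
qed

lemma integral_gauss_bound:
  fixes m a :: "real ^ 'n" and \<phi> :: "real ^ 'n \<Rightarrow> real"
  assumes "\<And>j. a $ j > 0" "\<phi> \<in> borel_measurable borel" "\<And>y. \<bar>\<phi> y\<bar> \<le> c"
  shows "\<bar>\<integral>y. \<phi> y \<partial>gauss m a\<bar> \<le> c"
proof -
  interpret prob_space "gauss m a" using assms(1) by (rule prob_space_gauss)
  have "\<bar>\<integral>y. \<phi> y \<partial>gauss m a\<bar> \<le> (\<integral>y. \<bar>\<phi> y\<bar> \<partial>gauss m a)" by (rule integral_abs_bound)
  also have "\<dots> \<le> c"
    using assms by (intro integral_le_const integrable_abs integrable_const_bound[of _ c] AE_I2) auto
  finally show ?thesis .
qed

section \<open>Brownian increments at countably many random times\<close>

locale subordinated_bm = stable_driver M \<alpha> \<gamma>b L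
  for M :: "'w measure" and \<alpha> \<gamma>b :: real and L :: "real \<Rightarrow> 'w \<Rightarrow> real" +
  fixes W :: "real \<Rightarrow> 'w \<Rightarrow> real ^ 'n"
  assumes complete: "complete_measure M"
    and bm: "brownian_motion M W"
    and indep: "independent_processes M L W"
begin

lemma W_measurable:
  assumes "t \<ge> 0"
  shows "W t \<in> borel_measurable M"
proof -
  have "(\<lambda>\<omega>. W t \<omega> $ j) \<in> borel_measurable M" for j
    using bm assms by (simp add: brownian_motion_def real_brownian_motion_def)
  from vec_lambda_measurable[of "\<lambda>\<omega> j. W t \<omega> $ j", OF this] show ?thesis by simp
qed

lemma W_continuous: "AE \<omega> in M. \<forall>j. continuous_on {0..} (\<lambda>t. W t \<omega> $ j)"
  using bm by (simp add: brownian_motion_def real_brownian_motion_def AE_all_countable)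

text \<open>Each coordinate is a sum of independent centred normal variables plus a constant, with
  the variances added. The times increase strictly, so that every increment has a density.\<close>

lemma distr_linear_combination:
  fixes \<tau> :: "nat \<Rightarrow> real" and c :: "nat \<Rightarrow> 'n \<Rightarrow> real" and m :: "real ^ 'n"
  assumes n: "n > 0" and \<tau>: "0 \<le> \<tau> 0" "\<And>k. k < n \<Longrightarrow> \<tau> k < \<tau> (Suc k)" and c: "\<And>k j. c k j > 0"
  shows "distr M borel (\<lambda>\<omega>. \<chi> j. m $ j + (\<Sum>k<n. c k j * (W (\<tau> (Suc k)) \<omega> $ j - W (\<tau> k) \<omega> $ j))) =
    gauss m (\<chi> j. sqrt (\<Sum>k<n. (c k j)\<^sup>2 * (\<tau> (Suc k) - \<tau> k)))"
proof -
  \<comment> \<open>Independence of increments is stated for monotone sequences over all naturals;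
    freezing the times after \<open>n\<close> extends the finite list.\<close>
  define \<tau>' where "\<tau>' k = \<tau> (min k n)" for k
  have "\<tau>' k \<le> \<tau>' (Suc k)" for k using \<tau>(2)[of k] by (cases "k < n") (auto simp: \<tau>'_def min_def)
  then have mono: "mono \<tau>'" by (intro mono_iff_le_Suc[THEN iffD2]) auto
  have \<tau>'0: "0 \<le> \<tau>' 0" using \<tau> by (simp add: \<tau>'_def)
  have \<tau>'nn: "0 \<le> \<tau>' k" for k using \<tau>'0 monoD[OF mono, of 0 k] by simp
  have \<tau>nn: "0 \<le> \<tau> k" if "k \<le> n" for k using \<tau>'nn[of k] that by (simp add: \<tau>'_def)
  have \<tau>nn': "0 \<le> \<tau> k" "0 \<le> \<tau> (Suc k)" if "k < n" for k
    using \<tau>nn[of k] \<tau>nn[of "Suc k"] that by simp_all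
  have eq: "\<tau> k = \<tau>' k" "\<tau> (Suc k) = \<tau>' (Suc k)" if "k < n" for k using that by (simp_all add: \<tau>'_def)
  let ?S = "\<lambda>j \<omega>. m $ j + (\<Sum>k<n. c k j * (W (\<tau> (Suc k)) \<omega> $ j - W (\<tau> k) \<omega> $ j))"
  let ?v = "\<lambda>j. \<Sum>k<n. (c k j)\<^sup>2 * (\<tau> (Suc k) - \<tau> k)"
  have v: "?v j > 0" for j
    by (rule sum_pos) (use n \<tau>(2) in \<open>auto intro!: mult_pos_pos zero_less_power c\<close>)
  have normal: "distributed M lborel (?S j) (normal_density (m $ j) (sqrt (?v j)))" for j
  proof -
    have rb: "real_brownian_motion M (\<lambda>t \<omega>. W t \<omega> $ j)" using bm by (simp add: brownian_motion_def)
    have "indep_vars (\<lambda>_. borel) (\<lambda>i \<omega>. W (\<tau>' (Suc i)) \<omega> $ j - W (\<tau>' i) \<omega> $ j) {..<n}"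
      using rb mono \<tau>'0 by (simp add: real_brownian_motion_def independent_increments_def)
    then have "indep_vars (\<lambda>_. borel) (\<lambda>i \<omega>. c i j * (W (\<tau>' (Suc i)) \<omega> $ j - W (\<tau>' i) \<omega> $ j)) {..<n}"
      by (rule indep_vars_compose2[where Y="\<lambda>i x. c i j * x"]) measurable
    then have ind: "indep_vars (\<lambda>_. borel) (\<lambda>i \<omega>. c i j * (W (\<tau> (Suc i)) \<omega> $ j - W (\<tau> i) \<omega> $ j)) {..<n}"
      by (rule indep_vars_cong[THEN iffD1, rotated -1]) (auto simp: eq)
    have inc: "distributed M lborel (\<lambda>\<omega>. c k j * (W (\<tau> (Suc k)) \<omega> $ j - W (\<tau> k) \<omega> $ j)) (normal_density 0 (c k j * sqrt (\<tau> (Suc k) - \<tau> k)))"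
      if "k \<in> {..<n}" for k
    proof -
      have "distributed M lborel (\<lambda>\<omega>. W (\<tau> (Suc k)) \<omega> $ j - W (\<tau> k) \<omega> $ j) (normal_density 0 (sqrt (\<tau> (Suc k) - \<tau> k)))"
        using rb \<tau>(2)[of k] \<tau>nn[of k] that by (simp add: real_brownian_motion_def)
      from normal_density_affine[OF this, of "c k j" 0] show ?thesis using \<tau>(2)[of k] c[of k j] that by simp
    qed
    have "distributed M lborel (\<lambda>\<omega>. \<Sum>k<n. c k j * (W (\<tau> (Suc k)) \<omega> $ j - W (\<tau> k) \<omega> $ j))
       (normal_density (\<Sum>k<n. 0) (sqrt (\<Sum>k<n. (c k j * sqrt (\<tau> (Suc k) - \<tau> k))\<^sup>2)))"
      by (rule sum_indep_normal[OF _ _ ind _ inc]) (use n c \<tau>(2) in \<open>auto intro!: mult_pos_pos\<close>)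
    also have "(\<Sum>k<n. (c k j * sqrt (\<tau> (Suc k) - \<tau> k))\<^sup>2) = ?v j"
      by (rule sum.cong) (use \<tau>(2) less_imp_le in \<open>auto simp: power_mult_distrib\<close>)
    finally have "distributed M lborel (\<lambda>\<omega>. \<Sum>k<n. c k j * (W (\<tau> (Suc k)) \<omega> $ j - W (\<tau> k) \<omega> $ j))
       (normal_density 0 (sqrt (?v j)))" by simp
    from normal_density_affine[OF this, of 1 "m $ j"] show ?thesis using v[of j] by simp
  qed
  \<comment> \<open>The coordinates are independent as random paths, hence so are these finite
    linear functionals of them.\<close>
  have "indep_vars (\<lambda>_. Pi\<^sub>M {0..} (\<lambda>_. borel)) (\<lambda>i \<omega>. \<lambda>t\<in>{0..}. W t \<omega> $ i) UNIV"
    using bm by (simp add: brownian_motion_def)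
  then have "indep_vars (\<lambda>_. borel) (\<lambda>j \<omega>. (\<lambda>f. m $ j + (\<Sum>k<n. c k j * (f (\<tau> (Suc k)) - f (\<tau> k)))) (\<lambda>t\<in>{0..}. W t \<omega> $ j)) UNIV"
  proof (rule indep_vars_compose2)
    fix j
    have [measurable]: "(\<lambda>f :: real \<Rightarrow> real. f (\<tau> k)) \<in> borel_measurable (Pi\<^sub>M {0..} (\<lambda>_. borel))" if "k \<le> n" for k
      using \<tau>nn[OF that] by (intro measurable_component_singleton) auto
    show "(\<lambda>f. m $ j + (\<Sum>k<n. c k j * (f (\<tau> (Suc k)) - f (\<tau> k)))) \<in> borel_measurable (Pi\<^sub>M {0..} (\<lambda>_. borel))"
      by measurable (use \<tau>nn' in auto)
  qed
  then have ind: "indep_vars (\<lambda>_. borel) ?S UNIV"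
    by (rule indep_vars_cong[THEN iffD1, rotated -1]) (auto simp: \<tau>nn' fun_eq_iff intro!: sum.cong)
  have "distr M borel (\<lambda>\<omega>. \<chi> j. ?S j \<omega>) = gauss m (\<chi> j. sqrt (?v j))"
    by (rule distr_indep_normal_vec[OF ind]) (use normal v in auto)
  then show ?thesis .
qed

lemma process_events_sigma_algebra:
  assumes "\<And>t. t \<ge> 0 \<Longrightarrow> X t \<in> borel_measurable M"
  shows "sigma_algebra (space M) (process_events M X)"
  unfolding process_events_def by (rule sigma_algebra_sigma_sets) auto

text \<open>The list takes countably many values, so the preimage of an arbitrary set of lists is a
  countable union of events of L.\<close>

lemma countable_levels_events:
  fixes F :: "nat \<Rightarrow> real \<Rightarrow> nat"
  assumes F: "\<And>k. F k \<in> borel \<rightarrow>\<^sub>M count_space UNIV" and r: "\<And>k. r k \<ge> 0"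
  shows "(\<lambda>\<omega>. map (\<lambda>k. F k (L (r k) \<omega>)) [0..<n]) -` A \<inter> space M \<in> process_events M L"
proof -
  interpret PE: sigma_algebra "space M" "process_events M L"
    using L_measurable by (rule process_events_sigma_algebra)
  have ev: "{\<omega>\<in>space M. F k (L (r k) \<omega>) = x} \<in> process_events M L" for k x
  proof -
    have "F k -` {x} \<in> sets borel" using measurable_sets[OF F[of k], of "{x}"] by simp
    then have "L (r k) -` (F k -` {x}) \<inter> space M \<in> process_events M L"
      unfolding process_events_def using r[of k] by blast
    moreover have "L (r k) -` (F k -` {x}) \<inter> space M = {\<omega>\<in>space M. F k (L (r k) \<omega>) = x}" by auto
    ultimately show ?thesis by simp
  qed
  have one: "{\<omega>\<in>space M. map (\<lambda>k. F k (L (r k) \<omega>)) [0..<n] = xs} \<in> process_events M L" for xs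
  proof (cases "length xs = n")
    case True
    have "{\<omega>\<in>space M. map (\<lambda>k. F k (L (r k) \<omega>)) [0..<n] = xs} = {\<omega>\<in>space M. \<forall>k\<in>{..<n}. F k (L (r k) \<omega>) = xs ! k}"
      using True by (auto simp: list_eq_iff_nth_eq)
    also have "\<dots> \<in> process_events M L" by (intro PE.sets_Collect_finite_All ev) auto
    finally show ?thesis .
  next
    case False
    then have "{\<omega>\<in>space M. map (\<lambda>k. F k (L (r k) \<omega>)) [0..<n] = xs} = {}" by auto
    then show ?thesis by (simp only: PE.empty_sets)
  qed
  have "(\<lambda>\<omega>. map (\<lambda>k. F k (L (r k) \<omega>)) [0..<n]) -` A \<inter> space M =
     (\<Union>xs\<in>A. {\<omega>\<in>space M. map (\<lambda>k. F k (L (r k) \<omega>)) [0..<n] = xs})" by auto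
  also have "\<dots> \<in> process_events M L" by (intro PE.countable_UN'' one) auto
  finally show ?thesis .
qed

text \<open>Independence of the two families of events becomes a product law for the pair of level
  list and Brownian path, which is the form needed to freeze the list by Fubini.\<close>

lemma levels_independent:
  fixes F :: "nat \<Rightarrow> real \<Rightarrow> nat" and n :: nat
  assumes F: "\<And>k. F k \<in> borel \<rightarrow>\<^sub>M count_space UNIV" and r: "\<And>k. r k \<ge> 0"
  defines "X \<equiv> \<lambda>\<omega>. map (\<lambda>k. F k (L (r k) \<omega>)) [0..<n]" and "Y \<equiv> \<lambda>\<omega>. \<lambda>t\<in>{0..}. W t \<omega>"
    and "S \<equiv> count_space UNIV" and "T \<equiv> Pi\<^sub>M {0..} (\<lambda>_. borel)"
  shows "X \<in> M \<rightarrow>\<^sub>M S" and "Y \<in> M \<rightarrow>\<^sub>M T"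
    and "distr M S X \<Otimes>\<^sub>M distr M T Y = distr M (S \<Otimes>\<^sub>M T) (\<lambda>\<omega>. (X \<omega>, Y \<omega>))"
proof -
  have PL: "process_events M L \<subseteq> events" and PW: "process_events M W \<subseteq> events"
    unfolding process_events_def
    using measurable_sets[OF L_measurable] measurable_sets[OF W_measurable] by (auto intro!: sets.sigma_sets_subset)
  interpret PL: sigma_algebra "space M" "process_events M L"
    using L_measurable by (rule process_events_sigma_algebra)
  interpret PW: sigma_algebra "space M" "process_events M W"
    using W_measurable by (rule process_events_sigma_algebra)
  \<comment> \<open>The path map must be measurable for the events of W themselves, not merely for
    \<open>M\<close>, before independence can be applied to its preimages.\<close>
  let ?MW = "sigma (space M) (process_events M W)"
  have sMW: "sets ?MW = process_events M W" by (simp add: PW.space_closed PW.sigma_sets_eq)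
  have "W t \<in> ?MW \<rightarrow>\<^sub>M borel" if "t \<ge> 0" for t
  proof (rule measurableI)
    fix A :: "(real ^ 'n) set" assume "A \<in> sets borel"
    then have "W t -` A \<inter> space M \<in> process_events M W" unfolding process_events_def using that by blast
    then show "W t -` A \<inter> space ?MW \<in> sets ?MW" by (simp add: sMW space_measure_of PW.space_closed)
  qed simp
  then have Y: "Y \<in> ?MW \<rightarrow>\<^sub>M T" unfolding Y_def T_def by (intro measurable_restrict) auto
  show Xm: "X \<in> M \<rightarrow>\<^sub>M S"
    using countable_levels_events[OF F r] PL unfolding X_def S_def by (intro measurableI) auto
  show Ym: "Y \<in> M \<rightarrow>\<^sub>M T" unfolding Y_def T_def by (intro measurable_restrict W_measurable) auto
  interpret PX: prob_space "distr M S X" by (rule prob_space_distr[OF Xm])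
  interpret PY: prob_space "distr M T Y" by (rule prob_space_distr[OF Ym])
  have ind: "indep_set (process_events M L) (process_events M W)"
    using indep by (simp add: independent_processes_def)
  show "distr M S X \<Otimes>\<^sub>M distr M T Y = distr M (S \<Otimes>\<^sub>M T) (\<lambda>\<omega>. (X \<omega>, Y \<omega>))"
  proof (rule pair_measure_eqI)
    fix A B assume "A \<in> sets (distr M S X)" "B \<in> sets (distr M T Y)"
    then have A: "A \<in> sets S" and B: "B \<in> sets T" by auto
    have EA: "X -` A \<inter> space M \<in> process_events M L"
      unfolding X_def by (rule countable_levels_events[OF F r])
    have EB: "Y -` B \<inter> space M \<in> process_events M W"
      using measurable_sets[OF Y B] by (simp add: sMW space_measure_of PW.space_closed)
    have "(\<lambda>\<omega>. (X \<omega>, Y \<omega>)) -` (A \<times> B) \<inter> space M = (X -` A \<inter> space M) \<inter> (Y -` B \<inter> space M)" by auto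
    then show "emeasure (distr M S X) A * emeasure (distr M T Y) B = emeasure (distr M (S \<Otimes>\<^sub>M T) (\<lambda>\<omega>. (X \<omega>, Y \<omega>))) (A \<times> B)"
      using A B Xm Ym indep_setD[OF ind EA EB]
      by (subst (1 2 3) emeasure_distr) (auto simp: emeasure_eq_measure ennreal_mult')
  qed (auto intro: PX.sigma_finite_measure_axioms PY.sigma_finite_measure_axioms)
qed

text \<open>With the list of levels frozen, the times are deterministic and strictly increasing, so
  the combination is Gaussian; averaging over the list by Fubini gives the mixture.\<close>

lemma conditional_gauss:
  fixes F :: "nat \<Rightarrow> real \<Rightarrow> nat" and c :: "nat \<Rightarrow> 'n \<Rightarrow> real" and m :: "real ^ 'n"
  assumes F: "\<And>k. F k \<in> borel \<rightarrow>\<^sub>M count_space UNIV" and r: "\<And>k. r k \<ge> 0"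
    and incr: "AE \<omega> in M. \<forall>k<n. F k (L (r k) \<omega>) < F (Suc k) (L (r (Suc k)) \<omega>)"
    and n: "n > 0" and \<delta>: "\<delta> > 0" and c: "\<And>k j. c k j > 0" and g: "g \<in> bounded_borel"
  defines "l \<equiv> \<lambda>k \<omega>. \<delta> * real (F k (L (r k) \<omega>))"
  shows "(\<integral>\<omega>. g (\<chi> j. m $ j + (\<Sum>k<n. c k j * (W (l (Suc k) \<omega>) \<omega> $ j - W (l k \<omega>) \<omega> $ j))) \<partial>M) =
    (\<integral>\<omega>. (\<integral>y. g y \<partial>gauss m (posvec (\<chi> j. sqrt (\<Sum>k<n. (c k j)\<^sup>2 * (l (Suc k) \<omega> - l k \<omega>))))) \<partial>M)"
    and "(\<lambda>\<omega>. \<chi> j. m $ j + (\<Sum>k<n. c k j * (W (l (Suc k) \<omega>) \<omega> $ j - W (l k \<omega>) \<omega> $ j))) \<in> borel_measurable M"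
proof -
  define X where "X = (\<lambda>\<omega>. map (\<lambda>k. F k (L (r k) \<omega>)) [0..<Suc n])"
  define Y where "Y = (\<lambda>\<omega>. \<lambda>t\<in>{0..}. W t \<omega>)"
  let ?S = "count_space (UNIV :: nat list set)" and ?T = "Pi\<^sub>M {0..} (\<lambda>_. borel) :: (real \<Rightarrow> real ^ 'n) measure"
  define v where "v xs w = (\<chi> j. m $ j + (\<Sum>k<n. c k j * (w (\<delta> * real (xs ! Suc k)) $ j - w (\<delta> * real (xs ! k)) $ j)))"
    for xs :: "nat list" and w :: "real \<Rightarrow> real ^ 'n"
  have gm [measurable]: "g \<in> borel_measurable borel" using g by (simp add: bounded_borel_def)
  obtain b where b: "\<And>y. \<bar>g y\<bar> \<le> b" using g by (auto simp: bounded_borel_def bounded_iff)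
  note X [measurable] = levels_independent(1)[where n="Suc n" and F=F and r=r, OF F r, folded X_def]
    and Y [measurable] = levels_independent(2)[where F=F and r=r, OF F r, folded Y_def]
  have pair: "distr M ?S X \<Otimes>\<^sub>M distr M ?T Y = distr M (?S \<Otimes>\<^sub>M ?T) (\<lambda>\<omega>. (X \<omega>, Y \<omega>))"
    using levels_independent(3)[where n="Suc n" and F=F and r=r, OF F r] by (simp only: X_def Y_def)
  have vm: "(\<lambda>w. v xs w) \<in> borel_measurable ?T" for xs
  proof -
    have [measurable]: "(\<lambda>w. w (\<delta> * real i)) \<in> borel_measurable ?T" for i
      using \<delta> by (intro measurable_component_singleton) auto
    show ?thesis unfolding v_def by (intro vec_lambda_measurable) measurable
  qed
  \<comment> \<open>Countability of the first factor enters here: evaluating a path at the listed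
    times is jointly measurable because it is so for each fixed list.\<close>
  have vm2 [measurable]: "(\<lambda>p. v (fst p) (snd p)) \<in> borel_measurable (?S \<Otimes>\<^sub>M ?T)"
    by (rule measurable_pair_measure_countable1) (auto intro: vm)
  have ln: "l k \<omega> = \<delta> * real (X \<omega> ! k)" if "k \<le> n" for k \<omega>
    using that by (simp add: l_def X_def del: upt_Suc)
  have l0: "l k \<omega> \<ge> 0" for k \<omega> using \<delta> by (simp add: l_def)
  have veq: "v (X \<omega>) (Y \<omega>) = (\<chi> j. m $ j + (\<Sum>k<n. c k j * (W (l (Suc k) \<omega>) \<omega> $ j - W (l k \<omega>) \<omega> $ j)))" for \<omega>
    unfolding v_def vec_eq_iff by (auto intro!: sum.cong simp: ln[symmetric] Suc_le_eq Y_def l0)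
  have "(\<lambda>\<omega>. v (X \<omega>) (Y \<omega>)) \<in> borel_measurable M"
    using measurable_compose[OF measurable_Pair[OF X Y] vm2] by simp
  then show "(\<lambda>\<omega>. \<chi> j. m $ j + (\<Sum>k<n. c k j * (W (l (Suc k) \<omega>) \<omega> $ j - W (l k \<omega>) \<omega> $ j))) \<in> borel_measurable M"
    by (simp only: veq)
  interpret PX: prob_space "distr M ?S X" by (rule prob_space_distr) measurable
  interpret PY: prob_space "distr M ?T Y" by (rule prob_space_distr) measurable
  interpret P: pair_prob_space "distr M ?S X" "distr M ?T Y" ..
  \<comment> \<open>The conditional expectation, given that the list of levels is
    \<open>xs\<close>.\<close>
  define H where "H xs = (\<integral>\<omega>. g (v xs (Y \<omega>)) \<partial>M)" for xs
  have "(\<integral>\<omega>. g (v (X \<omega>) (Y \<omega>)) \<partial>M) = (\<integral>p. g (v (fst p) (snd p)) \<partial>distr M (?S \<Otimes>\<^sub>M ?T) (\<lambda>\<omega>. (X \<omega>, Y \<omega>)))"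
    by (subst integral_distr) (auto intro!: measurable_Pair X Y)
  also have "\<dots> = (\<integral>p. (case p of (xs, w) \<Rightarrow> g (v xs w)) \<partial>(distr M ?S X \<Otimes>\<^sub>M distr M ?T Y))"
    by (simp add: pair split_def)
  also have "\<dots> = (\<integral>xs. (\<integral>w. g (v xs w) \<partial>distr M ?T Y) \<partial>distr M ?S X)"
  proof -
    have "integrable (distr M ?S X \<Otimes>\<^sub>M distr M ?T Y) (\<lambda>(xs, w). g (v xs w))"
      by (rule P.integrable_const_bound[of _ b]) (use b in \<open>auto simp: split_def cong: measurable_cong_sets\<close>)
    from P.integral_fst'[OF this] show ?thesis by simp
  qed
  also have "\<dots> = (\<integral>xs. H xs \<partial>distr M ?S X)"
    by (rule Bochner_Integration.integral_cong[OF refl]) (auto simp: H_def intro!: integral_distr[OF Y] measurable_compose[OF vm gm])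
  also have "\<dots> = (\<integral>\<omega>. H (X \<omega>) \<partial>M)" by (rule integral_distr[OF X]) simp
  finally have 1: "(\<integral>\<omega>. g (v (X \<omega>) (Y \<omega>)) \<partial>M) = (\<integral>\<omega>. H (X \<omega>) \<partial>M)" .
  have AE: "AE \<omega> in M. H (X \<omega>) = (\<integral>y. g y \<partial>gauss m (posvec (\<chi> j. sqrt (\<Sum>k<n. (c k j)\<^sup>2 * (l (Suc k) \<omega> - l k \<omega>)))))"
    using incr
  proof eventually_elim
    case (elim \<omega>)
    let ?\<tau> = "\<lambda>k. l k \<omega>"
    have inc: "?\<tau> k < ?\<tau> (Suc k)" if "k < n" for k using elim that \<delta> by (simp add: l_def)
    let ?a = "\<chi> j. sqrt (\<Sum>k<n. (c k j)\<^sup>2 * (?\<tau> (Suc k) - ?\<tau> k))"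
    have a: "posvec ?a = ?a"
      by (rule posvec_id) (use n inc in \<open>auto intro!: sum_pos mult_pos_pos zero_less_power c\<close>)
    have "H (X \<omega>) = (\<integral>\<omega>'. g (\<chi> j. m $ j + (\<Sum>k<n. c k j * (W (?\<tau> (Suc k)) \<omega>' $ j - W (?\<tau> k) \<omega>' $ j))) \<partial>M)"
      unfolding H_def v_def
      by (intro Bochner_Integration.integral_cong refl arg_cong[where f=g])
         (auto simp: vec_eq_iff ln[symmetric] Suc_le_eq Y_def l0 intro!: sum.cong)
    also have "\<dots> = (\<integral>y. g y \<partial>distr M borel (\<lambda>\<omega>'. \<chi> j. m $ j + (\<Sum>k<n. c k j * (W (?\<tau> (Suc k)) \<omega>' $ j - W (?\<tau> k) \<omega>' $ j))))"
    proof (rule integral_distr[symmetric])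
      have [measurable]: "(\<lambda>\<omega>'. W (?\<tau> k) \<omega>') \<in> borel_measurable M" for k using W_measurable[OF l0] .
      show "(\<lambda>\<omega>'. \<chi> j. m $ j + (\<Sum>k<n. c k j * (W (?\<tau> (Suc k)) \<omega>' $ j - W (?\<tau> k) \<omega>' $ j))) \<in> borel_measurable M"
        by (intro vec_lambda_measurable) measurable
    qed simp
    also have "distr M borel (\<lambda>\<omega>'. \<chi> j. m $ j + (\<Sum>k<n. c k j * (W (?\<tau> (Suc k)) \<omega>' $ j - W (?\<tau> k) \<omega>' $ j))) = gauss m ?a"
      by (rule distr_linear_combination[where \<tau>="?\<tau>" and c=c and m=m and n=n, OF n l0 inc c])
    finally show ?case using a by simp
  qed
  have "(\<integral>\<omega>. H (X \<omega>) \<partial>M) = (\<integral>\<omega>. (\<integral>y. g y \<partial>gauss m (posvec (\<chi> j. sqrt (\<Sum>k<n. (c k j)\<^sup>2 * (l (Suc k) \<omega> - l k \<omega>))))) \<partial>M)"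
  proof (rule integral_cong_AE[OF _ _ AE])
    show "(\<lambda>\<omega>. H (X \<omega>)) \<in> borel_measurable M" by (rule measurable_compose[OF X]) simp
    have lm [measurable]: "l k \<in> borel_measurable M" for k
      unfolding l_def using measurable_compose[OF measurable_compose[OF L_measurable[OF r] F[of k]], of real borel] by simp
    show "(\<lambda>\<omega>. \<integral>y. g y \<partial>gauss m (posvec (\<chi> j. sqrt (\<Sum>k<n. (c k j)\<^sup>2 * (l (Suc k) \<omega> - l k \<omega>))))) \<in> borel_measurable M"
      by (rule integral_gauss_measurable[OF g measurable_const measurable_compose[OF vec_lambda_measurable posvec_measurable] posvec_pos]) (auto)
  qed
  with 1 show "(\<integral>\<omega>. g (\<chi> j. m $ j + (\<Sum>k<n. c k j * (W (l (Suc k) \<omega>) \<omega> $ j - W (l k \<omega>) \<omega> $ j))) \<partial>M) =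
    (\<integral>\<omega>. (\<integral>y. g y \<partial>gauss m (posvec (\<chi> j. sqrt (\<Sum>k<n. (c k j)\<^sup>2 * (l (Suc k) \<omega> - l k \<omega>))))) \<partial>M)"
    by (simp only: veq)
qed

end

text \<open>The indicator of a closed set is the pointwise limit of the continuous functions max 0
  (1 - n dist), and closed sets form a generator stable under intersection.\<close>

lemma finite_measure_eqI_continuous:
  fixes \<mu> \<nu> :: "'a::{metric_space, second_countable_topology} measure"
  assumes "finite_measure \<mu>" "finite_measure \<nu>" and sets: "sets \<mu> = sets borel" "sets \<nu> = sets borel"
    and eq: "\<And>g :: 'a \<Rightarrow> real. continuous_on UNIV g \<Longrightarrow> (\<And>x. 0 \<le> g x \<and> g x \<le> 1) \<Longrightarrow> (\<integral>x. g x \<partial>\<mu>) = (\<integral>x. g x \<partial>\<nu>)"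
  shows "\<mu> = \<nu>"
proof -
  interpret \<mu>: finite_measure \<mu> by fact
  interpret \<nu>: finite_measure \<nu> by fact
  have lim: "(\<lambda>n. \<integral>x. max 0 (1 - real n * infdist x F) \<partial>\<rho>) \<longlonglongrightarrow> measure \<rho> F"
    if \<rho>: "finite_measure \<rho>" "sets \<rho> = sets borel" and F: "closed F" "F \<noteq> {}" for F and \<rho> :: "'a measure"
  proof -
    interpret finite_measure \<rho> by fact
    have [measurable]: "(\<lambda>x. infdist x F) \<in> borel_measurable \<rho>"
      unfolding measurable_cong_sets[OF \<rho>(2) refl] by (intro borel_measurable_continuous_onI continuous_intros)
    have Fm: "F \<in> sets \<rho>" using F \<rho> by simp
    have "(\<lambda>n. \<integral>x. max 0 (1 - real n * infdist x F) \<partial>\<rho>) \<longlonglongrightarrow> (\<integral>x. indicator F x \<partial>\<rho>)"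
    proof (rule integral_dominated_convergence[where w="\<lambda>_. 1"])
      show "AE x in \<rho>. (\<lambda>n. max 0 (1 - real n * infdist x F)) \<longlonglongrightarrow> (indicator F x :: real)"
      proof (rule AE_I2)
        fix x
        show "(\<lambda>n. max 0 (1 - real n * infdist x F)) \<longlonglongrightarrow> (indicator F x :: real)"
        proof (cases "x \<in> F")
          case False
          then have d: "infdist x F > 0" using F by (simp add: infdist_pos_not_in_closed)
          have "eventually (\<lambda>n. max 0 (1 - real n * infdist x F) = 0) sequentially"
          proof (rule eventually_sequentiallyI[of "nat \<lceil>1 / infdist x F\<rceil>"])
            fix n assume "nat \<lceil>1 / infdist x F\<rceil> \<le> n"
            then have "1 / infdist x F \<le> real n" by linarith
            then show "max 0 (1 - real n * infdist x F) = 0" using d by (simp add: field_simps)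
          qed
          then show ?thesis using False by (auto intro: tendsto_eventually)
        qed simp
      qed
      show "AE x in \<rho>. norm (max 0 (1 - real n * infdist x F)) \<le> 1" for n
        by (rule AE_I2) (auto simp: infdist_nonneg)
    qed (use Fm in auto)
    then show ?thesis using Fm by simp
  qed
  have meq: "emeasure \<mu> F = emeasure \<nu> F" if "closed F" for F
  \<comment> \<open>The distance to the empty set is 0 by convention, so the approximation would
    return the total mass there.\<close>
  proof (cases "F = {}")
    case False
    have "(\<integral>x. max 0 (1 - real n * infdist x F) \<partial>\<mu>) = (\<integral>x. max 0 (1 - real n * infdist x F) \<partial>\<nu>)" for n
      by (rule eq) (auto intro!: continuous_intros simp: infdist_nonneg)
    with lim[OF assms(1) sets(1) that False] lim[OF assms(2) sets(2) that False]
    have "measure \<mu> F = measure \<nu> F" using LIMSEQ_unique by auto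
    then show ?thesis by (simp add: \<mu>.emeasure_eq_measure \<nu>.emeasure_eq_measure)
  qed simp
  show ?thesis
  proof (rule measure_eqI_generator_eq[where E="Collect closed" and \<Omega>=UNIV and A="\<lambda>_. UNIV"])
    show "Int_stable (Collect closed :: 'a set set)" by (auto simp: Int_stable_def)
    show "sets \<mu> = sigma_sets UNIV (Collect closed)" "sets \<nu> = sigma_sets UNIV (Collect closed)"
      by (simp_all add: sets borel_eq_closed)
  qed (use meq in auto)
qed

text \<open>The random time \<open>L\<close> is replaced by countably many levels, so that conditioning on it is a
  countable sum; the summand \<open>k + 1\<close> makes the levels strictly increasing along the grid, which keeps
  all Gaussian variances positive.\<close>

definition level_index :: "nat \<Rightarrow> nat \<Rightarrow> real \<Rightarrow> nat" where
  "level_index n k x = nat \<lfloor>(real (Suc n))\<^sup>2 * x\<rfloor> + k + 1"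

text \<open>The spacing is the inverse square of \<open>Suc n\<close> because the shift k + 1 in the
  index can reach n + 2; the total error is then still at most 2 / \<open>Suc n\<close>.\<close>

definition level :: "nat \<Rightarrow> nat \<Rightarrow> real \<Rightarrow> real" where
  "level n k x = (1 / (real (Suc n))\<^sup>2) * real (level_index n k x)"

lemma level_nonneg: "level n k x \<ge> 0"
  by (simp add: level_def)

lemma level_bounds:
  assumes "x \<ge> 0" "k \<le> Suc n"
  shows "x \<le> level n k x" "level n k x \<le> x + 2 / real (Suc n)"
proof -
  define N where "N = real (Suc n)"
  have N: "N \<ge> 1" by (simp add: N_def)
  have "level_index n k x = nat \<lfloor>N\<^sup>2 * x\<rfloor> + k + 1" by (simp add: level_index_def N_def)
  then have r: "real (level_index n k x) = real_of_int \<lfloor>N\<^sup>2 * x\<rfloor> + real k + 1" using assms by simp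
  have l: "level n k x = real (level_index n k x) / N\<^sup>2" by (simp add: level_def N_def)
  have "N\<^sup>2 * x \<le> real (level_index n k x)" unfolding r by linarith
  then show "x \<le> level n k x" using N by (simp add: l field_simps)
  have "real k + 1 \<le> 2 * N" using assms(2) by (simp add: N_def)
  then have "real (level_index n k x) \<le> N\<^sup>2 * x + 2 * N" unfolding r by linarith
  then have "level n k x \<le> (N\<^sup>2 * x + 2 * N) / N\<^sup>2" unfolding l by (intro divide_right_mono) auto
  also have "\<dots> = x + 2 / N" using N by (simp add: field_simps power2_eq_square)
  finally show "level n k x \<le> x + 2 / real (Suc n)" by (simp add: N_def)
qed

lemma level_tendsto:
  assumes "X \<longlonglongrightarrow> x" "\<And>n. X n \<ge> 0" "\<And>n. k n \<le> Suc n"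
  shows "(\<lambda>n. level n (k n) (X n)) \<longlonglongrightarrow> x"
proof -
  have "(\<lambda>n. X n + 2 * inverse (real (Suc n))) \<longlonglongrightarrow> x + 2 * 0"
    by (intro tendsto_intros assms(1) LIMSEQ_inverse_real_of_nat)
  then have u: "(\<lambda>n. X n + 2 / real (Suc n)) \<longlonglongrightarrow> x" by (simp add: divide_inverse)
  show ?thesis
    by (rule tendsto_sandwich[OF _ _ assms(1) u]) (use level_bounds assms in \<open>auto intro!: always_eventually\<close>)
qed

text \<open>The composed path may jump, but \<beta> is continuous and a monotone \<xi> has only
  countably many discontinuities. Almost every interior time is therefore a continuity point, and at
  the two endpoints the grid hits the exact value.\<close>

lemma time_changed_path:
  fixes \<beta> \<xi> :: "real \<Rightarrow> real"
  assumes mono: "mono_on {0..} \<xi>" and nn: "\<And>q. q \<ge> 0 \<Longrightarrow> \<xi> q \<ge> 0" and \<beta>: "continuous_on {0..} \<beta>"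
    and st: "0 \<le> s" "s < t"
  shows "(\<lambda>n. \<Sum>k<Suc n. exp (- c * (t - grid s t n k)) *
        (\<beta> (level n (Suc k) (\<xi> (grid s t n (Suc k)))) - \<beta> (level n k (\<xi> (grid s t n k))))) \<longlonglongrightarrow>
     \<beta> (\<xi> t) - exp (- c * (t - s)) * \<beta> (\<xi> s) - (LINT q:{s..t}|lborel. c * exp (- c * (t - q)) * \<beta> (\<xi> q))"
    and "set_integrable lborel {s..t} (\<lambda>q. \<beta> (\<xi> q))"
proof -
  define L' where "L' q = \<xi> (max 0 q)" for q
  define B where "B q = \<beta> (max 0 q)" for q
  define y where "y q = B (L' q)" for q
  have yq: "y q = \<beta> (\<xi> q)" if "q \<ge> 0" for q using that nn by (simp add: y_def B_def L'_def)
  have mL: "mono L'" using mono by (auto simp: mono_def L'_def mono_on_def)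
  have cB: "continuous_on UNIV B" unfolding B_def
    by (rule continuous_on_compose2[OF \<beta>]) (auto intro!: continuous_intros)
  have [measurable]: "L' \<in> borel_measurable borel" using mL by (rule borel_measurable_mono)
  have [measurable]: "B \<in> borel_measurable borel" using cB by (rule borel_measurable_continuous_onI)
  have ym: "y \<in> borel_measurable borel" unfolding y_def[abs_def] by measurable
  have tb: "\<xi> q \<le> \<xi> t" if "0 \<le> q" "q \<le> t" for q using mono that by (auto simp: mono_on_def)
  \<comment> \<open>The 2 is room for the levels, which exceed the true value by at most 2 /
    \<open>Suc n\<close>.\<close>
  have "bounded (\<beta> ` {0..\<xi> t + 2})"
    by (intro compact_imp_bounded compact_continuous_image continuous_on_subset[OF \<beta>]) auto
  then obtain K where "\<forall>y\<in>\<beta> ` {0..\<xi> t + 2}. norm y \<le> K" unfolding bounded_iff by blast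
  then have K: "\<bar>\<beta> x\<bar> \<le> K" if "x \<in> {0..\<xi> t + 2}" for x using that by simp
  show "set_integrable lborel {s..t} (\<lambda>q. \<beta> (\<xi> q))"
  proof -
    have "integrable lborel (\<lambda>q. indicator {s..t} q *\<^sub>R y q)"
    proof (rule Bochner_Integration.integrable_bound)
      show "integrable lborel (\<lambda>q. K * indicator {s..t} q :: real)"
        by (intro integrable_mult_right integrable_real_indicator) (auto simp: emeasure_lborel_Icc_eq)
      show "AE q in lborel. norm (indicator {s..t} q *\<^sub>R y q) \<le> norm (K * indicator {s..t} q :: real)"
      proof (rule AE_I2)
        fix q
        show "norm (indicator {s..t} q *\<^sub>R y q) \<le> norm (K * indicator {s..t} q :: real)"
        proof (cases "q \<in> {s..t}")
          case True
          then have "\<bar>\<beta> (\<xi> q)\<bar> \<le> K" using st nn[of q] tb[of q] by (intro K) auto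
          then show ?thesis using True st by (simp add: yq)
        qed simp
      qed
    qed (use ym in measurable)
    moreover have "(\<lambda>q. indicator {s..t} q *\<^sub>R y q) = (\<lambda>q. indicator {s..t} q *\<^sub>R \<beta> (\<xi> q))"
      using st yq by (auto simp: fun_eq_iff indicator_def)
    ultimately show ?thesis by (simp add: set_integrable_def)
  qed
  have gnn: "grid s t n k \<ge> 0" for n k using st by (simp add: grid_def)
  have Blim: "(\<lambda>n. \<beta> (X n)) \<longlonglongrightarrow> \<beta> x" if "X \<longlonglongrightarrow> x" "x \<ge> 0" "\<And>n. X n \<ge> 0" for X x
    by (rule continuous_on_tendsto_compose[OF \<beta> that(1)]) (use that in auto)
  have "(\<lambda>n. \<Sum>k<Suc n. exp (- c * (t - grid s t n k)) *
        (\<beta> (level n (Suc k) (\<xi> (grid s t n (Suc k)))) - \<beta> (level n k (\<xi> (grid s t n k))))) \<longlonglongrightarrow>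
     y t - exp (- c * (t - s)) * y s - (LINT q:{s..t}|lborel. c * exp (- c * (t - q)) * y q)"
  proof (rule stieltjes_sum_tendsto[where K=K, OF st(2) ym])
    show "(\<lambda>n. \<beta> (level n 0 (\<xi> (grid s t n 0)))) \<longlonglongrightarrow> y s"
      using st by (auto simp: yq intro!: Blim level_tendsto level_nonneg nn)
    show "(\<lambda>n. \<beta> (level n (Suc n) (\<xi> (grid s t n (Suc n))))) \<longlonglongrightarrow> y t"
      using st by (auto simp: yq intro!: Blim level_tendsto[where k=Suc] level_nonneg nn)
    have "AE q in lborel. isCont L' q"
    proof (rule AE_I')
      show "{q. \<not> isCont L' q} \<in> null_sets lborel"
        using mono_ctble_discont[OF mL] by (rule countable_imp_null_set_lborel)
    qed auto
    then show "AE q in lborel. s < q \<longrightarrow> q < t \<longrightarrow> (\<forall>k. (\<forall>n. k n \<le> Suc n) \<longrightarrow>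
        (\<lambda>n. grid s t n (k n)) \<longlonglongrightarrow> q \<longrightarrow> (\<lambda>n. \<beta> (level n (k n) (\<xi> (grid s t n (k n))))) \<longlonglongrightarrow> y q)"
    proof (eventually_elim, intro impI allI)
      fix q k assume q: "isCont L' q" "s < q" "q < t" and k: "\<forall>n. k n \<le> Suc n" and g: "(\<lambda>n. grid s t n (k n)) \<longlonglongrightarrow> q"
      have "(\<lambda>n. L' (grid s t n (k n))) \<longlonglongrightarrow> L' q" by (rule isCont_tendsto_compose[OF q(1) g])
      then have "(\<lambda>n. \<xi> (grid s t n (k n))) \<longlonglongrightarrow> \<xi> q" using q st gnn by (simp add: L'_def)
      then show "(\<lambda>n. \<beta> (level n (k n) (\<xi> (grid s t n (k n))))) \<longlonglongrightarrow> y q"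
        using q st k gnn by (auto simp: yq intro!: Blim level_tendsto level_nonneg nn)
    qed
    show "\<bar>\<beta> (level n k (\<xi> (grid s t n k)))\<bar> \<le> K" if "k \<le> Suc n" for n k
    proof (rule K)
      have "\<xi> (grid s t n k) \<le> \<xi> t" using tb[of "grid s t n k"] gnn grid_bounds[of s t k n] st that by auto
      moreover have "2 / real (Suc n) \<le> 2" by (simp add: divide_simps)
      ultimately show "level n k (\<xi> (grid s t n k)) \<in> {0..\<xi> t + 2}"
        using level_bounds(2)[OF nn[OF gnn] that] level_nonneg by auto (smt (verit))
    qed
  qed
  moreover have "(LINT q:{s..t}|lborel. c * exp (- c * (t - q)) * y q) = (LINT q:{s..t}|lborel. c * exp (- c * (t - q)) * \<beta> (\<xi> q))"
    by (rule set_lebesgue_integral_cong) (use st yq in auto)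
  ultimately show "(\<lambda>n. \<Sum>k<Suc n. exp (- c * (t - grid s t n k)) *
        (\<beta> (level n (Suc k) (\<xi> (grid s t n (Suc k)))) - \<beta> (level n k (\<xi> (grid s t n k))))) \<longlonglongrightarrow>
     \<beta> (\<xi> t) - exp (- c * (t - s)) * \<beta> (\<xi> s) - (LINT q:{s..t}|lborel. c * exp (- c * (t - q)) * \<beta> (\<xi> q))"
    using st yq by simp
qed

section \<open>The law of the noise as a mixture of Gaussians\<close>

context subordinated_bm
begin

text \<open>The Stieltjes integral of exp (-c (t - q)) against dL over {s..t}, written after
  integration by parts so that only a Lebesgue integral of the path remains.\<close>

definition clock :: "real \<Rightarrow> real \<Rightarrow> real \<Rightarrow> 'w \<Rightarrow> real" where
  "clock c s t \<omega> = L t \<omega> - exp (- c * (t - s)) * L s \<omega> - (LINT q:{s..t}|lborel. c * exp (- c * (t - q)) * L q \<omega>)"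

text \<open>The same expression with coordinate \<open>j\<close> of W_L in place of L. Given L, its
  variance is the \<open>clock\<close> with rate \<open>2 * c\<close>, since variances carry the
  square of the weight.\<close>

definition noise :: "'n \<Rightarrow> real \<Rightarrow> real \<Rightarrow> real \<Rightarrow> 'w \<Rightarrow> real" where
  "noise j c s t \<omega> = W (L t \<omega>) \<omega> $ j - exp (- c * (t - s)) * W (L s \<omega>) \<omega> $ j -
     (LINT q:{s..t}|lborel. c * exp (- c * (t - q)) * W (L q \<omega>) \<omega> $ j)"

definition clock_sum :: "nat \<Rightarrow> real \<Rightarrow> real \<Rightarrow> real \<Rightarrow> 'w \<Rightarrow> real" where
  "clock_sum n c s t \<omega> = (\<Sum>k<Suc n. exp (- c * (t - grid s t n k)) *
        (level n (Suc k) (L (grid s t n (Suc k)) \<omega>) - level n k (L (grid s t n k) \<omega>)))"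

lemma grid_nonneg: "0 \<le> s \<Longrightarrow> s < t \<Longrightarrow> grid s t n k \<ge> 0"
  by (simp add: grid_def)

lemma level_measurable [measurable]: "level n k \<in> borel_measurable borel" "level_index n k \<in> borel \<rightarrow>\<^sub>M count_space UNIV"
proof -
  show *: "level_index n k \<in> borel \<rightarrow>\<^sub>M count_space UNIV" unfolding level_index_def by measurable
  show "level n k \<in> borel_measurable borel"
    unfolding level_def using measurable_compose[OF *, of real borel] by simp
qed

lemma clock_sum_measurable:
  assumes "0 \<le> s" "s < t"
  shows "clock_sum n c s t \<in> borel_measurable M"
proof -
  have [measurable]: "L (grid s t n k) \<in> borel_measurable M" for k using grid_nonneg[OF assms] by (rule L_measurable)
  show ?thesis unfolding clock_sum_def by measurable
qed

lemma clock_sum_tendsto: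
  assumes "0 \<le> s" "s < t"
  shows "AE \<omega> in M. \<forall>c. (\<lambda>n. clock_sum n c s t \<omega>) \<longlonglongrightarrow> clock c s t \<omega>"
  using L_mono L_nonneg
proof eventually_elim
  case (elim \<omega>)
  show ?case
  proof
    fix c
    show "(\<lambda>n. clock_sum n c s t \<omega>) \<longlonglongrightarrow> clock c s t \<omega>"
      using time_changed_path(1)[OF elim(1) _ continuous_on_id assms, of c] elim(2)
      by (simp add: clock_sum_def clock_def del: sum.lessThan_Suc)
  qed
qed

text \<open>The sums along the levels are measurable and converge to the clock almost surely;
  completeness transfers measurability to the pathwise integral.\<close>

lemma clock_measurable:
  assumes "0 \<le> s" "s < t"
  shows "clock c s t \<in> borel_measurable M"
proof (rule complete_measure.borel_measurable_AE_eq[OF complete])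
  have [measurable]: "clock_sum n c s t \<in> borel_measurable M" for n by (rule clock_sum_measurable[OF assms])
  show "(\<lambda>\<omega>. lim (\<lambda>n. clock_sum n c s t \<omega>)) \<in> borel_measurable M"
    by (rule borel_measurable_lim_metric) measurable
  show "AE \<omega> in M. clock c s t \<omega> = lim (\<lambda>n. clock_sum n c s t \<omega>)"
    using clock_sum_tendsto[OF assms] by eventually_elim (auto intro: limI[symmetric])
qed simp

text \<open>Replace L q by the larger L t under the integral; the weight integrates to 1 - exp (-c
  (t - s)), and what remains is the discounted increment.\<close>

lemma clock_lower_bound:
  assumes "0 \<le> s" "s < t" "c \<ge> 0"
  shows "AE \<omega> in M. exp (- c * (t - s)) * (L t \<omega> - L s \<omega>) \<le> clock c s t \<omega>"
  using L_mono L_nonneg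
proof eventually_elim
  case (elim \<omega>)
  have i: "set_integrable lborel {s..t} (\<lambda>q. L q \<omega>)"
    using time_changed_path(2)[OF elim(1) _ continuous_on_id assms(1,2)] elim(2) by simp
  have e: "set_integrable lborel {s..t} (\<lambda>q. c * exp (- c * (t - q)) * L t \<omega>)"
    using set_integrable_mult_left[OF integral_exp_weight(1)[of s t c t]] assms by simp
  have "(LINT q:{s..t}|lborel. c * exp (- c * (t - q)) * L q \<omega>) \<le> (LINT q:{s..t}|lborel. c * exp (- c * (t - q)) * L t \<omega>)"
  proof (rule set_integral_mono[OF _ e])
    have "set_integrable lborel {s..t} (\<lambda>q. c * (exp (- c * (t - q)) * L q \<omega>))"
      using exp_weight_fubini(2)[OF _ i] assms by (intro set_integrable_mult_right) auto
    then show "set_integrable lborel {s..t} (\<lambda>q. c * exp (- c * (t - q)) * L q \<omega>)" by (simp add: mult.assoc)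
    show "c * exp (- c * (t - q)) * L q \<omega> \<le> c * exp (- c * (t - q)) * L t \<omega>" if "q \<in> {s..t}" for q
      using elim(1) that assms by (intro mult_left_mono) (auto simp: mono_on_def)
  qed
  also have "\<dots> = (1 - exp (- c * (t - s))) * L t \<omega>"
    using integral_exp_weight(2)[of s t c t] assms
    by (simp only: set_lebesgue_integral_def scaleR_conv_of_real mult.assoc[symmetric] integral_mult_left_zero) simp
  finally show ?case by (simp add: clock_def algebra_simps)
qed

lemma clock_pos:
  assumes "0 \<le> s" "s < t" "c \<ge> 0"
  shows "AE \<omega> in M. 0 < clock c s t \<omega>"
  using clock_lower_bound[OF assms] increment_pos[OF assms(1,2)]
proof eventually_elim
  case (elim \<omega>)
  then have "0 < exp (- c * (t - s)) * (L t \<omega> - L s \<omega>)" by simp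
  then show ?case using elim(1) by linarith
qed

lemma noise_sum_tendsto:
  assumes "0 \<le> s" "s < t"
  shows "AE \<omega> in M. \<forall>j c. (\<lambda>n. \<Sum>k<Suc n. exp (- c * (t - grid s t n k)) *
        (W (level n (Suc k) (L (grid s t n (Suc k)) \<omega>)) \<omega> $ j - W (level n k (L (grid s t n k) \<omega>)) \<omega> $ j))
      \<longlonglongrightarrow> noise j c s t \<omega>"
    and "AE \<omega> in M. \<forall>j. set_integrable lborel {s..t} (\<lambda>q. W (L q \<omega>) \<omega> $ j)"
proof -
  show "AE \<omega> in M. \<forall>j c. (\<lambda>n. \<Sum>k<Suc n. exp (- c * (t - grid s t n k)) *
        (W (level n (Suc k) (L (grid s t n (Suc k)) \<omega>)) \<omega> $ j - W (level n k (L (grid s t n k) \<omega>)) \<omega> $ j))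
      \<longlonglongrightarrow> noise j c s t \<omega>"
    using L_mono L_nonneg W_continuous
  proof (eventually_elim, intro allI)
    fix \<omega> j c
    assume "mono_on {0..} (\<lambda>t. L t \<omega>)" "\<forall>t\<ge>0. 0 \<le> L t \<omega>" "\<forall>j. continuous_on {0..} (\<lambda>t. W t \<omega> $ j)"
    then show "(\<lambda>n. \<Sum>k<Suc n. exp (- c * (t - grid s t n k)) *
        (W (level n (Suc k) (L (grid s t n (Suc k)) \<omega>)) \<omega> $ j - W (level n k (L (grid s t n k) \<omega>)) \<omega> $ j))
      \<longlonglongrightarrow> noise j c s t \<omega>"
      unfolding noise_def by (intro time_changed_path(1)[where \<beta>="\<lambda>x. W x \<omega> $ j"] assms) auto
  qed
  show "AE \<omega> in M. \<forall>j. set_integrable lborel {s..t} (\<lambda>q. W (L q \<omega>) \<omega> $ j)"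
    using L_mono L_nonneg W_continuous
  proof (eventually_elim, intro allI)
    fix \<omega> j
    assume "mono_on {0..} (\<lambda>t. L t \<omega>)" "\<forall>t\<ge>0. 0 \<le> L t \<omega>" "\<forall>j. continuous_on {0..} (\<lambda>t. W t \<omega> $ j)"
    then show "set_integrable lborel {s..t} (\<lambda>q. W (L q \<omega>) \<omega> $ j)"
      by (intro time_changed_path(2)[where \<beta>="\<lambda>x. W x \<omega> $ j"] assms) auto
  qed
qed

text \<open>The standard deviations of the noise components, multiplied by \<sigma>, given
  L.\<close>

definition scale :: "('n \<Rightarrow> real) \<Rightarrow> ('n \<Rightarrow> real) \<Rightarrow> real \<Rightarrow> real \<Rightarrow> 'w \<Rightarrow> real ^ 'n" where
  "scale lam \<sigma> s t \<omega> = posvec (\<chi> j. sqrt ((\<sigma> j)\<^sup>2 * clock (2 * lam j) s t \<omega>))"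

lemma scale_measurable:
  assumes "0 \<le> s" "s < t"
  shows "scale lam \<sigma> s t \<in> borel_measurable M"
  unfolding scale_def[abs_def]
  using clock_measurable[OF assms]
  by (intro measurable_compose[OF vec_lambda_measurable posvec_measurable]) measurable

text \<open>The limit of the discretised identity. On the left the sums converge only pointwise to
  the noise, which is why \<open>g\<close> has to be continuous; on the right the Gaussian
  parameters converge.\<close>

lemma integral_mixture_continuous:
  fixes m :: "real ^ 'n" and lam \<sigma> :: "'n \<Rightarrow> real"
  assumes st: "0 \<le> s" "s < t" and lam: "\<And>j. lam j > 0" and \<sigma>: "\<And>j. \<sigma> j > 0"
    and Z: "X \<in> borel_measurable M" "AE \<omega> in M. X \<omega> = (\<chi> j. m $ j + \<sigma> j * noise j (lam j) s t \<omega>)"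
    and g: "g \<in> bounded_borel" "continuous_on UNIV g"
  shows "(\<integral>\<omega>. g (X \<omega>) \<partial>M) = (\<integral>\<omega>. (\<integral>y. g y \<partial>gauss m (scale lam \<sigma> s t \<omega>)) \<partial>M)"
proof -
  have gm [measurable]: "g \<in> borel_measurable borel" using g by (simp add: bounded_borel_def)
  obtain b where b: "\<And>y. \<bar>g y\<bar> \<le> b" using g by (auto simp: bounded_borel_def bounded_iff)
  let ?c = "\<lambda>n k j. exp (- lam j * (t - grid s t n k)) * \<sigma> j"
  let ?l = "\<lambda>n k \<omega>. level n k (L (grid s t n k) \<omega>)"
  let ?S = "\<lambda>n \<omega>. \<chi> j. m $ j + (\<Sum>k<Suc n. ?c n k j * (W (?l n (Suc k) \<omega>) \<omega> $ j - W (?l n k \<omega>) \<omega> $ j))"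
  let ?v = "\<lambda>n \<omega>. \<chi> j. sqrt (\<Sum>k<Suc n. (?c n k j)\<^sup>2 * (?l n (Suc k) \<omega> - ?l n k \<omega>))"
  \<comment> \<open>Squaring the coefficients doubles the rate of the exponential weight, so the
    discrete variance is a clock sum with rate \<open>2 * lam j\<close>.\<close>
  have v: "?v n \<omega> = (\<chi> j. sqrt ((\<sigma> j)\<^sup>2 * clock_sum n (2 * lam j) s t \<omega>))" for n \<omega>
  proof -
    have "(?c n k j)\<^sup>2 = (\<sigma> j)\<^sup>2 * exp (- (2 * lam j) * (t - grid s t n k))" for k j
      by (simp add: power_mult_distrib exp_double[symmetric] algebra_simps)
    then show ?thesis by (simp add: clock_sum_def sum_distrib_left mult.assoc del: sum.lessThan_Suc)
  qed
  have incr: "AE \<omega> in M. \<forall>k<Suc n. level_index n k (L (grid s t n k) \<omega>) < level_index n (Suc k) (L (grid s t n (Suc k)) \<omega>)" for n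
    using L_mono
  proof (eventually_elim, intro allI impI)
    fix \<omega> k assume "mono_on {0..} (\<lambda>t. L t \<omega>)"
    then have "L (grid s t n k) \<omega> \<le> L (grid s t n (Suc k)) \<omega>"
      using grid_nonneg[OF st] grid_mono[of s t k "Suc k" n] st by (auto simp: mono_on_def)
    then have "(real (Suc n))\<^sup>2 * L (grid s t n k) \<omega> \<le> (real (Suc n))\<^sup>2 * L (grid s t n (Suc k)) \<omega>"
      by (intro mult_left_mono) auto
    then show "level_index n k (L (grid s t n k) \<omega>) < level_index n (Suc k) (L (grid s t n (Suc k)) \<omega>)"
      unfolding level_index_def by (intro add_strict_right_mono add_le_less_mono nat_mono floor_mono) simp_all
  qed
  have cpos: "?c n k j > 0" for n k j using \<sigma> by simp
  note cg = conditional_gauss[where F="level_index n" and r="grid s t n" and n="Suc n" and \<delta>="1 / (real (Suc n))\<^sup>2"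
      and c="?c n" and m=m and g=g for n, folded level_def, OF level_measurable(2) grid_nonneg[OF st] incr _ _ cpos g(1)]
  have eq: "(\<integral>\<omega>. g (?S n \<omega>) \<partial>M) = (\<integral>\<omega>. (\<integral>y. g y \<partial>gauss m (posvec (?v n \<omega>))) \<partial>M)" for n
    by (rule cg(1)) auto
  have Sm [measurable]: "?S n \<in> borel_measurable M" for n by (rule cg(2)) auto
  have lim1: "(\<lambda>n. \<integral>\<omega>. g (?S n \<omega>) \<partial>M) \<longlonglongrightarrow> (\<integral>\<omega>. g (X \<omega>) \<partial>M)"
  proof (rule integral_dominated_convergence[where w="\<lambda>_. b"])
    show "AE \<omega> in M. (\<lambda>n. g (?S n \<omega>)) \<longlonglongrightarrow> g (X \<omega>)"
      using Z(2) noise_sum_tendsto(1)[OF st]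
    proof eventually_elim
      case (elim \<omega>)
      have "(\<lambda>n. ?S n \<omega>) \<longlonglongrightarrow> X \<omega>"
        unfolding elim(1)
      proof (intro tendsto_vec_lambda tendsto_add tendsto_const)
        fix j
        have "(\<lambda>n. \<sigma> j * (\<Sum>k<Suc n. exp (- lam j * (t - grid s t n k)) *
          (W (?l n (Suc k) \<omega>) \<omega> $ j - W (?l n k \<omega>) \<omega> $ j))) \<longlonglongrightarrow> \<sigma> j * noise j (lam j) s t \<omega>"
          using elim(2) by (intro tendsto_mult tendsto_const) blast
        then show "(\<lambda>n. \<Sum>k<Suc n. ?c n k j * (W (?l n (Suc k) \<omega>) \<omega> $ j - W (?l n k \<omega>) \<omega> $ j)) \<longlonglongrightarrow> \<sigma> j * noise j (lam j) s t \<omega>"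
          by (simp add: sum_distrib_left mult_ac del: sum.lessThan_Suc)
      qed
      then show ?case by (rule continuous_on_tendsto_compose[OF g(2)]) auto
    qed
    show "(\<lambda>\<omega>. g (X \<omega>)) \<in> borel_measurable M" by (rule measurable_compose[OF Z(1) gm])
    show "(\<lambda>\<omega>. g (?S n \<omega>)) \<in> borel_measurable M" for n by (rule measurable_compose[OF Sm gm])
    show "AE \<omega> in M. norm (g (?S n \<omega>)) \<le> b" for n by (rule AE_I2) (simp only: real_norm_def b)
  qed simp
  have clm [measurable]: "clock_sum n c s t \<in> borel_measurable M" for n c by (rule clock_sum_measurable[OF st])
  have lim2: "(\<lambda>n. \<integral>\<omega>. (\<integral>y. g y \<partial>gauss m (posvec (?v n \<omega>))) \<partial>M) \<longlonglongrightarrow> (\<integral>\<omega>. (\<integral>y. g y \<partial>gauss m (scale lam \<sigma> s t \<omega>)) \<partial>M)"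
  proof (rule integral_dominated_convergence[where w="\<lambda>_. b"])
    show "(\<lambda>\<omega>. \<integral>y. g y \<partial>gauss m (scale lam \<sigma> s t \<omega>)) \<in> borel_measurable M"
      by (rule integral_gauss_measurable[OF g(1) measurable_const scale_measurable[OF st]]) (simp_all add: scale_def posvec_pos)
    show "(\<lambda>\<omega>. \<integral>y. g y \<partial>gauss m (posvec (?v n \<omega>))) \<in> borel_measurable M" for n
      unfolding v by (rule integral_gauss_measurable[OF g(1) measurable_const measurable_compose[OF vec_lambda_measurable posvec_measurable] posvec_pos]) auto
    have "AE \<omega> in M. \<forall>j. 0 < clock (2 * lam j) s t \<omega>"
      unfolding AE_all_countable by (intro allI clock_pos st) (simp add: lam less_imp_le)
    then show "AE \<omega> in M. (\<lambda>n. \<integral>y. g y \<partial>gauss m (posvec (?v n \<omega>))) \<longlonglongrightarrow> (\<integral>y. g y \<partial>gauss m (scale lam \<sigma> s t \<omega>))"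
      using clock_sum_tendsto[OF st]
    proof eventually_elim
      case (elim \<omega>)
      have pos: "0 < sqrt ((\<sigma> j)\<^sup>2 * clock (2 * lam j) s t \<omega>)" for j
        using elim(1) \<sigma>[of j] by simp
      have "(\<lambda>n. posvec (?v n \<omega>)) \<longlonglongrightarrow> scale lam \<sigma> s t \<omega>"
        unfolding v scale_def posvec_def
      proof (rule tendsto_vec_lambda)
        fix j
        have c: "(\<lambda>n. sqrt ((\<sigma> j)\<^sup>2 * clock_sum n (2 * lam j) s t \<omega>)) \<longlonglongrightarrow> sqrt ((\<sigma> j)\<^sup>2 * clock (2 * lam j) s t \<omega>)"
          using elim(2) by (intro tendsto_intros) blast
        \<comment> \<open>\<open>posvec\<close> is discontinuous at 0, but the limit is positive, so
          the repair is eventually inactive.\<close>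
        have "eventually (\<lambda>n. sqrt ((\<sigma> j)\<^sup>2 * clock_sum n (2 * lam j) s t \<omega>) =
          (if (\<chi> j. sqrt ((\<sigma> j)\<^sup>2 * clock_sum n (2 * lam j) s t \<omega>)) $ j > 0 then (\<chi> j. sqrt ((\<sigma> j)\<^sup>2 * clock_sum n (2 * lam j) s t \<omega>)) $ j else 1)) sequentially"
          using order_tendstoD(1)[OF c pos] by eventually_elim simp
        from Lim_transform_eventually[OF c this] show "(\<lambda>n. if (\<chi> j. sqrt ((\<sigma> j)\<^sup>2 * clock_sum n (2 * lam j) s t \<omega>)) $ j > 0 then (\<chi> j. sqrt ((\<sigma> j)\<^sup>2 * clock_sum n (2 * lam j) s t \<omega>)) $ j else 1)
          \<longlonglongrightarrow> (if (\<chi> j. sqrt ((\<sigma> j)\<^sup>2 * clock (2 * lam j) s t \<omega>)) $ j > 0 then (\<chi> j. sqrt ((\<sigma> j)\<^sup>2 * clock (2 * lam j) s t \<omega>)) $ j else 1)"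
          using pos[of j] by simp
      qed
      then show ?case
        by (intro integral_gauss_tendsto tendsto_const g(1)) (simp_all add: scale_def posvec_pos)
    qed
    show "AE \<omega> in M. norm (\<integral>y. g y \<partial>gauss m (posvec (?v n \<omega>))) \<le> b" for n
      using integral_gauss_bound[OF posvec_pos gm b] by auto
  qed auto
  from lim1 lim2 show ?thesis unfolding eq by (rule LIMSEQ_unique)
qed

text \<open>Both sides integrate \<phi> against a finite measure, the law of \<open>X\<close> and
  the average of the Gaussians over \<omega>. Continuous functions already identify the two
  measures.\<close>

lemma integral_mixture:
  fixes m :: "real ^ 'n" and lam \<sigma> :: "'n \<Rightarrow> real"
  assumes st: "0 \<le> s" "s < t" and lam: "\<And>j. lam j > 0" and \<sigma>: "\<And>j. \<sigma> j > 0"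
    and Z: "X \<in> borel_measurable M" "AE \<omega> in M. X \<omega> = (\<chi> j. m $ j + \<sigma> j * noise j (lam j) s t \<omega>)"
    and \<phi>: "\<phi> \<in> bounded_borel"
  shows "(\<integral>\<omega>. \<phi> (X \<omega>) \<partial>M) = (\<integral>\<omega>. (\<integral>y. \<phi> y \<partial>gauss m (scale lam \<sigma> s t \<omega>)) \<partial>M)"
proof -
  let ?G = "\<lambda>\<omega>. gauss m (scale lam \<sigma> s t \<omega>)"
  have pos: "scale lam \<sigma> s t \<omega> $ j > 0" for \<omega> j by (simp add: scale_def posvec_pos)
  have pg: "prob_space (?G \<omega>)" for \<omega> using pos by (rule prob_space_gauss)
  have ker: "?G \<in> M \<rightarrow>\<^sub>M subprob_algebra borel"
  proof (rule measurable_subprob_algebra)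
    fix A :: "(real ^ 'n) set" assume A: "A \<in> sets borel"
    then have ib: "indicator A \<in> bounded_borel"
      by (auto simp: bounded_borel_def bounded_iff intro!: exI[of _ 1] simp: indicator_def)
    have "emeasure (?G \<omega>) A = ennreal (\<integral>y. indicator A y \<partial>?G \<omega>)" for \<omega>
      using A finite_measure.emeasure_eq_measure[OF prob_space.finite_measure[OF pg]] by simp
    moreover have "(\<lambda>\<omega>. \<integral>y. (indicator A y :: real) \<partial>?G \<omega>) \<in> borel_measurable M"
      by (rule integral_gauss_measurable[where m="\<lambda>_. m", OF ib _ scale_measurable[OF st] pos]) simp
    ultimately show "(\<lambda>\<omega>. emeasure (?G \<omega>) A) \<in> borel_measurable M" by simp
  qed (auto intro: prob_space_imp_subprob_space pg)
  have b1: "AE \<omega> in M. emeasure (?G \<omega>) (space (?G \<omega>)) \<le> ennreal 1"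
    using prob_space.emeasure_space_1[OF pg] by simp
  have ib: "(\<integral>y. \<phi> y \<partial>(M \<bind> ?G)) = (\<integral>\<omega>. (\<integral>y. \<phi> y \<partial>?G \<omega>) \<partial>M)" if \<phi>: "\<phi> \<in> bounded_borel" for \<phi>
  proof -
    obtain b where b: "\<And>y. \<bar>\<phi> y\<bar> \<le> b" using \<phi> by (auto simp: bounded_borel_def bounded_iff)
    show ?thesis
      by (rule integral_bind[OF _ _ ker finite_measure_axioms b1]) (use \<phi> b in \<open>auto simp: bounded_borel_def\<close>)
  qed
  have "distr M borel X = M \<bind> ?G"
  proof (rule finite_measure_eqI_continuous)
    show "finite_measure (distr M borel X)" using Z(1) by (intro finite_measure_distr)
    have "prob_space (M \<bind> ?G)" by (rule prob_space_bind[OF _ ker]) (use pg in auto)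
    then show "finite_measure (M \<bind> ?G)" by (rule prob_space.finite_measure)
    show "sets (M \<bind> ?G) = sets borel" by (rule sets_bind[OF _ not_empty]) simp
    fix g :: "real ^ 'n \<Rightarrow> real" assume g: "continuous_on UNIV g" "\<And>x. 0 \<le> g x \<and> g x \<le> 1"
    have gb: "g \<in> bounded_borel"
      unfolding bounded_borel_def bounded_iff using g borel_measurable_continuous_onI[OF g(1)] by (auto intro!: exI[of _ 1])
    have "(\<integral>x. g x \<partial>distr M borel X) = (\<integral>\<omega>. g (X \<omega>) \<partial>M)"
      using gb Z(1) by (intro integral_distr) (auto simp: bounded_borel_def)
    also have "\<dots> = (\<integral>\<omega>. (\<integral>y. g y \<partial>?G \<omega>) \<partial>M)"
      by (rule integral_mixture_continuous[OF st lam \<sigma> Z gb g(1)])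
    finally show "(\<integral>x. g x \<partial>distr M borel X) = (\<integral>x. g x \<partial>(M \<bind> ?G))" by (simp add: ib[OF gb])
  qed simp
  then have "(\<integral>y. \<phi> y \<partial>distr M borel X) = (\<integral>\<omega>. (\<integral>y. \<phi> y \<partial>?G \<omega>) \<partial>M)" by (simp add: ib[OF \<phi>])
  then show ?thesis using \<phi> Z(1) by (subst (asm) integral_distr) (auto simp: bounded_borel_def)
qed

end

subsection \<open>The linear equation\<close>

text \<open>The indicators of the moving intervals converge except possibly at the two limiting
  endpoints, so an integrable \<open>k\<close> suffices.\<close>

lemma exp_integral_tendsto:
  fixes k :: "real \<Rightarrow> real"
  assumes k: "set_integrable lborel {0..T} k"
    and S: "S \<longlonglongrightarrow> s" "\<And>n. 0 \<le> S n" and R: "R \<longlonglongrightarrow> r" "\<And>n. R n \<le> T"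
  shows "(\<lambda>n. LINT q:{S n..R n}|lborel. exp (- c * (R n - q)) * k q) \<longlonglongrightarrow> (LINT q:{s..r}|lborel. exp (- c * (r - q)) * k q)"
proof -
  define k' where "k' q = indicator {0..T} q * k q" for q
  have ki: "integrable lborel k'" using k by (simp add: set_integrable_def k'_def[abs_def])
  then have [measurable]: "k' \<in> borel_measurable borel" by auto
  have s: "0 \<le> s" using S by (intro LIMSEQ_le_const) auto
  have r: "r \<le> T" using R by (intro LIMSEQ_le_const2) auto
  have eq: "indicator {a..b} q *\<^sub>R (exp (- c * (b - q)) * k q) = indicator {a..b} q *\<^sub>R (exp (- c * (b - q)) * k' q)"
    if "0 \<le> a" "b \<le> T" for a b q using that by (auto simp: indicator_def k'_def)
  have "(\<lambda>n. \<integral>q. indicator {S n..R n} q *\<^sub>R (exp (- c * (R n - q)) * k' q) \<partial>lborel) \<longlonglongrightarrow>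
     (\<integral>q. indicator {s..r} q *\<^sub>R (exp (- c * (r - q)) * k' q) \<partial>lborel)"
  proof (rule integral_dominated_convergence[where w="\<lambda>q. exp (\<bar>c\<bar> * T) * \<bar>k' q\<bar>"])
    show "integrable lborel (\<lambda>q. exp (\<bar>c\<bar> * T) * \<bar>k' q\<bar>)" using ki by simp
    show "AE q in lborel. norm (indicator {S n..R n} q *\<^sub>R (exp (- c * (R n - q)) * k' q)) \<le> exp (\<bar>c\<bar> * T) * \<bar>k' q\<bar>" for n
    proof (rule AE_I2)
      fix q
      show "norm (indicator {S n..R n} q *\<^sub>R (exp (- c * (R n - q)) * k' q)) \<le> exp (\<bar>c\<bar> * T) * \<bar>k' q\<bar>"
      proof (cases "q \<in> {S n..R n}")
        case True
        have "- c * (R n - q) \<le> \<bar>c\<bar> * (R n - q)" using True by (intro mult_right_mono) auto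
        also have "\<dots> \<le> \<bar>c\<bar> * T" using True S(2)[of n] R(2)[of n] by (intro mult_left_mono) auto
        finally show ?thesis using True by (auto simp: abs_mult intro!: mult_right_mono)
      qed simp
    qed
    show "AE q in lborel. (\<lambda>n. indicator {S n..R n} q *\<^sub>R (exp (- c * (R n - q)) * k' q)) \<longlonglongrightarrow>
        indicator {s..r} q *\<^sub>R (exp (- c * (r - q)) * k' q)"
    proof (rule AE_mp[OF AE_conjI[OF AE_lborel_singleton[of s] AE_lborel_singleton[of r]]], rule AE_I2, rule impI, elim conjE)
      fix q assume q: "q \<noteq> s" "q \<noteq> r"
      have e1: "eventually (\<lambda>n. (S n \<le> q) = (s \<le> q)) sequentially"
      proof (cases "s < q")
        case True
        show ?thesis using order_tendstoD(2)[OF S(1) True] by eventually_elim (use True in auto)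
      next
        case False
        then have "q < s" using q by simp
        show ?thesis using order_tendstoD(1)[OF S(1) \<open>q < s\<close>] by eventually_elim (use \<open>q < s\<close> in auto)
      qed
      have e2: "eventually (\<lambda>n. (q \<le> R n) = (q \<le> r)) sequentially"
      proof (cases "q < r")
        case True
        show ?thesis using order_tendstoD(1)[OF R(1) True] by eventually_elim (use True in auto)
      next
        case False
        then have "r < q" using q by simp
        show ?thesis using order_tendstoD(2)[OF R(1) \<open>r < q\<close>] by eventually_elim (use \<open>r < q\<close> in auto)
      qed
      have i: "(\<lambda>n. indicator {S n..R n} q :: real) \<longlonglongrightarrow> indicator {s..r} q"
        by (rule tendsto_eventually) (use e1 e2 in \<open>eventually_elim, auto simp: indicator_def\<close>)
      show "(\<lambda>n. indicator {S n..R n} q *\<^sub>R (exp (- c * (R n - q)) * k' q)) \<longlonglongrightarrow>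
        indicator {s..r} q *\<^sub>R (exp (- c * (r - q)) * k' q)"
        by (intro tendsto_intros i R(1))
    qed
  qed measurable
  then show ?thesis using S(2) R(2) s r by (simp only: set_lebesgue_integral_def eq)
qed

lemma set_integrable_vec_nth:
  fixes V :: "real \<Rightarrow> real ^ 'n"
  assumes "set_integrable lborel A V"
  shows "set_integrable lborel A (\<lambda>r. V r $ j)" and "(LINT r:A|lborel. V r) $ j = (LINT r:A|lborel. V r $ j)"
  using integrable_bounded_linear[OF bounded_linear_vec_nth, of lborel "\<lambda>r. indicator A r *\<^sub>R V r" j]
    integral_bounded_linear[OF bounded_linear_vec_nth, of lborel "\<lambda>r. indicator A r *\<^sub>R V r" j] assms
  by (simp_all add: set_integrable_def set_lebesgue_integral_def)

lemma diag_mat_mult: "(diag_mat d *v v) $ j = d j * v $ j"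
  by (simp add: diag_mat_def matrix_vector_mult_def if_distrib[of "\<lambda>x. x * _"] cong: if_cong)

lemma minus_diag_mat_mult: "((- diag_mat d) *v v) $ j = - d j * v $ j"
  by (simp add: diag_mat_def matrix_vector_mult_def if_distrib[of "\<lambda>x. - x * _"] if_distrib[of "\<lambda>x. - x"] if_distrib[of "\<lambda>x. x * _"] cong: if_cong)

text \<open>Each \<open>Z s x\<close> satisfies its equation off a null set of its own. Only the law
  of \<open>Z s x r\<close> for fixed arguments is used, so these null sets never have to be united
  over all starting points.\<close>

locale linear_equation = subordinated_bm M \<alpha> \<gamma>b L W
  for M :: "'w measure" and \<alpha> \<gamma>b :: real and L :: "real \<Rightarrow> 'w \<Rightarrow> real" and W :: "real \<Rightarrow> 'w \<Rightarrow> real ^ 'n" +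
  fixes lam \<sigma> :: "'n \<Rightarrow> real" and f :: "real \<Rightarrow> real ^ 'n" and T :: real
    and Z :: "real \<Rightarrow> real ^ 'n \<Rightarrow> real \<Rightarrow> 'w \<Rightarrow> real ^ 'n"
  assumes lam: "\<And>j. lam j > 0" and \<sigma>: "\<And>j. \<sigma> j > 0" and T: "T > 0"
    and f: "continuous_on {0..T} f"
    and Z: "\<And>s x. s \<in> {0..T} \<Longrightarrow> solves_linear_sde M (- diag_mat lam) f (diag_mat \<sigma>) (subordinated W L) T s x (Z s x)"
begin

definition mean :: "real \<Rightarrow> real \<Rightarrow> real ^ 'n \<Rightarrow> real ^ 'n" where
  "mean s r x = (\<chi> j. exp (- lam j * (r - s)) * x $ j + (LINT q:{s..r}|lborel. exp (- lam j * (r - q)) * f q $ j))"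

lemma f_component: "continuous_on {0..T} (\<lambda>q. f q $ j)"
  using f by (intro continuous_intros)

lemma Z_measurable: "0 \<le> s \<Longrightarrow> s \<le> r \<Longrightarrow> r \<le> T \<Longrightarrow> Z s x r \<in> borel_measurable M"
  using Z[of s x] by (auto simp: solves_linear_sde_def)

text \<open>The matrices are diagonal, so the equation decouples into scalar ones along almost every
  path, each solved by the variation of constants formula with the scaled increment of W_L as
  forcing.\<close>

lemma Z_decomposition:
  assumes sr: "0 \<le> s" "s < r" "r \<le> T"
  shows "AE \<omega> in M. Z s x r \<omega> = (\<chi> j. mean s r x $ j + \<sigma> j * noise j (lam j) s r \<omega>)"
proof -
  have "AE \<omega> in M. set_integrable lborel {s..T} (\<lambda>r. - diag_mat lam *v Z s x r \<omega> + f r) \<and>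
        (\<forall>t\<in>{s..T}. Z s x t \<omega> = x + (LINT r:{s..t}|lborel. - diag_mat lam *v Z s x r \<omega> + f r) +
            diag_mat \<sigma> *v (subordinated W L t \<omega> - subordinated W L s \<omega>))"
    using Z[of s x] sr by (simp add: solves_linear_sde_def)
  then show ?thesis using noise_sum_tendsto(2)[OF sr(1,2)]
  proof eventually_elim
    case (elim \<omega>)
    let ?V = "\<lambda>q. - diag_mat lam *v Z s x q \<omega> + f q"
    have VT: "set_integrable lborel {s..T} ?V" using elim by blast
    have "Z s x r \<omega> $ j = mean s r x $ j + \<sigma> j * noise j (lam j) s r \<omega>" for j
    proof -
      define y where "y q = W (L q \<omega>) \<omega> $ j" for q
      define h where "h q = \<sigma> j * (y q - y s)" for q
      let ?X = "\<lambda>q. Z s x q \<omega> $ j" and ?c = "lam j"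
      let ?e = "\<lambda>q. exp (- lam j * (r - q))"
      have yi: "set_integrable lborel {s..r} y" using elim(2) unfolding y_def[abs_def] by blast
      have Vj: "?V q $ j = - ?c * ?X q + f q $ j" for q by (simp add: minus_diag_mat_mult)
      have Vint: "set_integrable lborel {s..t} ?V" if "t \<in> {s..r}" for t
        by (rule set_integrable_subset[OF VT]) (use that sr in auto)
      have int: "set_integrable lborel {s..t} (\<lambda>q. - ?c * ?X q + f q $ j)" if "t \<in> {s..r}" for t
        using set_integrable_vec_nth(1)[OF Vint[OF that], of j] by (simp only: Vj)
      have X: "?X t = x $ j + (LINT q:{s..t}|lborel. - ?c * ?X q + f q $ j) + h t" if "t \<in> {s..r}" for t
      proof -
        have "Z s x t \<omega> = x + (LINT r:{s..t}|lborel. ?V r) + diag_mat \<sigma> *v (subordinated W L t \<omega> - subordinated W L s \<omega>)"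
          using elim(1) that sr by auto
        then have "?X t = x $ j + (LINT r:{s..t}|lborel. ?V r) $ j + (diag_mat \<sigma> *v (subordinated W L t \<omega> - subordinated W L s \<omega>)) $ j"
          by simp
        also have "(LINT r:{s..t}|lborel. ?V r) $ j = (LINT q:{s..t}|lborel. - ?c * ?X q + f q $ j)"
          using set_integrable_vec_nth(2)[OF Vint[OF that], of j] by (simp only: Vj)
        finally show ?thesis by (simp add: diag_mat_mult h_def y_def subordinated_def)
      qed
      have fc: "continuous_on {s..r} (\<lambda>q. f q $ j)"
        by (rule continuous_on_subset[OF f_component]) (use sr in auto)
      have "?X r = ?e s * x $ j + (LINT q:{s..r}|lborel. ?e q * f q $ j) + (h r - (LINT q:{s..r}|lborel. ?c * ?e q * h q))"
        by (rule variation_of_constants[OF _ _ fc int X]) (use sr lam[of j] in auto)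
      \<comment> \<open>The constant \<open>y s\<close> inside \<open>h\<close> is integrated with
        total weight 1 - exp (-lam_j (r - s)); this turns the coefficient -1 of \<open>y s\<close>
        into the discounted one in \<open>noise\<close>.\<close>
      also have "h r - (LINT q:{s..r}|lborel. ?c * ?e q * h q) = \<sigma> j * noise j ?c s r \<omega>"
      proof -
        have ey: "set_integrable lborel {s..r} (\<lambda>q. ?c * ?e q * y q)"
          using set_integrable_mult_right[OF exp_weight_fubini(2)[OF _ yi, of ?c], of ?c] sr by (simp add: mult.assoc)
        have es: "set_integrable lborel {s..r} (\<lambda>q. ?c * ?e q * y s)"
          using set_integrable_mult_left[OF integral_exp_weight(1)[of s r ?c r]] sr by simp
        have "(LINT q:{s..r}|lborel. ?c * ?e q * h q) = (LINT q:{s..r}|lborel. \<sigma> j * (?c * ?e q * y q - ?c * ?e q * y s))"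
          by (rule set_lebesgue_integral_cong) (auto simp: h_def algebra_simps)
        also have "\<dots> = \<sigma> j * (LINT q:{s..r}|lborel. ?c * ?e q * y q - ?c * ?e q * y s)"
          by (rule set_integral_mult_right)
        also have "(LINT q:{s..r}|lborel. ?c * ?e q * y q - ?c * ?e q * y s) = (LINT q:{s..r}|lborel. ?c * ?e q * y q) - (LINT q:{s..r}|lborel. ?c * ?e q * y s)"
          by (rule set_integral_diff(2)[OF ey es])
        also have "(LINT q:{s..r}|lborel. ?c * ?e q * y s) = (LINT q:{s..r}|lborel. ?c * ?e q) * y s"
          by (rule set_integral_mult_left)
        also have "(LINT q:{s..r}|lborel. ?c * ?e q) = 1 - ?e s"
          using integral_exp_weight(2)[of s r ?c r] sr by simp
        finally have I: "(LINT q:{s..r}|lborel. ?c * ?e q * h q) = \<sigma> j * ((LINT q:{s..r}|lborel. ?c * ?e q * y q) - (1 - ?e s) * y s)" .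
        show ?thesis unfolding I unfolding noise_def h_def y_def[symmetric] by (simp add: algebra_simps)
      qed
      finally show ?thesis by (simp add: mean_def)
    qed
    then show ?case by (simp add: vec_eq_iff)
  qed
qed

lemma transition_op_mixture:
  assumes sr: "0 \<le> s" "s < r" "r \<le> T" and \<phi>: "\<phi> \<in> bounded_borel"
  shows "transition_op M Z s r \<phi> x = (\<integral>\<omega>. (\<integral>y. \<phi> y \<partial>gauss (mean s r x) (scale lam \<sigma> s r \<omega>)) \<partial>M)"
  unfolding transition_op_def
  by (rule integral_mixture[OF sr(1,2) lam \<sigma> _ Z_decomposition[OF sr] \<phi>]) (use sr Z_measurable in auto)

lemma scale_pos: "scale lam \<sigma> s r \<omega> $ j > 0"
  by (simp add: scale_def posvec_pos)

lemma scale_eq: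
  assumes "0 \<le> s" "s < r"
  shows "AE \<omega> in M. \<forall>j. scale lam \<sigma> s r \<omega> $ j = \<sigma> j * sqrt (clock (2 * lam j) s r \<omega>) \<and> 0 < clock (2 * lam j) s r \<omega>"
proof -
  have "AE \<omega> in M. \<forall>j. 0 < clock (2 * lam j) s r \<omega>"
    unfolding AE_all_countable by (intro allI clock_pos assms) (simp add: lam less_imp_le)
  then show ?thesis
  proof eventually_elim
    case (elim \<omega>)
    then show ?case using \<sigma> by (auto simp: scale_def posvec_def real_sqrt_mult less_imp_le)
  qed
qed

lemma mean_tendsto:
  assumes "S \<longlonglongrightarrow> s" "R \<longlonglongrightarrow> r" "X \<longlonglongrightarrow> x" "\<And>n. 0 \<le> S n" "\<And>n. R n \<le> T"
  shows "(\<lambda>n. mean (S n) (R n) (X n)) \<longlonglongrightarrow> mean s r x"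
  unfolding mean_def
  using borel_integrable_atLeastAtMost'[OF f_component]
  by (intro tendsto_vec_lambda tendsto_intros exp_integral_tendsto[where T=T] assms)

text \<open>The limit times \<open>s\<close> and \<open>r\<close> are fixed, so L is almost surely
  continuous at both, from either side; the sequences may approach them from any direction.\<close>

lemma clock_tendsto:
  assumes S: "S \<longlonglongrightarrow> s" "\<And>n. 0 \<le> S n" and R: "R \<longlonglongrightarrow> r" "\<And>n. R n \<le> T" and SR: "\<And>n. S n < R n"
    and s: "0 \<le> s" "s < r" "r \<le> T"
  shows "AE \<omega> in M. \<forall>c. (\<lambda>n. clock c (S n) (R n) \<omega>) \<longlonglongrightarrow> clock c s r \<omega>"
  using no_fixed_jump[OF s(1)] no_fixed_jump[of r, OF order_trans[OF s(1) less_imp_le[OF s(2)]]] L_mono L_nonneg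
proof (eventually_elim, intro allI)
  fix \<omega> c
  assume c1: "isCont (\<lambda>t. L (max 0 t) \<omega>) s" and c2: "isCont (\<lambda>t. L (max 0 t) \<omega>) r"
    and m: "mono_on {0..} (\<lambda>t. L t \<omega>)" and nn: "\<forall>t\<ge>0. 0 \<le> L t \<omega>"
  have Rn: "0 \<le> R n" for n using S(2)[of n] SR[of n] by simp
  have l1: "(\<lambda>n. L (S n) \<omega>) \<longlonglongrightarrow> L s \<omega>"
    using isCont_tendsto_compose[OF c1 S(1)] S(2) s by simp
  have l2: "(\<lambda>n. L (R n) \<omega>) \<longlonglongrightarrow> L r \<omega>"
    using isCont_tendsto_compose[OF c2 R(1)] Rn s by simp
  have i: "set_integrable lborel {0..T} (\<lambda>q. c * L q \<omega>)"
    using time_changed_path(2)[OF m _ continuous_on_id order_refl T] nn by (intro set_integrable_mult_right) simp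
  have "(\<lambda>n. L (R n) \<omega> - exp (- c * (R n - S n)) * L (S n) \<omega> - (LINT q:{S n..R n}|lborel. exp (- c * (R n - q)) * (c * L q \<omega>)))
    \<longlonglongrightarrow> L r \<omega> - exp (- c * (r - s)) * L s \<omega> - (LINT q:{s..r}|lborel. exp (- c * (r - q)) * (c * L q \<omega>))"
    by (intro tendsto_intros l1 l2 S R exp_integral_tendsto[OF i])
  moreover have "exp (- c * (b - q)) * (c * L q \<omega>) = c * exp (- c * (b - q)) * L q \<omega>" for b q by simp
  ultimately show "(\<lambda>n. clock c (S n) (R n) \<omega>) \<longlonglongrightarrow> clock c s r \<omega>"
    unfolding clock_def by (simp only:)
qed

text \<open>For almost every \<omega> the mean and the deviations converge, hence so does the
  Gaussian integral of the Borel function \<phi>; its sup bound is the majorant.\<close>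

lemma transition_op_continuous:
  assumes \<phi>: "\<phi> \<in> bounded_borel"
  shows "continuous_on {(s, r, x). 0 \<le> s \<and> s < r \<and> r \<le> T} (\<lambda>(s, r, x). transition_op M Z s r \<phi> x)"
proof (unfold continuous_on_sequentially, intro allI ballI impI, elim conjE)
  fix P p
  assume p: "p \<in> {(s, r, x :: real ^ 'n). 0 \<le> s \<and> s < r \<and> r \<le> T}"
    and P: "\<forall>n. P n \<in> {(s, r, x :: real ^ 'n). 0 \<le> s \<and> s < r \<and> r \<le> T}" "P \<longlonglongrightarrow> p"
  obtain s r x where sr: "p = (s, r, x)" "0 \<le> s" "s < r" "r \<le> T" using p by auto
  define S R X where "S n = fst (P n)" and "R n = fst (snd (P n))" and "X n = snd (snd (P n))" for n
  have Pn: "P n = (S n, R n, X n)" for n by (simp add: S_def R_def X_def)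
  have SR: "0 \<le> S n" "S n < R n" "R n \<le> T" for n using P(1) by (auto simp: Pn)
  have lim: "S \<longlonglongrightarrow> s" "R \<longlonglongrightarrow> r" "X \<longlonglongrightarrow> x"
    unfolding S_def R_def X_def using tendsto_fst[OF P(2)] tendsto_fst[OF tendsto_snd[OF P(2)]] tendsto_snd[OF tendsto_snd[OF P(2)]] sr
    by simp_all
  have pm [measurable]: "\<phi> \<in> borel_measurable borel" using \<phi> by (simp add: bounded_borel_def)
  obtain b where b: "\<And>y. \<bar>\<phi> y\<bar> \<le> b" using \<phi> by (auto simp: bounded_borel_def bounded_iff)
  have "(\<lambda>n. \<integral>\<omega>. (\<integral>y. \<phi> y \<partial>gauss (mean (S n) (R n) (X n)) (scale lam \<sigma> (S n) (R n) \<omega>)) \<partial>M) \<longlonglongrightarrow>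
     (\<integral>\<omega>. (\<integral>y. \<phi> y \<partial>gauss (mean s r x) (scale lam \<sigma> s r \<omega>)) \<partial>M)"
  proof (rule integral_dominated_convergence[where w="\<lambda>_. b"])
    show "(\<lambda>\<omega>. \<integral>y. \<phi> y \<partial>gauss (mean s r x) (scale lam \<sigma> s r \<omega>)) \<in> borel_measurable M"
      by (rule integral_gauss_measurable[OF \<phi> measurable_const scale_measurable[OF sr(2,3)] scale_pos]) simp
    show "(\<lambda>\<omega>. \<integral>y. \<phi> y \<partial>gauss (mean (S n) (R n) (X n)) (scale lam \<sigma> (S n) (R n) \<omega>)) \<in> borel_measurable M" for n
      by (rule integral_gauss_measurable[OF \<phi> measurable_const scale_measurable[OF SR(1,2)] scale_pos]) simp
    show "AE \<omega> in M. norm (\<integral>y. \<phi> y \<partial>gauss (mean (S n) (R n) (X n)) (scale lam \<sigma> (S n) (R n) \<omega>)) \<le> b" for n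
      using integral_gauss_bound[OF scale_pos pm b] by auto
    \<comment> \<open>The deviations have the unrepaired form off a null set for each
      \<open>n\<close>; countably many such sets are united.\<close>
    have "AE \<omega> in M. \<forall>n j. scale lam \<sigma> (S n) (R n) \<omega> $ j = \<sigma> j * sqrt (clock (2 * lam j) (S n) (R n) \<omega>) \<and> 0 < clock (2 * lam j) (S n) (R n) \<omega>"
      by (subst AE_all_countable) (use scale_eq[OF SR(1,2)] in blast)
    then show "AE \<omega> in M. (\<lambda>n. \<integral>y. \<phi> y \<partial>gauss (mean (S n) (R n) (X n)) (scale lam \<sigma> (S n) (R n) \<omega>)) \<longlonglongrightarrow>
        (\<integral>y. \<phi> y \<partial>gauss (mean s r x) (scale lam \<sigma> s r \<omega>))"
      using scale_eq[OF sr(2,3)] clock_tendsto[OF lim(1) SR(1) lim(2) SR(3) SR(2) sr(2-4)]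
    proof eventually_elim
      case (elim \<omega>)
      have "(\<lambda>n. (\<chi> j. \<sigma> j * sqrt (clock (2 * lam j) (S n) (R n) \<omega>)) :: real ^ 'n) \<longlonglongrightarrow> (\<chi> j. \<sigma> j * sqrt (clock (2 * lam j) s r \<omega>))"
        using elim(3) by (intro tendsto_vec_lambda tendsto_intros) blast
      moreover have "(\<chi> j. \<sigma> j * sqrt (clock (2 * lam j) (S n) (R n) \<omega>)) = scale lam \<sigma> (S n) (R n) \<omega>" for n
        using elim(1) by (simp add: vec_eq_iff)
      moreover have "(\<chi> j. \<sigma> j * sqrt (clock (2 * lam j) s r \<omega>)) = scale lam \<sigma> s r \<omega>"
        using elim(2) by (simp add: vec_eq_iff)
      ultimately have "(\<lambda>n. scale lam \<sigma> (S n) (R n) \<omega>) \<longlonglongrightarrow> scale lam \<sigma> s r \<omega>" by simp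
      then show ?case
        by (intro integral_gauss_tendsto mean_tendsto lim SR scale_pos \<phi>)
    qed
  qed auto
  then show "((\<lambda>(s, r, x). transition_op M Z s r \<phi> x) \<circ> P) \<longlonglongrightarrow> (case p of (s, r, x) \<Rightarrow> transition_op M Z s r \<phi> x)"
    using transition_op_mixture[OF _ _ _ \<phi>] SR sr by (simp add: Pn o_def)
qed

section \<open>The gradient estimate and its constant\<close>

definition smoothing_const :: real where
  "smoothing_const = (\<Sum>i\<in>UNIV. exp (lam i * T) / \<sigma> i) * (\<integral>\<omega>. 1 / sqrt (L 1 \<omega>) \<partial>M)"

lemma smoothing_const_nonneg: "smoothing_const \<ge> 0"
proof -
  have "(\<integral>\<omega>. 1 / sqrt (L 1 \<omega>) \<partial>M) \<ge> 0"
    using L1_pos by (intro integral_nonneg_AE) (auto elim: eventually_mono)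
  moreover have "(\<Sum>i\<in>UNIV. exp (lam i * T) / \<sigma> i) \<ge> 0" by (intro sum_nonneg divide_nonneg_nonneg) (simp_all add: \<sigma> less_imp_le)
  ultimately show ?thesis by (simp add: smoothing_const_def)
qed

text \<open>The lower bound for the clock with rate \<open>2 * lam i\<close> gives, after the square
  root, a deviation of at least \<sigma>_i exp (-lam_i (r - s)) sqrt (L r - L s), and r - s is at
  most T. This is the origin of the factors exp (lam_i T) / \<sigma>_i in
  \<open>smoothing_const\<close>; the power of r - s comes from scaling.\<close>

lemma inverse_scale:
  assumes sr: "0 \<le> s" "s < r" "r \<le> T"
  shows "integrable M (\<lambda>\<omega>. \<Sum>i\<in>UNIV. 1 / scale lam \<sigma> s r \<omega> $ i)"
    and "(\<integral>\<omega>. (\<Sum>i\<in>UNIV. 1 / scale lam \<sigma> s r \<omega> $ i) \<partial>M) \<le> smoothing_const * (r - s) powr (- (1 / (2 * \<alpha>)))"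
proof -
  have [measurable]: "scale lam \<sigma> s r \<in> borel_measurable M" by (rule scale_measurable[OF sr(1,2)])
  have sm [measurable]: "(\<lambda>\<omega>. scale lam \<sigma> s r \<omega> $ i) \<in> borel_measurable M" for i
    by (rule measurable_compose[OF _ vec_nth_measurable]) measurable
  let ?K = "\<lambda>i. exp (lam i * T) / \<sigma> i"
  have lb: "AE \<omega> in M. \<forall>i. exp (- (2 * lam i) * (r - s)) * (L r \<omega> - L s \<omega>) \<le> clock (2 * lam i) s r \<omega>"
    unfolding AE_all_countable by (intro allI clock_lower_bound sr(1,2)) (simp add: lam less_imp_le)
  have le: "AE \<omega> in M. \<forall>i. 1 / scale lam \<sigma> s r \<omega> $ i \<le> ?K i * (1 / sqrt (L r \<omega> - L s \<omega>))"
    using lb scale_eq[OF sr(1,2)] increment_pos[OF sr(1,2)]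
  proof (eventually_elim, intro allI)
    fix \<omega> i
    assume lb: "\<forall>i. exp (- (2 * lam i) * (r - s)) * (L r \<omega> - L s \<omega>) \<le> clock (2 * lam i) s r \<omega>"
      and sc: "\<forall>j. scale lam \<sigma> s r \<omega> $ j = \<sigma> j * sqrt (clock (2 * lam j) s r \<omega>) \<and> 0 < clock (2 * lam j) s r \<omega>"
      and inc: "L s \<omega> < L r \<omega>"
    have "exp (- (lam i * T)) * sqrt (L r \<omega> - L s \<omega>) \<le> exp (- lam i * (r - s)) * sqrt (L r \<omega> - L s \<omega>)"
      using lam[of i] sr inc by (intro mult_right_mono) (auto intro!: mult_left_mono)
    also have "\<dots> = sqrt (exp (- (2 * lam i) * (r - s)) * (L r \<omega> - L s \<omega>))"
    proof -
      have "exp (- (2 * lam i) * (r - s)) = (exp (- lam i * (r - s)))\<^sup>2"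
        by (simp add: exp_double[symmetric] mult_ac)
      then show ?thesis by (simp add: real_sqrt_mult)
    qed
    also have "\<dots> \<le> sqrt (clock (2 * lam i) s r \<omega>)" using lb by simp
    finally have "\<sigma> i * (exp (- (lam i * T)) * sqrt (L r \<omega> - L s \<omega>)) \<le> scale lam \<sigma> s r \<omega> $ i"
      using sc \<sigma>[of i] by (simp add: mult_left_mono)
    moreover have "0 < \<sigma> i * (exp (- (lam i * T)) * sqrt (L r \<omega> - L s \<omega>))" using \<sigma>[of i] inc by simp
    ultimately have "1 / scale lam \<sigma> s r \<omega> $ i \<le> 1 / (\<sigma> i * (exp (- (lam i * T)) * sqrt (L r \<omega> - L s \<omega>)))"
      by (intro divide_left_mono mult_pos_pos scale_pos \<sigma>) (auto simp: inc)
    also have "\<dots> = ?K i * (1 / sqrt (L r \<omega> - L s \<omega>))" by (simp add: exp_minus field_simps)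
    finally show "1 / scale lam \<sigma> s r \<omega> $ i \<le> ?K i * (1 / sqrt (L r \<omega> - L s \<omega>))" .
  qed
  have ib: "integrable M (\<lambda>\<omega>. \<Sum>i\<in>UNIV. ?K i * (1 / sqrt (L r \<omega> - L s \<omega>)))"
    using inverse_sqrt_increment(1)[OF sr(1,2)] by (intro Bochner_Integration.integrable_sum integrable_mult_right)
  have sle: "AE \<omega> in M. (\<Sum>i\<in>UNIV. 1 / scale lam \<sigma> s r \<omega> $ i) \<le> (\<Sum>i\<in>UNIV. ?K i * (1 / sqrt (L r \<omega> - L s \<omega>)))"
    using le by eventually_elim (auto intro!: sum_mono)
  have nn: "0 \<le> (\<Sum>i\<in>UNIV. 1 / scale lam \<sigma> s r \<omega> $ i)" for \<omega>
    by (intro sum_nonneg divide_nonneg_nonneg) (simp_all add: scale_pos less_imp_le)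
  show i: "integrable M (\<lambda>\<omega>. \<Sum>i\<in>UNIV. 1 / scale lam \<sigma> s r \<omega> $ i)"
  proof (rule Bochner_Integration.integrable_bound[OF ib])
    show "AE \<omega> in M. norm (\<Sum>i\<in>UNIV. 1 / scale lam \<sigma> s r \<omega> $ i) \<le> norm (\<Sum>i\<in>UNIV. ?K i * (1 / sqrt (L r \<omega> - L s \<omega>)))"
      using sle by eventually_elim (use nn in \<open>auto intro: order_trans[OF _ abs_ge_self]\<close>)
  qed measurable
  have "(\<integral>\<omega>. (\<Sum>i\<in>UNIV. 1 / scale lam \<sigma> s r \<omega> $ i) \<partial>M) \<le> (\<integral>\<omega>. (\<Sum>i\<in>UNIV. ?K i * (1 / sqrt (L r \<omega> - L s \<omega>))) \<partial>M)"
    by (rule integral_mono_AE[OF i ib sle])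
  also have "\<dots> = (\<Sum>i\<in>UNIV. ?K i) * (\<integral>\<omega>. 1 / sqrt (L r \<omega> - L s \<omega>) \<partial>M)"
    by (simp only: sum_distrib_right[symmetric] integral_mult_right_zero)
  also have "\<dots> = smoothing_const * (r - s) powr (- (1 / (2 * \<alpha>)))"
    by (simp only: inverse_sqrt_increment(2)[OF sr(1,2)] smoothing_const_def) (simp only: mult_ac)
  finally show "(\<integral>\<omega>. (\<Sum>i\<in>UNIV. 1 / scale lam \<sigma> s r \<omega> $ i) \<partial>M) \<le> smoothing_const * (r - s) powr (- (1 / (2 * \<alpha>)))" .
qed

text \<open>Differentiation under the expectation of the Gaussian integral, with the sum of inverse
  deviations as majorant. The starting point enters only through the mean, by the chain
  rule.\<close>

lemma transition_op_smooth:
  assumes sr: "0 \<le> s" "s < r" "r \<le> T" and \<phi>: "\<phi> \<in> bounded_borel" and c: "\<And>y. \<bar>\<phi> y\<bar> \<le> c"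
  shows "\<exists>g. continuous_on UNIV g \<and> (\<forall>x. (transition_op M Z s r \<phi> has_derivative (\<lambda>k. g x \<bullet> k)) (at x)) \<and>
         (\<forall>x. norm (g x) \<le> smoothing_const * c * (r - s) powr (- (1 / (2 * \<alpha>))))"
proof -
  have pm: "\<phi> \<in> borel_measurable borel" using \<phi> by (simp add: bounded_borel_def)
  have c0: "c \<ge> 0" using c abs_ge_zero order_trans by blast
  let ?a = "\<lambda>\<omega>. scale lam \<sigma> s r \<omega>"
  define D where "D m a = (\<integral>y. (\<phi> y * gauss_density m a y) *\<^sub>R score m a y \<partial>lborel)" for m a :: "real ^ 'n"
  note DG = integral_gauss_gradient[OF _ \<phi>, folded D_def]
  \<comment> \<open>The diagonal of the linear part of \<open>mean\<close>. Its entries lie between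
    0 and 1, so the chain rule does not enlarge the gradient.\<close>
  define e where "e j = exp (- lam j * (r - s))" for j
  have e: "0 \<le> e j" "e j \<le> 1" for j using lam[of j] sr by (auto simp: e_def mult_nonneg_nonneg)
  define h where "h x \<omega> = (\<integral>y. \<phi> y \<partial>gauss (mean s r x) (?a \<omega>))" for x \<omega>
  define g where "g x \<omega> = (\<chi> j. e j * D (mean s r x) (?a \<omega>) $ j)" for x \<omega>
  define b where "b \<omega> = c * (\<Sum>i\<in>UNIV. 1 / ?a \<omega> $ i)" for \<omega>
  have mean_der: "(mean s r has_derivative (\<lambda>k. \<chi> j. e j * k $ j)) (at x)" for x
  proof -
    have "linear (\<lambda>k :: real ^ 'n. (\<chi> j. e j * k $ j) :: real ^ 'n)"
      by (auto intro!: linearI simp: vec_eq_iff algebra_simps)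
    then have "((\<lambda>k :: real ^ 'n. \<chi> j. e j * k $ j) has_derivative (\<lambda>k. \<chi> j. e j * k $ j)) (at x)"
      by (intro bounded_linear_imp_has_derivative) (simp add: linear_conv_bounded_linear)
    from has_derivative_add_const[OF this, of "\<chi> j. LINT q:{s..r}|lborel. exp (- lam j * (r - q)) * f q $ j"]
    show ?thesis by (rule back_subst[where P="\<lambda>F. (F has_derivative _) _"]) (simp add: fun_eq_iff vec_eq_iff mean_def e_def)
  qed
  have der: "((\<lambda>x. h x \<omega>) has_derivative (\<lambda>k. g x \<omega> \<bullet> k)) (at x)" for x \<omega>
  proof -
    have "((\<lambda>x. h x \<omega>) has_derivative (\<lambda>k. D (mean s r x) (?a \<omega>) \<bullet> (\<chi> j. e j * k $ j))) (at x)"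
      unfolding h_def
      by (rule has_derivative_compose[OF mean_der, of "\<lambda>m. \<integral>y. \<phi> y \<partial>gauss m (?a \<omega>)"]) (rule DG(1)[OF scale_pos])
    then show ?thesis by (rule has_derivative_eq_rhs) (auto simp: g_def inner_vec_def mult_ac)
  qed
  have bnd: "norm (g x \<omega>) \<le> b \<omega>" for x \<omega>
  proof -
    have "norm (g x \<omega>) \<le> norm (D (mean s r x) (?a \<omega>))"
    proof (rule norm_le_componentwise_cart)
      show "norm (g x \<omega> $ i) \<le> norm (D (mean s r x) (?a \<omega>) $ i)" for i
        using e[of i] by (simp add: g_def abs_mult mult_left_le_one_le)
    qed
    also have "\<dots> \<le> b \<omega>" unfolding b_def by (rule DG(3)[OF scale_pos c])
    finally show ?thesis .
  qed
  have hi: "integrable M (h x)" for x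
    unfolding h_def
  proof (rule integrable_const_bound[of _ c])
    show "(\<lambda>\<omega>. \<integral>y. \<phi> y \<partial>gauss (mean s r x) (?a \<omega>)) \<in> borel_measurable M"
      by (rule integral_gauss_measurable[OF \<phi> measurable_const scale_measurable[OF sr(1,2)] scale_pos]) simp
    show "AE \<omega> in M. norm (\<integral>y. \<phi> y \<partial>gauss (mean s r x) (?a \<omega>)) \<le> c"
      using integral_gauss_bound[OF scale_pos pm c] by auto
  qed
  have bi: "integrable M b" unfolding b_def using inverse_scale(1)[OF sr] by (intro integrable_mult_right)
  have cont: "isCont (\<lambda>x. g x \<omega>) x" for x \<omega>
  proof -
    have "isCont (\<lambda>x. D (mean s r x) (?a \<omega>)) x"
      by (rule isCont_o2[OF has_derivative_continuous[OF mean_der]]) (rule DG(2)[OF scale_pos])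
    then show ?thesis unfolding g_def continuous_at_sequentially o_def
      by (auto intro!: tendsto_vec_lambda tendsto_intros)
  qed
  note dui = open_UNIV convex_UNIV UNIV_I hi der bnd bi
  have eq: "transition_op M Z s r \<phi> = (\<lambda>x. \<integral>\<omega>. h x \<omega> \<partial>M)"
    using transition_op_mixture[OF sr \<phi>] by (auto simp: h_def fun_eq_iff)
  show ?thesis
  proof (intro exI[of _ "\<lambda>x. \<integral>\<omega>. g x \<omega> \<partial>M"] conjI allI)
    show "continuous_on UNIV (\<lambda>x. \<integral>\<omega>. g x \<omega> \<partial>M)"
      unfolding continuous_on_eq_continuous_at[OF open_UNIV]
      using isCont_integral_gradient[where h=h and g=g and N=M and U=UNIV, OF dui cont] by blast
    fix x
    show "(transition_op M Z s r \<phi> has_derivative (\<lambda>k. (\<integral>\<omega>. g x \<omega> \<partial>M) \<bullet> k)) (at x)"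
      unfolding eq by (rule has_derivative_integral[where h=h and g=g and N=M and U=UNIV, OF dui])
    have "norm (\<integral>\<omega>. g x \<omega> \<partial>M) \<le> (\<integral>\<omega>. norm (g x \<omega>) \<partial>M)" by (rule integral_norm_bound)
    also have "\<dots> \<le> (\<integral>\<omega>. b \<omega> \<partial>M)"
      by (rule integral_mono[OF _ bi bnd])
         (rule integrable_norm, rule integrable_gradient[where h=h and g=g and N=M and U=UNIV, OF dui])
    also have "\<dots> = c * (\<integral>\<omega>. (\<Sum>i\<in>UNIV. 1 / ?a \<omega> $ i) \<partial>M)" unfolding b_def by (rule integral_mult_right_zero)
    also have "\<dots> \<le> c * (smoothing_const * (r - s) powr (- (1 / (2 * \<alpha>))))"
      by (intro mult_left_mono inverse_scale(2)[OF sr] c0)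
    finally show "norm (\<integral>\<omega>. g x \<omega> \<partial>M) \<le> smoothing_const * c * (r - s) powr (- (1 / (2 * \<alpha>)))"
      by (simp add: mult_ac)
  qed
qed

sublocale smoothing_kernel "transition_op M Z" "\<lambda>s r x. distr M borel (Z s x r)" T "1 / (2 * \<alpha>)" smoothing_const
proof (rule smoothing_kernel.intro)
  \<comment> \<open>\<alpha> > 1/2 says precisely that the time singularity is integrable.\<close>
  show "0 < 1 / (2 * \<alpha>)" "1 / (2 * \<alpha>) < 1" using alpha by simp_all
  show "smoothing_const \<ge> 0" by (rule smoothing_const_nonneg)
  fix s r :: real and x :: "real ^ 'n" assume sr: "0 \<le> s" "s < r" "r \<le> T"
  have Zm: "Z s x r \<in> borel_measurable M" using sr by (intro Z_measurable) auto
  show "prob_space (distr M borel (Z s x r))" using Zm by (rule prob_space_distr)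
  show "sets (distr M borel (Z s x r)) = sets borel" by simp
  fix \<phi> :: "real ^ 'n \<Rightarrow> real" assume "\<phi> \<in> bounded_borel"
  then show "transition_op M Z s r \<phi> x = (\<integral>y. \<phi> y \<partial>distr M borel (Z s x r))"
    unfolding transition_op_def using Zm by (subst integral_distr) (auto simp: bounded_borel_def)
next
  fix \<phi> :: "real ^ 'n \<Rightarrow> real" assume "\<phi> \<in> bounded_borel"
  then show "continuous_on {(s, r, x). 0 \<le> s \<and> s < r \<and> r \<le> T} (\<lambda>(s, r, x). transition_op M Z s r \<phi> x)"
    by (rule transition_op_continuous)
next
  fix s r c :: real and \<phi> :: "real ^ 'n \<Rightarrow> real"
  assume "0 \<le> s" "s < r" "r \<le> T" "\<phi> \<in> bounded_borel" "\<And>y. \<bar>\<phi> y\<bar> \<le> c"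
  then show "\<exists>g. continuous_on UNIV g \<and> (\<forall>x. (transition_op M Z s r \<phi> has_derivative (\<lambda>k. g x \<bullet> k)) (at x)) \<and>
         (\<forall>x. norm (g x) \<le> smoothing_const * c * (r - s) powr (- (1 / (2 * \<alpha>))))"
    by (rule transition_op_smooth)
qed

end

theorem theorem1:
  fixes lam \<sigma> :: "'n::{finite, linorder} \<Rightarrow> real"
    and M :: "'w measure"
    and W :: "real \<Rightarrow> 'w \<Rightarrow> (real, 'n) vec"
    and L :: "real \<Rightarrow> 'w \<Rightarrow> real"
    and f :: "real \<Rightarrow> (real, 'n) vec"
    and Z :: "real \<Rightarrow> (real, 'n) vec \<Rightarrow> real \<Rightarrow> 'w \<Rightarrow> (real, 'n) vec"
    and B :: "real \<Rightarrow> (real, 'n) vec \<Rightarrow> (real, 'n) vec"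
    and \<phi> :: "(real, 'n) vec \<Rightarrow> real"
    and T \<alpha> \<gamma>b \<gamma> t :: real
  assumes "prob_space M" and "complete_measure M"
    and "T > 0"
    and "1 / 2 < \<alpha>" and "\<alpha> < 1" and "\<gamma> = 1 / (2 * \<alpha>)" and "\<gamma>b > 0"
    and "brownian_motion M W"
    and "stable_subordinator M \<alpha> \<gamma>b L"
    and "independent_processes M L W"
    and "\<forall>n. 0 < lam n" and "mono lam"
    and "\<forall>n. (\<sigma> n)\<^sup>2 > 0"
    and "continuous_on {0..T} f"
    and "\<forall>s\<in>{0..T}. \<forall>x. solves_linear_sde M (- diag_mat lam) f
           (diag_mat (\<lambda>n. sqrt ((\<sigma> n)\<^sup>2))) (subordinated W L) T s x (Z s x)"
    and "(\<lambda>(r, x). B r x) \<in> borel_measurable (restrict_space borel ({0..T} \<times> UNIV))"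
    and "bounded ((\<lambda>(r, x). B r x) ` ({0..T} \<times> UNIV))"
    and "\<phi> \<in> bounded_borel"
    and "0 < t" and "t \<le> T"
  shows "\<exists>u. solves_kolmogorov (transition_op M Z) B \<phi> t u \<and>
             (\<lambda>s x. u (t - s) x) \<in> Lambda1 \<gamma> t \<and>
             (\<forall>v. solves_kolmogorov (transition_op M Z) B \<phi> t v \<and>
                  (\<lambda>s x. v (t - s) x) \<in> Lambda1 \<gamma> t \<longrightarrow>
                  (\<forall>s\<in>{0..t}. \<forall>x. v s x = u s x))"
proof -
  have "stable_driver M \<alpha> \<gamma>b L"
    by (intro stable_driver.intro stable_driver_axioms.intro assms(1,4,5,7,9))
  then have sub: "subordinated_bm M \<alpha> \<gamma>b L W"
    by (rule subordinated_bm.intro) (intro subordinated_bm_axioms.intro assms(2,8,10))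
  \<comment> \<open>Only the squares of \<sigma> are assumed positive; the entries of the root of Q
    are their square roots, which are positive even where \<sigma> is negative.\<close>
  interpret eq: linear_equation M \<alpha> \<gamma>b L W lam "\<lambda>n. sqrt ((\<sigma> n)\<^sup>2)" f T Z
  proof (rule linear_equation.intro[OF sub linear_equation_axioms.intro])
    show "0 < lam j" "0 < sqrt ((\<sigma> j)\<^sup>2)" for j using assms(11,13) by simp_all
    show "T > 0" "continuous_on {0..T} f" by fact+
    show "solves_linear_sde M (- diag_mat lam) f (diag_mat (\<lambda>n. sqrt ((\<sigma> n)\<^sup>2))) (subordinated W L) T s x (Z s x)"
      if "s \<in> {0..T}" for s x using assms(15) that by blast
  qed
  obtain b where b: "\<And>r x. r \<in> {0..T} \<Longrightarrow> norm (B r x) \<le> b"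
    using assms(17) by (force simp: bounded_iff)
  have "{0..T} \<times> (UNIV :: (real, 'n) vec set) \<in> sets borel"
    unfolding borel_prod[symmetric] by (intro pair_measureI) auto
  then have B: "(\<lambda>z. indicator ({0..T} \<times> UNIV) z *\<^sub>R (case z of (r, x) \<Rightarrow> B r x)) \<in> borel_measurable (borel \<Otimes>\<^sub>M borel)"
    using assms(16) by (subst (asm) borel_measurable_restrict_space_iff) (auto simp: borel_prod)
  \<comment> \<open>The drift is cut down from {0..T} to {0..<t}, the times at which a gradient is
    multiplied by it.\<close>
  have "(\<lambda>z. indicator {0..<t} (fst z) *\<^sub>R (indicator ({0..T} \<times> UNIV) z *\<^sub>R (case z of (r, x) \<Rightarrow> B r x)))
      \<in> borel_measurable (borel \<Otimes>\<^sub>M borel)"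
    by (rule borel_measurable_scaleR[OF _ B]) measurable
  then have Bm: "(\<lambda>(s, x). indicator {0..<t} s *\<^sub>R B s x) \<in> borel_measurable (borel \<Otimes>\<^sub>M borel)"
    by (rule back_subst[where P="\<lambda>f. f \<in> borel_measurable _"]) (use assms(20) in \<open>auto simp: fun_eq_iff indicator_def\<close>)
  interpret drifted_kernel "transition_op M Z" "\<lambda>s r x. distr M borel (Z s x r)" T "1 / (2 * \<alpha>)" eq.smoothing_const B t b
  proof (rule drifted_kernel.intro[OF eq.smoothing_kernel_axioms drifted_kernel_axioms.intro])
    show "0 < t" "t \<le> T" by fact+
    show "norm (B s x) \<le> b" if "s \<in> {0..<t}" for s x using that assms(20) by (intro b) auto
  qed (rule Bm)
  show ?thesis using kolmogorov_wellposed[OF assms(18)] unfolding assms(6) .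
qed

end
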